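(* Let $m$ be a positive integer, let $\bar i\in\{1,\dots,m\}$ and let $\mu=(\mu_1,\dots,\mu_m)\in\mathbb{C}^m$ satisfy $\mu_1=\dots=\mu_{\bar i}$ and $\mu_{\bar i+1}=\dots=\mu_m$, where by convention $\bar i=m$ if $\mu_1=\dots=\mu_m$. Let $V=L(\mu)$ be the simple highest weight $\mathfrak{l}$-module of highest weight $\mu$. Then the $\mathfrak{sl}(m+1)$-module $M_{\mathfrak p}(V)$ is not simple if and only if at least one of the following holds: (1) $\bar i\neq m$, $l:=\mu_{\bar i}+m+1-\bar i\in\mathbb{N}$, and $\mu_{\bar i}-\mu_{\bar i+1}\in\mathbb{C}\setminus\{0,\dots,l-1\}$; (2) $\mu_m+1\in\mathbb{N}$.
   Context: All algebras and vector spaces are over $\mathbb{C}$; $\mathbb{N}=\{1,2,\dots\}$. $E_{i,j}$ denotes the matrix unit. In $\mathfrak{sl}(m+1)$ let $\mathfrak{l}=\mathrm{span}\{E_{i,j},\ E_{i,i}-E_{m+1,m+1}\mid 1\le i\ne j\le m\}$, which is isomorphic to $\mathfrak{gl}(m)$ via $E_{i,j}\mapsto E_{i,j}$ ($i\neq j$), $E_{i,i}-E_{m+1,m+1}\mapsto E_{i,i}$. Let $\mathfrak{u}=\sum_{s=1}^m\mathbb{C}E_{s,m+1}$ and $\mathfrak{p}=\mathfrak{l}\oplus\mathfrak{u}$ (a maximal parabolic subalgebra). For $\mu\in\mathbb{C}^m$, $L(\mu)$ is the simple highest weight $\mathfrak{l}$-module generated by a vector $v_\mu$ with $E_{i,j}v_\mu=0$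 for $1\le i<j\le m$ and $(E_{i,i}-E_{m+1,m+1})v_\mu=\mu_iv_\mu$ for $1\le i\le m$. It becomes a $\mathfrak{p}$-module by letting $\mathfrak{u}$ act as zero, and $M_{\mathfrak p}(V)=U(\mathfrak{sl}(m+1))\otimes_{U(\mathfrak p)}V$ is the generalized Verma module. *)

theory Defs
  imports
    "Jordan_Normal_Form.VS_Connect"
    "HOL-Algebra.QuotRing"
    "HOL-Algebra.Generated_Groups"
    "HOL-Algebra.Free_Abelian_Groups"
begin

hide_const (open) Wellorder_Constructions.zero

section \<open>Complex Lie algebras and their modules\<close>

record 'a lie_algebra = "(complex, 'a) module" +
  lie_bracket :: "'a \<Rightarrow> 'a \<Rightarrow> 'a"

definition lie_subalgebra_on :: "'a lie_algebra \<Rightarrow> 'a set \<Rightarrow> 'a lie_algebra" where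
  "lie_subalgebra_on L K = L\<lparr>carrier := K\<rparr>"

locale lie_module =
  fixes L :: "'a lie_algebra" and V :: "(complex, 'v) module" and \<rho> :: "'a \<Rightarrow> 'v \<Rightarrow> 'v"
  assumes vectorspace: "vectorspace class_ring V"
    and act_closed: "\<lbrakk>x \<in> carrier L; v \<in> carrier V\<rbrakk> \<Longrightarrow> \<rho> x v \<in> carrier V"
    and act_add: "\<lbrakk>x \<in> carrier L; v \<in> carrier V; w \<in> carrier V\<rbrakk> \<Longrightarrow>
      \<rho> x (v \<oplus>\<^bsub>V\<^esub> w) = \<rho> x v \<oplus>\<^bsub>V\<^esub> \<rho> x w"
    and act_smult: "\<lbrakk>x \<in> carrier L; v \<in> carrier V\<rbrakk> \<Longrightarrow> \<rho> x (c \<odot>\<^bsub>V\<^esub> v) = c \<odot>\<^bsub>V\<^esub> \<rho> x v"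
    and add_act: "\<lbrakk>x \<in> carrier L; y \<in> carrier L; v \<in> carrier V\<rbrakk> \<Longrightarrow>
      \<rho> (x \<oplus>\<^bsub>L\<^esub> y) v = \<rho> x v \<oplus>\<^bsub>V\<^esub> \<rho> y v"
    and smult_act: "\<lbrakk>x \<in> carrier L; v \<in> carrier V\<rbrakk> \<Longrightarrow> \<rho> (c \<odot>\<^bsub>L\<^esub> x) v = c \<odot>\<^bsub>V\<^esub> \<rho> x v"
    and bracket_act: "\<lbrakk>x \<in> carrier L; y \<in> carrier L; v \<in> carrier V\<rbrakk> \<Longrightarrow>
      \<rho> (lie_bracket L x y) v = \<rho> x (\<rho> y v) \<ominus>\<^bsub>V\<^esub> \<rho> y (\<rho> x v)"

definition lie_submodule ::
    "'a lie_algebra \<Rightarrow> (complex, 'v) module \<Rightarrow> ('a \<Rightarrow> 'v \<Rightarrow> 'v) \<Rightarrow> 'v set \<Rightarrow> bool" where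
  "lie_submodule L V \<rho> W \<longleftrightarrow>
     VectorSpace.subspace class_ring W V \<and> (\<forall>x\<in>carrier L. \<forall>w\<in>W. \<rho> x w \<in> W)"

definition simple_lie_module ::
    "'a lie_algebra \<Rightarrow> (complex, 'v) module \<Rightarrow> ('a \<Rightarrow> 'v \<Rightarrow> 'v) \<Rightarrow> bool" where
  "simple_lie_module L V \<rho> \<longleftrightarrow>
     lie_module L V \<rho> \<and> carrier V \<noteq> {\<zero>\<^bsub>V\<^esub>} \<and>
     (\<forall>W. lie_submodule L V \<rho> W \<longrightarrow> W = {\<zero>\<^bsub>V\<^esub>} \<or> W = carrier V)"


section \<open>The universal enveloping algebra\<close>

text \<open>A copy of the type of lists that carries the monoid structure of concatenation (written
  additively), so that \<open>'a word \<Rightarrow>\<^sub>0 complex\<close> is the free associative unital algebra on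
  the letters.\<close>

datatype 'a word = Word (letters: "'a list")

instantiation word :: (type) monoid_add
begin
definition zero_word :: "'a word" where "0 = Word []"
definition plus_word :: "'a word \<Rightarrow> 'a word \<Rightarrow> 'a word" where
  "u + v = Word (letters u @ letters v)"
instance by standard (simp_all add: zero_word_def plus_word_def)
end

definition free_alg :: "'a set \<Rightarrow> ('a word \<Rightarrow>\<^sub>0 complex) ring" where
  "free_alg X = \<lparr>carrier = {f. \<forall>w\<in>Poly_Mapping.keys f. set (letters w) \<subseteq> X},
     mult = (*), one = 1, zero = 0, add = (+)\<rparr>"

definition free_gen :: "'a \<Rightarrow> 'a word \<Rightarrow>\<^sub>0 complex" where
  "free_gen x = Poly_Mapping.single (Word [x]) 1"

definition free_const :: "complex \<Rightarrow> 'a word \<Rightarrow>\<^sub>0 complex" where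
  "free_const c = Poly_Mapping.single 0 c"

text \<open>The first two families of relations turn the free algebra on the set underlying \<open>L\<close> into
  the tensor algebra of the vector space \<open>L\<close>.\<close>

definition env_ideal :: "'a lie_algebra \<Rightarrow> ('a word \<Rightarrow>\<^sub>0 complex) set" where
  "env_ideal L = genideal (free_alg (carrier L))
    ({free_gen (x \<oplus>\<^bsub>L\<^esub> y) - free_gen x - free_gen y | x y. x \<in> carrier L \<and> y \<in> carrier L} \<union>
     {free_gen (c \<odot>\<^bsub>L\<^esub> x) - free_const c * free_gen x | c x. x \<in> carrier L} \<union>
     {free_gen x * free_gen y - free_gen y * free_gen x - free_gen (lie_bracket L x y) | x y.
        x \<in> carrier L \<and> y \<in> carrier L})"

definition env_class :: "'a lie_algebra \<Rightarrow> ('a word \<Rightarrow>\<^sub>0 complex) \<Rightarrow> ('a word \<Rightarrow>\<^sub>0 complex) set" where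
  "env_class L f = env_ideal L +>\<^bsub>free_alg (carrier L)\<^esub> f"

definition env_alg :: "'a lie_algebra \<Rightarrow> ('a word \<Rightarrow>\<^sub>0 complex) set ring" where
  "env_alg L = free_alg (carrier L) Quot env_ideal L"

text \<open>The algebra homomorphism from \<open>U(K)\<close> to \<open>U(L)\<close> induced by the inclusion of a subalgebra
  \<open>K\<close> in \<open>L\<close>: the union is over representatives and all its members agree.\<close>

definition env_incl :: "'a lie_algebra \<Rightarrow> ('a word \<Rightarrow>\<^sub>0 complex) set \<Rightarrow> ('a word \<Rightarrow>\<^sub>0 complex) set" where
  "env_incl L X = (\<Union>f\<in>X. env_class L f)"

definition free_act :: "(complex, 'v) module \<Rightarrow> ('a \<Rightarrow> 'v \<Rightarrow> 'v) \<Rightarrow> ('a word \<Rightarrow>\<^sub>0 complex) \<Rightarrow> 'v \<Rightarrow> 'v" where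
  "free_act V \<rho> f v =
     (\<Oplus>\<^bsub>V\<^esub>w\<in>Poly_Mapping.keys f. Poly_Mapping.lookup f w \<odot>\<^bsub>V\<^esub> foldr \<rho> (letters w) v)"

text \<open>The action of the enveloping algebra on a Lie module; the image below is a singleton
  because the action does not depend on the representative.\<close>

definition env_act :: "(complex, 'v) module \<Rightarrow> ('a \<Rightarrow> 'v \<Rightarrow> 'v) \<Rightarrow> ('a word \<Rightarrow>\<^sub>0 complex) set \<Rightarrow> 'v \<Rightarrow> 'v" where
  "env_act V \<rho> X v = the_elem ((\<lambda>f. free_act V \<rho> f v) ` X)"


section \<open>Tensor products over a ring and induced modules\<close>

text \<open>\<open>A\<close> is a right module over the ring \<open>S\<close> via \<open>ra\<close>, and \<open>B\<close> a left module via \<open>la\<close>.\<close>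

definition tensor_rel ::
    "('s, 'x) ring_scheme \<Rightarrow> ('a, 'y) ring_scheme \<Rightarrow> ('a \<Rightarrow> 's \<Rightarrow> 'a) \<Rightarrow>
     ('b, 'z) ring_scheme \<Rightarrow> ('s \<Rightarrow> 'b \<Rightarrow> 'b) \<Rightarrow> ('a \<times> 'b \<Rightarrow>\<^sub>0 int) set" where
  "tensor_rel S A ra B la = generate (free_Abelian_group (carrier A \<times> carrier B))
    ({frag_of (a \<oplus>\<^bsub>A\<^esub> a', b) - frag_of (a, b) - frag_of (a', b) | a a' b.
        a \<in> carrier A \<and> a' \<in> carrier A \<and> b \<in> carrier B} \<union>
     {frag_of (a, b \<oplus>\<^bsub>B\<^esub> b') - frag_of (a, b) - frag_of (a, b') | a b b'.
        a \<in> carrier A \<and> b \<in> carrier B \<and> b' \<in> carrier B} \<union>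
     {frag_of (ra a s, b) - frag_of (a, la s b) | a s b.
        a \<in> carrier A \<and> s \<in> carrier S \<and> b \<in> carrier B})"

text \<open>The tensor product, as an abelian group in multiplicative notation.\<close>

definition tensor_prod ::
    "('s, 'x) ring_scheme \<Rightarrow> ('a, 'y) ring_scheme \<Rightarrow> ('a \<Rightarrow> 's \<Rightarrow> 'a) \<Rightarrow>
     ('b, 'z) ring_scheme \<Rightarrow> ('s \<Rightarrow> 'b \<Rightarrow> 'b) \<Rightarrow> ('a \<times> 'b \<Rightarrow>\<^sub>0 int) set monoid" where
  "tensor_prod S A ra B la = free_Abelian_group (carrier A \<times> carrier B) Mod tensor_rel S A ra B la"

text \<open>The data defining \<open>U(L) \<otimes>\<^bsub>U(K)\<^esub> V\<close> for a subalgebra \<open>K\<close> of \<open>L\<close> and a \<open>K\<close>-module \<open>V\<close>.\<close>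

definition ind_rel ::
    "'a lie_algebra \<Rightarrow> 'a lie_algebra \<Rightarrow> (complex, 'v) module \<Rightarrow> ('a \<Rightarrow> 'v \<Rightarrow> 'v) \<Rightarrow>
     (('a word \<Rightarrow>\<^sub>0 complex) set \<times> 'v \<Rightarrow>\<^sub>0 int) set" where
  "ind_rel L K V \<rho> =
     tensor_rel (env_alg K) (env_alg L) (\<lambda>a s. a \<otimes>\<^bsub>env_alg L\<^esub> env_incl L s) V (env_act V \<rho>)"

definition ind_group ::
    "'a lie_algebra \<Rightarrow> 'a lie_algebra \<Rightarrow> (complex, 'v) module \<Rightarrow> ('a \<Rightarrow> 'v \<Rightarrow> 'v) \<Rightarrow>
     (('a word \<Rightarrow>\<^sub>0 complex) set \<times> 'v \<Rightarrow>\<^sub>0 int) set monoid" where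
  "ind_group L K V \<rho> =
     tensor_prod (env_alg K) (env_alg L) (\<lambda>a s. a \<otimes>\<^bsub>env_alg L\<^esub> env_incl L s) V (env_act V \<rho>)"

text \<open>Left multiplication \<open>a \<otimes> v \<mapsto> u a \<otimes> v\<close> by \<open>u \<in> U(L)\<close>, extended additively and passed to
  cosets.\<close>

definition ind_mult ::
    "'a lie_algebra \<Rightarrow> 'a lie_algebra \<Rightarrow> (complex, 'v) module \<Rightarrow> ('a \<Rightarrow> 'v \<Rightarrow> 'v) \<Rightarrow>
     ('a word \<Rightarrow>\<^sub>0 complex) set \<Rightarrow>
     (('a word \<Rightarrow>\<^sub>0 complex) set \<times> 'v \<Rightarrow>\<^sub>0 int) set \<Rightarrow> (('a word \<Rightarrow>\<^sub>0 complex) set \<times> 'v \<Rightarrow>\<^sub>0 int) set" where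
  "ind_mult L K V \<rho> u X =
     (\<Union>F\<in>X. ind_rel L K V \<rho> #>\<^bsub>free_Abelian_group (carrier (env_alg L) \<times> carrier V)\<^esub>
        frag_extend (\<lambda>(a, v). frag_of (u \<otimes>\<^bsub>env_alg L\<^esub> a, v)) F)"

text \<open>The multiplicative fields of a \<open>module\<close> record carry no meaning.\<close>

definition ind_module ::
    "'a lie_algebra \<Rightarrow> 'a lie_algebra \<Rightarrow> (complex, 'v) module \<Rightarrow> ('a \<Rightarrow> 'v \<Rightarrow> 'v) \<Rightarrow>
     (complex, (('a word \<Rightarrow>\<^sub>0 complex) set \<times> 'v \<Rightarrow>\<^sub>0 int) set) module" where
  "ind_module L K V \<rho> = \<lparr>carrier = carrier (ind_group L K V \<rho>), mult = undefined, one = undefined,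
     zero = \<one>\<^bsub>ind_group L K V \<rho>\<^esub>, add = mult (ind_group L K V \<rho>),
     smult = \<lambda>c. ind_mult L K V \<rho> (env_class L (free_const c))\<rparr>"

definition ind_act ::
    "'a lie_algebra \<Rightarrow> 'a lie_algebra \<Rightarrow> (complex, 'v) module \<Rightarrow> ('a \<Rightarrow> 'v \<Rightarrow> 'v) \<Rightarrow>
     'a \<Rightarrow> (('a word \<Rightarrow>\<^sub>0 complex) set \<times> 'v \<Rightarrow>\<^sub>0 int) set \<Rightarrow>
     (('a word \<Rightarrow>\<^sub>0 complex) set \<times> 'v \<Rightarrow>\<^sub>0 int) set" where
  "ind_act L K V \<rho> x = ind_mult L K V \<rho> (env_class L (free_gen x))"


section \<open>The parabolic subalgebra of \<open>sl(m+1)\<close>\<close>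

definition sl :: "nat \<Rightarrow> complex mat lie_algebra" where
  "sl n = \<lparr>carrier = {A \<in> carrier_mat n n. (\<Sum>i<n. A $$ (i, i)) = 0},
     mult = (*), one = 1\<^sub>m n, zero = 0\<^sub>m n n, add = (+), smult = (\<cdot>\<^sub>m),
     lie_bracket = \<lambda>A B. A * B - B * A\<rparr>"

text \<open>Matrix units with rows and columns numbered from 1, while matrix entries are numbered
  from 0.\<close>

definition E :: "nat \<Rightarrow> nat \<Rightarrow> nat \<Rightarrow> complex mat" where
  "E n i j = mat n n (\<lambda>(a, b). if Suc a = i \<and> Suc b = j then 1 else 0)"

definition levi :: "nat \<Rightarrow> complex mat set" where
  "levi m = LinearCombinations.module.span class_ring (module_mat TYPE(complex) (m+1) (m+1))
     ({E (m+1) i j | i j. i \<in> {1..m} \<and> j \<in> {1..m} \<and> i \<noteq> j} \<union>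
      {E (m+1) i i - E (m+1) (m+1) (m+1) | i. i \<in> {1..m}})"

definition nilrad :: "nat \<Rightarrow> complex mat set" where
  "nilrad m = LinearCombinations.module.span class_ring (module_mat TYPE(complex) (m+1) (m+1))
     {E (m+1) s (m+1) | s. s \<in> {1..m}}"

definition parabolic :: "nat \<Rightarrow> complex mat set" where
  "parabolic m = {A + B | A B. A \<in> levi m \<and> B \<in> nilrad m}"

abbreviation levi_alg :: "nat \<Rightarrow> complex mat lie_algebra" where
  "levi_alg m \<equiv> lie_subalgebra_on (sl (m+1)) (levi m)"

abbreviation parabolic_alg :: "nat \<Rightarrow> complex mat lie_algebra" where
  "parabolic_alg m \<equiv> lie_subalgebra_on (sl (m+1)) (parabolic m)"

text \<open>\<open>(V, \<rho>)\<close> is a model of \<open>L(\<mu>)\<close>, which the following properties determine up to isomorphism.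
  Only \<open>\<mu> 1, \<dots>, \<mu> m\<close> matter.\<close>

definition simple_highest_weight_module ::
    "nat \<Rightarrow> (nat \<Rightarrow> complex) \<Rightarrow> (complex, 'v) module \<Rightarrow> (complex mat \<Rightarrow> 'v \<Rightarrow> 'v) \<Rightarrow> bool" where
  "simple_highest_weight_module m \<mu> V \<rho> \<longleftrightarrow>
     simple_lie_module (levi_alg m) V \<rho> \<and>
     (\<exists>v\<in>carrier V.
        (\<forall>W. lie_submodule (levi_alg m) V \<rho> W \<and> v \<in> W \<longrightarrow> W = carrier V) \<and>
        (\<forall>i j. 1 \<le> i \<and> i < j \<and> j \<le> m \<longrightarrow> \<rho> (E (m+1) i j) v = \<zero>\<^bsub>V\<^esub>) \<and>
        (\<forall>i\<in>{1..m}. \<rho> (E (m+1) i i - E (m+1) (m+1) (m+1)) v = \<mu> i \<odot>\<^bsub>V\<^esub> v))"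

text \<open>The action of \<open>\<ll> \<oplus> \<uu>\<close> extending that of \<open>\<ll>\<close> by zero on \<open>\<uu>\<close>.\<close>

definition parabolic_act :: "nat \<Rightarrow> (complex mat \<Rightarrow> 'v \<Rightarrow> 'v) \<Rightarrow> complex mat \<Rightarrow> 'v \<Rightarrow> 'v" where
  "parabolic_act m \<rho> X = \<rho> (THE A. A \<in> levi m \<and> (\<exists>B\<in>nilrad m. X = A + B))"

definition gen_verma ::
    "nat \<Rightarrow> (complex, 'v) module \<Rightarrow> (complex mat \<Rightarrow> 'v \<Rightarrow> 'v) \<Rightarrow>
     (complex, ((complex mat word \<Rightarrow>\<^sub>0 complex) set \<times> 'v \<Rightarrow>\<^sub>0 int) set) module" where
  "gen_verma m V \<rho> = ind_module (sl (m+1)) (parabolic_alg m) V (parabolic_act m \<rho>)"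

definition gen_verma_act ::
    "nat \<Rightarrow> (complex, 'v) module \<Rightarrow> (complex mat \<Rightarrow> 'v \<Rightarrow> 'v) \<Rightarrow> complex mat \<Rightarrow>
     ((complex mat word \<Rightarrow>\<^sub>0 complex) set \<times> 'v \<Rightarrow>\<^sub>0 int) set \<Rightarrow>
     ((complex mat word \<Rightarrow>\<^sub>0 complex) set \<times> 'v \<Rightarrow>\<^sub>0 int) set" where
  "gen_verma_act m V \<rho> = ind_act (sl (m+1)) (parabolic_alg m) V (parabolic_act m \<rho>)"

end

theory Submission
  imports Defs "HOL-Library.Function_Algebras"
begin

text \<open>
  By the triangularity of the induction, \<open>M\<^sub>p(V)\<close> is \<open>\<complex>[x\<^sub>1, \<dots>, x\<^sub>m] \<otimes> V\<close> as a vector space. Write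
  \<open>X\<^sub>t\<close> for multiplication by \<open>x\<^sub>t\<close>, \<open>D\<^sub>t\<close> for the derivative and \<open>A\<^sub>s\<^sub>t\<close> for the action of \<open>E\<^sub>s\<^sub>t\<close> on \<open>V\<close>. The
  operators \<open>B\<^sub>s\<^sub>t = A\<^sub>s\<^sub>t - X\<^sub>t D\<^sub>s\<close>, \<open>X\<^sub>t\<close>, \<open>\<Sum>\<^sub>t B\<^sub>s\<^sub>t D\<^sub>t\<close> and \<open>\<Sum>\<^sub>t X\<^sub>t D\<^sub>t\<close> satisfy the relations of
  \<open>gl(m+1)\<close>. The universal property maps the induced module onto this model, and since the words in the
  \<open>x\<^sub>t\<close> span the induced module over \<open>V\<close>, the map is injective; no PBW theorem is needed.

  A proper nonzero submodule contains a vector \<open>w = \<Sum>\<^sub>\<alpha> x\<^sup>\<alpha>/\<alpha>! \<otimes> w\<^sub>\<alpha>\<close> killed by all \<open>E\<^sub>i\<^sub>j\<close> with \<open>i < j\<close> that is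
  not a multiple of the generating vector \<open>1 \<otimes> v\<^sub>\<mu>\<close>. Let \<open>\<phi>\<close> be a functional on \<open>V\<close> that takes the value \<open>1\<close>
  at \<open>v\<^sub>\<mu>\<close> and vanishes on the image of the lowering operators. Then some \<open>\<phi>(w\<^sub>\<alpha>)\<close> with \<open>\<alpha> \<noteq> 0\<close> is
  nonzero, and applying \<open>\<phi>\<close> to the equations \<open>E\<^sub>i\<^sub>j w = 0\<close> yields a linear equation in \<open>\<mu>\<close> for each variable occurring
  in \<open>x\<^sup>\<alpha>\<close>. If \<open>\<mu>\<^sub>i - \<mu>\<^sub>i\<^sub>+\<^sub>1 = n\<close> is a natural number, \<open>\<phi>\<close> vanishes on the image of \<open>E\<^sub>i\<^sub>,\<^sub>i\<^sub>+\<^sub>1\<^sup>n\<^sup>+\<^sup>1\<close>; for \<open>n = 0\<close> this leaves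
  only the last variable of each of the two blocks, and for general \<open>n\<close> it excludes \<open>n < l\<close> in condition (1).

  Conversely, under either condition an explicit combination of the \<open>x\<^sup>\<alpha> \<otimes> (\<Prod>\<^sub>j E\<^sub>j\<^sub>,\<^sub>i\<^sup>\<alpha>\<^sup>j) v\<^sub>\<mu>\<close> of degree \<open>l\<close>
  is killed by the nilradical and generates a proper submodule.
\<close>

subsection \<open>Linear combinations\<close>

text \<open>The necessity part rests on two properties of \<phi>. It vanishes on images of lowering
  operators and is multiplied by \<open>\<mu> i\<close> under the diagonal ones, so in a coefficient
  equation of a singular vector all terms become multiples of one number \<phi>(w_\<beta>).
  Moreover, the equations for the Levi part turn a raising operator applied to one coefficient of w
  into a multiple of another coefficient; hence the numbers \<phi>(w_\<alpha>) determine w, which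
  may mix weights and degrees. Submodules arise from a single device, \<open>word_stable\<close>:
  take the vectors that no word in a chosen set of operators carries out of a given subgroup. With
  the raising operators and the kernel of \<phi> it turns simplicity of V into separation of vectors
  by \<phi>. With the nilradical and the vectors without constant term it gives a proper submodule
  around the explicit singular vector. The two conditions belong to the last variables of the two
  blocks. Condition (2) needs no construction of its own: it is the explicit vector for a second
  block that is empty, where the weight that would belong to it can be chosen freely.\<close>

definition lc :: "(complex, 'v) module \<Rightarrow> ('k \<Rightarrow> 'v) \<Rightarrow> ('k \<Rightarrow>\<^sub>0 complex) \<Rightarrow> 'v" where
  "lc V g \<tau> = (\<Oplus>\<^bsub>V\<^esub>k\<in>Poly_Mapping.keys \<tau>. Poly_Mapping.lookup \<tau> k \<odot>\<^bsub>V\<^esub> g k)"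

locale cvec = vectorspace class_ring V for V :: "(complex, 'v) module" (structure)
begin

lemma sm_closed [simp]: "v \<in> carrier V \<Longrightarrow> c \<odot> v \<in> carrier V"
  using smult_closed[of c v] by simp

lemma sm_zero [simp]: "v \<in> carrier V \<Longrightarrow> (0::complex) \<odot> v = \<zero>"
  using smult_l_null[of v] by simp

lemma sm_one [simp]: "v \<in> carrier V \<Longrightarrow> (1::complex) \<odot> v = v"
  using smult_one[of v] by simp

lemma sm_ladd: "v \<in> carrier V \<Longrightarrow> (c + d) \<odot> v = c \<odot> v \<oplus> d \<odot> v"
  using smult_l_distr[of c d v] by simp

lemma sm_radd: "v \<in> carrier V \<Longrightarrow> w \<in> carrier V \<Longrightarrow> c \<odot> (v \<oplus> w) = c \<odot> v \<oplus> c \<odot> w"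
  using smult_r_distr[of c v w] by simp

lemma sm_assoc: "v \<in> carrier V \<Longrightarrow> (c * d) \<odot> v = c \<odot> (d \<odot> v)"
  using smult_assoc1[of c d v] by simp

lemma sm_rzero [simp]: "c \<odot> \<zero> = \<zero>"
  using smult_r_null[of c] by simp

lemma sm_neg_one: "v \<in> carrier V \<Longrightarrow> (- 1 :: complex) \<odot> v = \<ominus> v"
  using sm_ladd[of v "- 1" 1] by (simp add: minus_equality[symmetric])

lemma add_minus_minus:
  assumes "v \<in> carrier V" "w \<in> carrier V" shows "v \<oplus> w \<ominus> v \<ominus> w = \<zero>"
proof -
  have "v \<oplus> w \<ominus> v = w" using assms by (simp add: a_minus_def a_comm[of v w] a_assoc r_neg)
  then show ?thesis using assms by (simp add: a_minus_def r_neg)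
qed

text \<open>Enlarging the index set adds only zero terms. This allows combinations with different
  supports to be compared over one common index set.\<close>

lemma lc_superset:
  assumes "finite S" "Poly_Mapping.keys \<tau> \<subseteq> S" "g \<in> S \<rightarrow> carrier V"
  shows "lc V g \<tau> = (\<Oplus>k\<in>S. Poly_Mapping.lookup \<tau> k \<odot> g k)"
  unfolding lc_def
proof (rule add.finprod_mono_neutral_cong_left)
  show "\<And>i. i \<in> S - Poly_Mapping.keys \<tau> \<Longrightarrow> Poly_Mapping.lookup \<tau> i \<odot> g i = \<zero>"
    using assms by (auto simp: in_keys_iff Pi_iff)
qed (use assms in auto)

lemma lc_closed: "g \<in> Poly_Mapping.keys \<tau> \<rightarrow> carrier V \<Longrightarrow> lc V g \<tau> \<in> carrier V"
  unfolding lc_def by (auto intro!: finsum_closed)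

lemma lc_zero [simp]: "lc V g 0 = \<zero>"
  by (simp add: lc_def)

lemma lc_add:
  assumes "g \<in> Poly_Mapping.keys \<sigma> \<union> Poly_Mapping.keys \<tau> \<rightarrow> carrier V"
  shows "lc V g (\<sigma> + \<tau>) = lc V g \<sigma> \<oplus> lc V g \<tau>"
proof -
  let ?S = "Poly_Mapping.keys \<sigma> \<union> Poly_Mapping.keys \<tau>"
  have g: "g k \<in> carrier V" if "k \<in> ?S" for k using assms that by (auto simp: Pi_iff)
  have "lc V g (\<sigma> + \<tau>) = (\<Oplus>k\<in>?S. Poly_Mapping.lookup (\<sigma> + \<tau>) k \<odot> g k)"
    by (rule lc_superset) (use g keys_add[of \<sigma> \<tau>] in \<open>auto simp: Pi_iff\<close>)
  also have "\<dots> = (\<Oplus>k\<in>?S. Poly_Mapping.lookup \<sigma> k \<odot> g k \<oplus> Poly_Mapping.lookup \<tau> k \<odot> g k)"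
    by (rule finsum_cong') (use g in \<open>auto simp: Pi_iff lookup_add sm_ladd\<close>)
  also have "\<dots> = (\<Oplus>k\<in>?S. Poly_Mapping.lookup \<sigma> k \<odot> g k) \<oplus> (\<Oplus>k\<in>?S. Poly_Mapping.lookup \<tau> k \<odot> g k)"
    by (rule finsum_addf) (use g in \<open>auto simp: Pi_iff\<close>)
  also have "(\<Oplus>k\<in>?S. Poly_Mapping.lookup \<sigma> k \<odot> g k) = lc V g \<sigma>"
    by (rule lc_superset[symmetric]) (use g in \<open>auto simp: Pi_iff\<close>)
  also have "(\<Oplus>k\<in>?S. Poly_Mapping.lookup \<tau> k \<odot> g k) = lc V g \<tau>"
    by (rule lc_superset[symmetric]) (use g in \<open>auto simp: Pi_iff\<close>)
  finally show ?thesis .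
qed

lemma lc_single: "g k \<in> carrier V \<Longrightarrow> lc V g (Poly_Mapping.single k c) = c \<odot> g k"
  by (subst lc_superset[of "{k}"]) auto

end

subsection \<open>The free algebra\<close>

lemma free_alg_simps [simp]:
  "f \<in> carrier (free_alg X) \<longleftrightarrow> (\<forall>w\<in>Poly_Mapping.keys f. set (letters w) \<subseteq> X)"
  "mult (free_alg X) = (*)" "one (free_alg X) = 1" "zero (free_alg X) = 0" "add (free_alg X) = (+)"
  by (simp_all add: free_alg_def)

lemma free_mult_closed:
  assumes "f \<in> carrier (free_alg X)" "g \<in> carrier (free_alg X)"
  shows "f * g \<in> carrier (free_alg X)"
  using assms keys_mult[of f g] by (fastforce simp: plus_word_def)

lemma free_add_closed:
  assumes "f \<in> carrier (free_alg X)" "g \<in> carrier (free_alg X)"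
  shows "f + g \<in> carrier (free_alg X)"
  using assms keys_add[of f g] by fastforce

lemma free_minus_closed: "f \<in> carrier (free_alg X) \<Longrightarrow> - f \<in> carrier (free_alg X)"
  by simp

lemma free_diff_closed:
  assumes "f \<in> carrier (free_alg X)" "g \<in> carrier (free_alg X)"
  shows "f - g \<in> carrier (free_alg X)"
  using free_add_closed[OF assms(1) free_minus_closed[OF assms(2)]] by simp

lemma free_zero_closed: "0 \<in> carrier (free_alg X)" by simp

lemma free_single_closed: "set xs \<subseteq> X \<Longrightarrow> Poly_Mapping.single (Word xs) c \<in> carrier (free_alg X)"
  by simp

lemma free_gen_closed: "x \<in> X \<Longrightarrow> free_gen x \<in> carrier (free_alg X)"
  by (simp add: free_gen_def)

lemma free_const_closed: "free_const c \<in> carrier (free_alg X)"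
  by (simp add: free_const_def zero_word_def)

lemma free_one_closed: "1 \<in> carrier (free_alg X)"
  using free_const_closed[of 1 X] by (simp add: free_const_def)

lemmas free_closed = free_mult_closed free_add_closed free_minus_closed free_diff_closed free_zero_closed
  free_single_closed free_gen_closed free_const_closed free_one_closed

lemma ring_free_alg: "ring (free_alg X)"
proof (rule ringI)
  show "abelian_group (free_alg X)"
  proof (rule abelian_groupI)
    fix f assume "f \<in> carrier (free_alg X)"
    then show "\<exists>g\<in>carrier (free_alg X). g \<oplus>\<^bsub>free_alg X\<^esub> f = \<zero>\<^bsub>free_alg X\<^esub>"
      by (intro bexI[of _ "- f"]) (use free_minus_closed in auto)
  next
    fix f g assume "f \<in> carrier (free_alg X)" "g \<in> carrier (free_alg X)"
    then show "f \<oplus>\<^bsub>free_alg X\<^esub> g \<in> carrier (free_alg X)" unfolding free_alg_simps(5) by (rule free_add_closed)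
  qed (auto simp: add.assoc add.commute)
  show "Group.monoid (free_alg X)"
  proof (rule monoidI)
    fix f g assume "f \<in> carrier (free_alg X)" "g \<in> carrier (free_alg X)"
    then show "f \<otimes>\<^bsub>free_alg X\<^esub> g \<in> carrier (free_alg X)" unfolding free_alg_simps(2) by (rule free_mult_closed)
  next
    show "\<one>\<^bsub>free_alg X\<^esub> \<in> carrier (free_alg X)" unfolding free_alg_simps(3) by (rule free_one_closed)
  qed (auto simp: mult.assoc)
qed (auto simp: ring_distribs)

lemma free_a_inv: "f \<in> carrier (free_alg X) \<Longrightarrow> \<ominus>\<^bsub>free_alg X\<^esub> f = - f"
proof -
  interpret ring "free_alg X" by (rule ring_free_alg)
  assume f: "f \<in> carrier (free_alg X)"
  show ?thesis by (rule minus_equality) (use f free_minus_closed in auto)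
qed

text \<open>An element is the finite sum of its monomials, so additive claims need only be checked
  on scalar multiples of words. The summands stay in the carrier, which is why membership is
  available in the additive step.\<close>

lemma free_induct [consumes 1, case_names zero single add]:
  assumes f: "f \<in> carrier (free_alg X)" and P0: "P 0"
    and Ps: "\<And>xs c. set xs \<subseteq> X \<Longrightarrow> P (Poly_Mapping.single (Word xs) c)"
    and Pa: "\<And>f g. \<lbrakk>f \<in> carrier (free_alg X); g \<in> carrier (free_alg X); P f; P g\<rbrakk> \<Longrightarrow> P (f + g)"
  shows "P f"
proof -
  let ?s = "\<lambda>w. Poly_Mapping.single w (Poly_Mapping.lookup f w)"
  have "S \<subseteq> Poly_Mapping.keys f \<Longrightarrow> sum ?s S \<in> carrier (free_alg X) \<and> P (sum ?s S)" if "finite S" for S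
    using that
  proof (induction S rule: finite_induct)
    case empty
    then show ?case using P0 by simp
  next
    case (insert w S)
    obtain xs where w: "w = Word xs" by (cases w)
    have "w \<in> Poly_Mapping.keys f" using insert.prems by simp
    then have xs: "set xs \<subseteq> X" using f w by fastforce
    then show ?case using insert Pa[OF free_single_closed[OF xs] _ Ps[OF xs]]
        free_add_closed[OF free_single_closed[OF xs]] unfolding w by (simp del: free_alg_simps(1))
  qed
  moreover have "f = sum ?s (Poly_Mapping.keys f)"
    by (rule poly_mapping_eqI)
      (simp add: lookup_sum lookup_single when_def sum.delta in_keys_iff)
  ultimately show ?thesis by (metis finite_keys order_refl)
qed

definition wmon :: "'a list \<Rightarrow> 'a word \<Rightarrow>\<^sub>0 complex" where
  "wmon xs = Poly_Mapping.single (Word xs) 1"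

lemma wmon_closed: "set xs \<subseteq> X \<Longrightarrow> wmon xs \<in> carrier (free_alg X)"
  by (simp add: wmon_def)

lemma wmon_append: "wmon (xs @ ys) = wmon xs * wmon ys"
  by (simp add: wmon_def mult_single plus_word_def)

lemma wmon_Cons: "wmon (x # xs) = free_gen x * wmon xs"
  by (simp add: wmon_def free_gen_def mult_single plus_word_def)

lemma single_Word: "Poly_Mapping.single (Word xs) c = free_const c * wmon xs"
  by (simp add: wmon_def free_const_def mult_single)

lemma free_const_central: "free_const c * f = f * free_const c"
proof -
  have "f \<in> carrier (free_alg UNIV)" by simp
  then show ?thesis
    by (induction f rule: free_induct) (simp_all add: ring_distribs free_const_def mult_single mult.commute)
qed

subsection \<open>Enveloping algebras\<close>

text \<open>Closure of the carrier places the defining relations of the enveloping algebra inside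
  the free algebra on the carrier, as the generated ideal requires.\<close>

locale lie_ops =
  fixes L :: "'a lie_algebra"
  assumes L_add: "\<lbrakk>x \<in> carrier L; y \<in> carrier L\<rbrakk> \<Longrightarrow> x \<oplus>\<^bsub>L\<^esub> y \<in> carrier L"
    and L_smult: "x \<in> carrier L \<Longrightarrow> c \<odot>\<^bsub>L\<^esub> x \<in> carrier L"
    and L_bracket: "\<lbrakk>x \<in> carrier L; y \<in> carrier L\<rbrakk> \<Longrightarrow> lie_bracket L x y \<in> carrier L"
begin

abbreviation "A \<equiv> free_alg (carrier L)"

definition env_rels :: "('a word \<Rightarrow>\<^sub>0 complex) set" where
  "env_rels = {free_gen (x \<oplus>\<^bsub>L\<^esub> y) - free_gen x - free_gen y | x y. x \<in> carrier L \<and> y \<in> carrier L} \<union>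
     {free_gen (c \<odot>\<^bsub>L\<^esub> x) - free_const c * free_gen x | c x. x \<in> carrier L} \<union>
     {free_gen x * free_gen y - free_gen y * free_gen x - free_gen (lie_bracket L x y) | x y.
        x \<in> carrier L \<and> y \<in> carrier L}"

lemma env_ideal_eq: "env_ideal L = genideal A env_rels"
  by (simp add: env_ideal_def env_rels_def)

lemma env_rels_closed: "env_rels \<subseteq> carrier A"
  unfolding env_rels_def
  by (auto simp del: free_alg_simps(1) intro!: free_closed L_add L_smult L_bracket)

sublocale A: ring A by (rule ring_free_alg)

sublocale I: ideal "env_ideal L" A
  unfolding env_ideal_eq by (rule A.genideal_ideal[OF env_rels_closed])

lemma env_rel_in: "f \<in> env_rels \<Longrightarrow> f \<in> env_ideal L"
  unfolding env_ideal_eq using A.genideal_self[OF env_rels_closed] by blast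

lemma I_mult_l: "f \<in> env_ideal L \<Longrightarrow> g \<in> carrier A \<Longrightarrow> g * f \<in> env_ideal L"
  using I.I_l_closed[of f g] by (simp del: free_alg_simps(1))

lemma I_mult_r: "f \<in> env_ideal L \<Longrightarrow> g \<in> carrier A \<Longrightarrow> f * g \<in> env_ideal L"
  using I.I_r_closed[of f g] by (simp del: free_alg_simps(1))

abbreviation cl :: "('a word \<Rightarrow>\<^sub>0 complex) \<Rightarrow> ('a word \<Rightarrow>\<^sub>0 complex) set" where
  "cl \<equiv> env_class L"

lemma cl_eq: "cl f = {h + f | h. h \<in> env_ideal L}"
  unfolding env_class_def a_r_coset_def' by auto

lemma carrier_env: "carrier (env_alg L) = cl ` carrier A"
  unfolding env_alg_def FactRing_def env_class_def A_RCOSETS_def' by auto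

lemma cl_closed: "f \<in> carrier A \<Longrightarrow> cl f \<in> carrier (env_alg L)"
  unfolding carrier_env by (rule imageI)

lemma cl_mult: "f \<in> carrier A \<Longrightarrow> g \<in> carrier A \<Longrightarrow> cl f \<otimes>\<^bsub>env_alg L\<^esub> cl g = cl (f * g)"
  unfolding env_alg_def FactRing_def env_class_def by (simp add: I.rcoset_mult_add del: free_alg_simps(1))

lemma cl_add: "f \<in> carrier A \<Longrightarrow> g \<in> carrier A \<Longrightarrow> cl f \<oplus>\<^bsub>env_alg L\<^esub> cl g = cl (f + g)"
  unfolding env_alg_def FactRing_def env_class_def by (simp add: I.a_rcos_sum del: free_alg_simps(1))

lemma cl_cong:
  assumes "f \<in> carrier A" "g \<in> carrier A" "f - g \<in> env_ideal L" shows "cl f = cl g"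
proof -
  have "f \<in> cl g" unfolding cl_eq using assms(3) by (auto intro!: exI[of _ "f - g"])
  then have "f \<in> env_ideal L +>\<^bsub>A\<^esub> g" by (simp add: env_class_def)
  from A.a_repr_independence[OF this assms(2) I.a_subgroup] show ?thesis by (simp add: env_class_def)
qed

end

subsection \<open>The action of the enveloping algebra\<close>

locale rep = lie_ops L + lie_module L V \<rho> for L :: "'a lie_algebra" and V :: "(complex, 'v) module" and \<rho>
begin

sublocale V: cvec V unfolding cvec_def by (rule vectorspace)

lemma fold_closed: "set xs \<subseteq> carrier L \<Longrightarrow> v \<in> carrier V \<Longrightarrow> foldr \<rho> xs v \<in> carrier V"
  by (induction xs) (auto simp: act_closed)

lemma fold_add: "set xs \<subseteq> carrier L \<Longrightarrow> v \<in> carrier V \<Longrightarrow> w \<in> carrier V \<Longrightarrow> foldr \<rho> xs (v \<oplus>\<^bsub>V\<^esub> w) = foldr \<rho> xs v \<oplus>\<^bsub>V\<^esub> foldr \<rho> xs w"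
  by (induction xs) (auto simp: act_add fold_closed)

lemma fold_smult: "set xs \<subseteq> carrier L \<Longrightarrow> v \<in> carrier V \<Longrightarrow> foldr \<rho> xs (c \<odot>\<^bsub>V\<^esub> v) = c \<odot>\<^bsub>V\<^esub> foldr \<rho> xs v"
  by (induction xs) (auto simp: act_smult fold_closed)

abbreviation act :: "('a word \<Rightarrow>\<^sub>0 complex) \<Rightarrow> 'v \<Rightarrow> 'v" where
  "act \<equiv> free_act V \<rho>"

lemma act_lc: "act f v = lc V (\<lambda>w. foldr \<rho> (letters w) v) f"
  by (simp add: free_act_def lc_def)

lemma fact_closed: "f \<in> carrier A \<Longrightarrow> v \<in> carrier V \<Longrightarrow> act f v \<in> carrier V"
  unfolding act_lc by (rule V.lc_closed) (auto intro: fold_closed)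

lemma fact_add: "f \<in> carrier A \<Longrightarrow> g \<in> carrier A \<Longrightarrow> v \<in> carrier V \<Longrightarrow> act (f + g) v = act f v \<oplus>\<^bsub>V\<^esub> act g v"
  unfolding act_lc by (rule V.lc_add) (auto intro: fold_closed)

lemma fact_zero: "act 0 v = \<zero>\<^bsub>V\<^esub>"
  by (simp add: act_lc)

lemma fact_single: "set xs \<subseteq> carrier L \<Longrightarrow> v \<in> carrier V \<Longrightarrow> act (Poly_Mapping.single (Word xs) c) v = c \<odot>\<^bsub>V\<^esub> foldr \<rho> xs v"
  unfolding act_lc by (subst V.lc_single) (simp_all add: fold_closed)

lemma fact_add_r:
  assumes "f \<in> carrier A" "v \<in> carrier V" "w \<in> carrier V" shows "act f (v \<oplus>\<^bsub>V\<^esub> w) = act f v \<oplus>\<^bsub>V\<^esub> act f w"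
  using assms(1)
proof (induction f rule: free_induct)
  case (add f g)
  then show ?case using assms(2,3) by (simp add: fact_add fact_closed V.a_ac del: free_alg_simps(1))
qed (use assms(2,3) in \<open>simp_all add: fact_zero fact_single fold_add V.sm_radd fold_closed\<close>)

lemma fact_smult_r:
  assumes "f \<in> carrier A" "v \<in> carrier V" shows "act f (c \<odot>\<^bsub>V\<^esub> v) = c \<odot>\<^bsub>V\<^esub> act f v"
  using assms(1)
proof (induction f rule: free_induct)
  case (add f g)
  then show ?case using assms(2) by (simp add: fact_add fact_closed V.sm_radd del: free_alg_simps(1))
next
  case (single xs d)
  then show ?case using assms(2) by (simp add: fact_single fold_smult fold_closed V.sm_assoc[symmetric] mult.commute)
qed (simp add: fact_zero)

lemma fact_mult:
  assumes "f \<in> carrier A" "g \<in> carrier A" "v \<in> carrier V" shows "act (f * g) v = act f (act g v)"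
  using assms(1)
proof (induction f rule: free_induct)
  case zero
  then show ?case by (simp add: fact_zero)
next
  case (add f f')
  then show ?case using assms(2,3)
    by (simp add: fact_add fact_closed ring_distribs free_mult_closed del: free_alg_simps(1))
next
  case (single xs c)
  note xs = single
  show ?case using assms(2)
  proof (induction g rule: free_induct)
    case zero
    then show ?case using xs V.zero_closed by (simp add: fact_zero fact_single) (metis V.sm_zero V.zero_closed fold_smult V.sm_rzero fold_closed)
  next
    case (add g h)
    then show ?case using xs assms(3)
      by (simp add: fact_add fact_closed ring_distribs free_mult_closed free_single_closed fact_add_r del: free_alg_simps(1))
  next
    case (single ys d)
    then show ?case using xs assms(3)
      by (simp add: mult_single plus_word_def fact_single fold_closed fold_smult V.sm_assoc)
  qed
qed

lemma fact_gen: "x \<in> carrier L \<Longrightarrow> v \<in> carrier V \<Longrightarrow> act (free_gen x) v = \<rho> x v"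
  using fact_single[of "[x]" v 1] by (simp add: free_gen_def act_closed)

lemma fact_const: "v \<in> carrier V \<Longrightarrow> act (free_const c) v = c \<odot>\<^bsub>V\<^esub> v"
  using fact_single[of "[]" v c] by (simp add: free_const_def zero_word_def)

lemma fact_wmon: "set xs \<subseteq> carrier L \<Longrightarrow> v \<in> carrier V \<Longrightarrow> act (wmon xs) v = foldr \<rho> xs v"
  by (simp add: wmon_def fact_single fold_closed)

lemma fact_diff: 
  assumes "f \<in> carrier A" "g \<in> carrier A" "v \<in> carrier V"
  shows "act (f - g) v = act f v \<ominus>\<^bsub>V\<^esub> act g v"
proof -
  have "act (f - g) v \<oplus>\<^bsub>V\<^esub> act g v = act f v"
    using fact_add[OF free_diff_closed[OF assms(1,2)] assms(2,3)] by simp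
  then show ?thesis
    using fact_closed[OF assms(1,3)] fact_closed[OF assms(2,3)] fact_closed[OF free_diff_closed[OF assms(1,2)] assms(3)]
    by (metis a_minus_def V.add.inv_solve_right)
qed

text \<open>The annihilator of the whole module is a two-sided ideal because \<open>act\<close> is
  multiplicative, and the module axioms say that it contains the three families of relations. It
  therefore contains the ideal that they generate, and the action descends to classes.\<close>

lemma fact_ideal:
  assumes "f \<in> env_ideal L" "v \<in> carrier V" shows "act f v = \<zero>\<^bsub>V\<^esub>"
proof -
  let ?J = "{f \<in> carrier A. \<forall>v\<in>carrier V. act f v = \<zero>\<^bsub>V\<^esub>}"
  have "ideal ?J A"
  proof (rule idealI[OF ring_free_alg])
    show "subgroup ?J (add_monoid A)"
    proof (rule group.subgroupI[OF A.a_group])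
      show "?J \<noteq> {}" using fact_zero by (auto intro!: exI[of _ 0])
      fix a assume a: "a \<in> ?J"
      then have "act (0 - a) v = \<zero>\<^bsub>V\<^esub>" if "v \<in> carrier V" for v
        using that by (subst fact_diff) (auto simp: fact_zero a_minus_def)
      then show "inv\<^bsub>add_monoid A\<^esub> a \<in> ?J"
        using a free_a_inv[of a "carrier L"] free_minus_closed[of a "carrier L"] by (simp add: a_inv_def del: free_alg_simps(1))
      fix b assume b: "b \<in> ?J"
      then show "a \<otimes>\<^bsub>add_monoid A\<^esub> b \<in> ?J"
        using a by (auto simp: fact_add free_add_closed simp del: free_alg_simps(1))
    qed auto
    fix a f assume "a \<in> ?J" "f \<in> carrier A"
    \<comment> \<open>Left multiples of an annihilating element need that \<open>f\<close> sends the
      zero vector to itself, which is homogeneity for the scalar 0.\<close>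
    moreover from this have "act f \<zero>\<^bsub>V\<^esub> = \<zero>\<^bsub>V\<^esub>" using fact_smult_r[of f "\<zero>\<^bsub>V\<^esub>" 0] by (simp add: fact_closed del: free_alg_simps(1))
    ultimately show "f \<otimes>\<^bsub>A\<^esub> a \<in> ?J" "a \<otimes>\<^bsub>A\<^esub> f \<in> ?J"
      by (auto simp: free_mult_closed fact_mult fact_closed simp del: free_alg_simps(1))
  qed
  moreover have "env_rels \<subseteq> ?J"
  proof
    fix f assume f: "f \<in> env_rels"
    then have fA: "f \<in> carrier A" using env_rels_closed by blast
    have "act f v = \<zero>\<^bsub>V\<^esub>" if v: "v \<in> carrier V" for v
      using f unfolding env_rels_def
    proof (elim UnE CollectE exE conjE)
      fix x y assume "f = free_gen (x \<oplus>\<^bsub>L\<^esub> y) - free_gen x - free_gen y" "x \<in> carrier L" "y \<in> carrier L"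
      then show ?thesis using v
        by (simp add: fact_diff free_closed L_add fact_gen add_act act_closed V.add_minus_minus del: free_alg_simps(1))
    next
      fix c x assume "f = free_gen (c \<odot>\<^bsub>L\<^esub> x) - free_const c * free_gen x" "x \<in> carrier L"
      then show ?thesis using v
        by (simp add: fact_diff free_closed L_smult fact_gen fact_mult fact_const smult_act act_closed a_minus_def V.r_neg del: free_alg_simps(1))
    next
      fix x y assume "f = free_gen x * free_gen y - free_gen y * free_gen x - free_gen (lie_bracket L x y)" "x \<in> carrier L" "y \<in> carrier L"
      then show ?thesis using v
        by (simp add: fact_diff free_closed L_bracket fact_gen fact_mult bracket_act act_closed a_minus_def V.r_neg del: free_alg_simps(1))
    qed
    with fA show "f \<in> ?J" by blast
  qed
  ultimately have "env_ideal L \<subseteq> ?J" unfolding env_ideal_eq by (rule A.genideal_minimal)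
  then show ?thesis using assms by blast
qed

lemma env_act_cl: "f \<in> carrier A \<Longrightarrow> v \<in> carrier V \<Longrightarrow> env_act V \<rho> (cl f) v = act f v"
proof -
  assume f: "f \<in> carrier A" and v: "v \<in> carrier V"
  have "act (h + f) v = act f v" if "h \<in> env_ideal L" for h
    using that I.Icarr[OF that] f v by (simp add: fact_add fact_ideal fact_closed del: free_alg_simps(1))
  moreover have "0 \<in> env_ideal L" using I.zero_closed by simp
  ultimately have "(\<lambda>g. act g v) ` cl f = {act f v}" unfolding cl_eq by auto
  then show ?thesis by (simp add: env_act_def)
qed

end

subsection \<open>Induced modules\<close>

locale induced = L: lie_ops L + V: rep K V \<rho> for L K :: "'a lie_algebra" and V :: "(complex, 'v) module" and \<rho> +
  assumes K_sub: "carrier K \<subseteq> carrier L"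
    and K_ops: "add K = add L" "smult K = smult L" "lie_bracket K = lie_bracket L"
begin

abbreviation "AL \<equiv> free_alg (carrier L)"
abbreviation "AK \<equiv> free_alg (carrier K)"

lemma AK_AL: "f \<in> carrier AK \<Longrightarrow> f \<in> carrier AL"
  using K_sub by fastforce

text \<open>The ideal of \<open>L\<close> meets the free algebra on \<open>K\<close> in an ideal of
  the latter, and this contains the relations of \<open>K\<close> because the operations agree.
  Hence the inclusion induces a map of enveloping algebras.\<close>

lemma ideal_mono: "env_ideal K \<subseteq> env_ideal L"
proof -
  let ?J = "env_ideal L \<inter> carrier AK"
  have "ideal ?J AK"
  proof (rule idealI[OF ring_free_alg])
    show "subgroup ?J (add_monoid AK)"
    proof (rule group.subgroupI[OF V.A.a_group])
      show "?J \<noteq> {}" using L.I.zero_closed free_zero_closed[of "carrier K"] by auto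
      fix a assume a: "a \<in> ?J"
      have "\<ominus>\<^bsub>AL\<^esub> a \<in> env_ideal L" using a L.I.a_inv_closed by blast
      then show "inv\<^bsub>add_monoid AK\<^esub> a \<in> ?J"
        using a free_a_inv[of a "carrier K"] free_a_inv[of a "carrier L"] AK_AL[of a] free_minus_closed[of a "carrier K"]
        by (simp add: a_inv_def del: free_alg_simps(1))
      fix b assume b: "b \<in> ?J"
      then show "a \<otimes>\<^bsub>add_monoid AK\<^esub> b \<in> ?J"
        using a L.I.a_closed[of a b] free_add_closed[of a "carrier K" b] by (simp del: free_alg_simps(1))
    qed auto
    fix a x assume "a \<in> ?J" "x \<in> carrier AK"
    then show "x \<otimes>\<^bsub>AK\<^esub> a \<in> ?J" "a \<otimes>\<^bsub>AK\<^esub> x \<in> ?J"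
      using L.I_mult_l[of a x] L.I_mult_r[of a x] AK_AL[of x] free_mult_closed[of a "carrier K" x] free_mult_closed[of x "carrier K" a]
      by (simp_all del: free_alg_simps(1))
  qed
  moreover have "V.env_rels \<subseteq> L.env_rels"
    unfolding V.env_rels_def L.env_rels_def K_ops using K_sub by blast
  then have "V.env_rels \<subseteq> ?J" using V.env_rels_closed L.env_rel_in by blast
  ultimately have "env_ideal K \<subseteq> ?J" unfolding V.env_ideal_eq by (rule V.A.genideal_minimal)
  then show ?thesis by blast
qed

text \<open>Two representatives of a class over \<open>K\<close> differ by an element of the ideal
  of \<open>K\<close>, hence of \<open>L\<close>; all members of the union in
  \<open>env_incl\<close> coincide.\<close>

lemma env_incl_cl: assumes f: "f \<in> carrier AK" shows "env_incl L (V.cl f) = L.cl f"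
proof -
  have "L.cl g = L.cl f" if g: "g \<in> V.cl f" for g
  proof -
    obtain h where h: "g = h + f" "h \<in> env_ideal K" using g unfolding V.cl_eq by blast
    have "h \<in> carrier AK" using h V.I.Icarr by blast
    then have "g \<in> carrier AK" using h f free_add_closed by blast
    then show ?thesis using h ideal_mono AK_AL f by (intro L.cl_cong) auto
  qed
  moreover have "f \<in> V.cl f" unfolding V.cl_eq using V.I.zero_closed by (auto intro!: exI[of _ 0])
  ultimately show ?thesis unfolding env_incl_def by blast
qed

abbreviation "S \<equiv> carrier (env_alg L) \<times> carrier V"
abbreviation "FG \<equiv> free_Abelian_group S"
abbreviation "rel \<equiv> ind_rel L K V \<rho>"
abbreviation "G \<equiv> ind_group L K V \<rho>"

text \<open>The generating tensor relations, expressed through representatives in the free algebras,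
  so that membership can be shown by computing with words.\<close>

definition gens :: "(('a word \<Rightarrow>\<^sub>0 complex) set \<times> 'v \<Rightarrow>\<^sub>0 int) set" where
  "gens = {frag_of (L.cl (f + g), v) - frag_of (L.cl f, v) - frag_of (L.cl g, v) | f g v.
        f \<in> carrier AL \<and> g \<in> carrier AL \<and> v \<in> carrier V} \<union>
     {frag_of (L.cl f, v \<oplus>\<^bsub>V\<^esub> w) - frag_of (L.cl f, v) - frag_of (L.cl f, w) | f v w.
        f \<in> carrier AL \<and> v \<in> carrier V \<and> w \<in> carrier V} \<union>
     {frag_of (L.cl (f * s), v) - frag_of (L.cl f, V.act s v) | f s v.
        f \<in> carrier AL \<and> s \<in> carrier AK \<and> v \<in> carrier V}"

lemma rel_eq: "rel = generate FG gens"
proof -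
  have 1: "{frag_of (a \<oplus>\<^bsub>env_alg L\<^esub> a', b) - frag_of (a, b) - frag_of (a', b) | a a' b.
        a \<in> carrier (env_alg L) \<and> a' \<in> carrier (env_alg L) \<and> b \<in> carrier V} =
     {frag_of (L.cl (f + g), v) - frag_of (L.cl f, v) - frag_of (L.cl g, v) | f g v.
        f \<in> carrier AL \<and> g \<in> carrier AL \<and> v \<in> carrier V}" (is "?l = ?r")
  proof -
    have eq: "frag_of (L.cl f \<oplus>\<^bsub>env_alg L\<^esub> L.cl g, v) - frag_of (L.cl f, v) - frag_of (L.cl g, v)
       = frag_of (L.cl (f + g), v) - frag_of (L.cl f, v) - frag_of (L.cl g, v)"
      if "f \<in> carrier AL" "g \<in> carrier AL" for f g and v :: 'v
      using L.cl_add[OF that] by simp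
    have "?l = {frag_of (L.cl f \<oplus>\<^bsub>env_alg L\<^esub> L.cl g, v) - frag_of (L.cl f, v) - frag_of (L.cl g, v) | f g v.
        f \<in> carrier AL \<and> g \<in> carrier AL \<and> v \<in> carrier V}"
      unfolding L.carrier_env by blast
    also have "\<dots> = ?r"
    proof (intro Collect_cong iff_exI)
      fix x f g v
      show "(x = frag_of (L.cl f \<oplus>\<^bsub>env_alg L\<^esub> L.cl g, v) - frag_of (L.cl f, v) - frag_of (L.cl g, v) \<and> f \<in> carrier AL \<and> g \<in> carrier AL \<and> v \<in> carrier V) =
        (x = frag_of (L.cl (f + g), v) - frag_of (L.cl f, v) - frag_of (L.cl g, v) \<and> f \<in> carrier AL \<and> g \<in> carrier AL \<and> v \<in> carrier V)"
        using eq[of f g v] by metis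
    qed
    finally show ?thesis .
  qed
  have 2: "{frag_of (a, b \<oplus>\<^bsub>V\<^esub> b') - frag_of (a, b) - frag_of (a, b') | a b b'.
        a \<in> carrier (env_alg L) \<and> b \<in> carrier V \<and> b' \<in> carrier V} =
     {frag_of (L.cl f, v \<oplus>\<^bsub>V\<^esub> w) - frag_of (L.cl f, v) - frag_of (L.cl f, w) | f v w.
        f \<in> carrier AL \<and> v \<in> carrier V \<and> w \<in> carrier V}"
    unfolding L.carrier_env by blast
  have 3: "{frag_of (a \<otimes>\<^bsub>env_alg L\<^esub> env_incl L s, b) - frag_of (a, env_act V \<rho> s b) | a s b.
        a \<in> carrier (env_alg L) \<and> s \<in> carrier (env_alg K) \<and> b \<in> carrier V} =
     {frag_of (L.cl (f * s), v) - frag_of (L.cl f, V.act s v) | f s v.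
        f \<in> carrier AL \<and> s \<in> carrier AK \<and> v \<in> carrier V}" (is "?l = ?r")
  proof -
    have eq: "frag_of (L.cl f \<otimes>\<^bsub>env_alg L\<^esub> env_incl L (V.cl s), v) - frag_of (L.cl f, env_act V \<rho> (V.cl s) v)
       = frag_of (L.cl (f * s), v) - frag_of (L.cl f, V.act s v)"
      if "f \<in> carrier AL" "s \<in> carrier AK" "v \<in> carrier V" for f s v
      using env_incl_cl[OF that(2)] L.cl_mult[OF that(1) AK_AL[OF that(2)]] V.env_act_cl[OF that(2,3)] by simp
    have "?l = {frag_of (L.cl f \<otimes>\<^bsub>env_alg L\<^esub> env_incl L (V.cl s), v) - frag_of (L.cl f, env_act V \<rho> (V.cl s) v) | f s v.
        f \<in> carrier AL \<and> s \<in> carrier AK \<and> v \<in> carrier V}"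
      unfolding L.carrier_env V.carrier_env by blast
    also have "\<dots> = ?r" using eq by (intro Collect_cong iff_exI) metis
    finally show ?thesis .
  qed
  show ?thesis unfolding ind_rel_def tensor_rel_def gens_def 1 2 3 ..
qed

lemma frag_closed: "f \<in> carrier AL \<Longrightarrow> v \<in> carrier V \<Longrightarrow> frag_of (L.cl f, v) \<in> carrier FG"
  using L.cl_closed by simp

sublocale FG: comm_group FG by (rule abelian_free_Abelian_group)

lemma FG_diff: "x \<in> carrier FG \<Longrightarrow> y \<in> carrier FG \<Longrightarrow> x - y \<in> carrier FG"
  using FG.m_closed[of x "inv\<^bsub>FG\<^esub> y"] FG.inv_closed[of y] by simp

lemma gens_closed: "gens \<subseteq> carrier FG"
  unfolding gens_def
  by (auto simp del: carrier_free_Abelian_group_iff free_alg_simps(1)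
    intro!: FG_diff frag_closed free_mult_closed free_add_closed V.fact_closed intro: AK_AL)

lemma rel_subgroup: "subgroup rel FG"
  unfolding rel_eq by (rule FG.generate_is_subgroup[OF gens_closed])

lemma rel_normal: "rel \<lhd> FG"
  by (rule FG.subgroup_imp_normal[OF rel_subgroup])

lemma G_eq: "G = FG Mod rel"
  by (simp add: ind_group_def tensor_prod_def ind_rel_def)

sublocale G: comm_group G
  unfolding G_eq by (rule FG.abelian_FactGroup[OF rel_subgroup])

text \<open>The pure tensor of the class of \<open>f\<close> with \<open>v\<close>. Keeping a
  representative \<open>f\<close> avoids computing with cosets of the enveloping algebra.\<close>

definition T :: "('a word \<Rightarrow>\<^sub>0 complex) \<Rightarrow> 'v \<Rightarrow> (('a word \<Rightarrow>\<^sub>0 complex) set \<times> 'v \<Rightarrow>\<^sub>0 int) set" where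
  "T f v = rel #>\<^bsub>FG\<^esub> frag_of (L.cl f, v)"

lemma coset_closed: "F \<in> carrier FG \<Longrightarrow> rel #>\<^bsub>FG\<^esub> F \<in> carrier G"
  unfolding G_eq FactGroup_def RCOSETS_def by auto

lemma carrier_G: "X \<in> carrier G \<Longrightarrow> \<exists>F\<in>carrier FG. X = rel #>\<^bsub>FG\<^esub> F"
  unfolding G_eq FactGroup_def RCOSETS_def by auto

lemma coset_mult: "F \<in> carrier FG \<Longrightarrow> F' \<in> carrier FG \<Longrightarrow> (rel #>\<^bsub>FG\<^esub> F) \<otimes>\<^bsub>G\<^esub> (rel #>\<^bsub>FG\<^esub> F') = rel #>\<^bsub>FG\<^esub> (F + F')"
  unfolding G_eq FactGroup_def using normal.rcos_sum[OF rel_normal, of F F'] by simp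

lemma coset_cong: 
  assumes "F \<in> carrier FG" "F' \<in> carrier FG" "F - F' \<in> rel" shows "rel #>\<^bsub>FG\<^esub> F = rel #>\<^bsub>FG\<^esub> F'"
proof -
  have "F \<in> rel #>\<^bsub>FG\<^esub> F'" unfolding r_coset_def using assms(3) by (auto intro!: bexI[of _ "F - F'"])
  then show ?thesis using FG.repr_independence[OF _ assms(2) rel_subgroup] by simp
qed

lemma gens_rel: "F \<in> gens \<Longrightarrow> F \<in> rel"
  unfolding rel_eq by (rule generate.incl)

lemma T_closed: "f \<in> carrier AL \<Longrightarrow> v \<in> carrier V \<Longrightarrow> T f v \<in> carrier G"
  unfolding T_def by (rule coset_closed[OF frag_closed])

lemma T_cong: "f \<in> carrier AL \<Longrightarrow> g \<in> carrier AL \<Longrightarrow> f - g \<in> env_ideal L \<Longrightarrow> T f v = T g v"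
  unfolding T_def using L.cl_cong by simp

lemma T_add_l:
  assumes "f \<in> carrier AL" "g \<in> carrier AL" "v \<in> carrier V" shows "T (f + g) v = T f v \<otimes>\<^bsub>G\<^esub> T g v"
proof -
  have "frag_of (L.cl (f + g), v) - frag_of (L.cl f, v) - frag_of (L.cl g, v) \<in> gens"
    unfolding gens_def using assms by blast
  then have "frag_of (L.cl (f + g), v) - (frag_of (L.cl f, v) + frag_of (L.cl g, v)) \<in> rel"
    using gens_rel by (simp add: algebra_simps)
  then show ?thesis unfolding T_def
    using coset_mult[OF frag_closed[OF assms(1,3)] frag_closed[OF assms(2,3)]]
      coset_cong[OF frag_closed[OF free_add_closed[OF assms(1,2)] assms(3)]] FG.m_closed[OF frag_closed[OF assms(1,3)] frag_closed[OF assms(2,3)]]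
    by (simp del: carrier_free_Abelian_group_iff frag_of_in_free_Abelian_group)
qed

lemma T_add_r:
  assumes "f \<in> carrier AL" "v \<in> carrier V" "w \<in> carrier V" shows "T f (v \<oplus>\<^bsub>V\<^esub> w) = T f v \<otimes>\<^bsub>G\<^esub> T f w"
proof -
  have "frag_of (L.cl f, v \<oplus>\<^bsub>V\<^esub> w) - frag_of (L.cl f, v) - frag_of (L.cl f, w) \<in> gens"
    unfolding gens_def using assms by blast
  then have "frag_of (L.cl f, v \<oplus>\<^bsub>V\<^esub> w) - (frag_of (L.cl f, v) + frag_of (L.cl f, w)) \<in> rel"
    using gens_rel by (simp add: algebra_simps)
  then show ?thesis unfolding T_def
    using coset_mult[OF frag_closed[OF assms(1,2)] frag_closed[OF assms(1,3)]]
      coset_cong[OF frag_closed[OF assms(1) V.V.a_closed[OF assms(2,3)]]] FG.m_closed[OF frag_closed[OF assms(1,2)] frag_closed[OF assms(1,3)]]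
    by (simp del: carrier_free_Abelian_group_iff frag_of_in_free_Abelian_group)
qed

lemma T_move:
  assumes "f \<in> carrier AL" "s \<in> carrier AK" "v \<in> carrier V" shows "T (f * s) v = T f (V.act s v)"
proof -
  have "frag_of (L.cl (f * s), v) - frag_of (L.cl f, V.act s v) \<in> gens"
    unfolding gens_def using assms by blast
  then have "frag_of (L.cl (f * s), v) - frag_of (L.cl f, V.act s v) \<in> rel"
    by (rule gens_rel)
  then show ?thesis unfolding T_def
    by (intro coset_cong frag_closed V.fact_closed free_mult_closed AK_AL assms)
qed

text \<open>Pure tensors generate the quotient as a group, so inverses form a case. The neutral
  element does not: it is the product of a pure tensor and its inverse.\<close>

lemma G_induct [consumes 1, case_names T mult inv]:
  assumes X: "X \<in> carrier G"
    and PT: "\<And>f v. f \<in> carrier AL \<Longrightarrow> v \<in> carrier V \<Longrightarrow> P (T f v)"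
    and Pm: "\<And>X Y. X \<in> carrier G \<Longrightarrow> Y \<in> carrier G \<Longrightarrow> P X \<Longrightarrow> P Y \<Longrightarrow> P (X \<otimes>\<^bsub>G\<^esub> Y)"
    and Pi: "\<And>X. X \<in> carrier G \<Longrightarrow> P X \<Longrightarrow> P (inv\<^bsub>G\<^esub> X)"
  shows "P X"
proof -
  obtain F where F: "F \<in> carrier FG" "X = rel #>\<^bsub>FG\<^esub> F" using carrier_G X by blast
  have 0: "P (rel #>\<^bsub>FG\<^esub> 0)"
  proof -
    have T0: "T 0 \<zero>\<^bsub>V\<^esub> \<in> carrier G" "P (T 0 \<zero>\<^bsub>V\<^esub>)" by (auto intro!: T_closed PT free_zero_closed)
    then have "P (T 0 \<zero>\<^bsub>V\<^esub> \<otimes>\<^bsub>G\<^esub> inv\<^bsub>G\<^esub> T 0 \<zero>\<^bsub>V\<^esub>)" by (intro Pm Pi G.inv_closed)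
    moreover have "rel #>\<^bsub>FG\<^esub> 0 = \<one>\<^bsub>G\<^esub>"
      unfolding G_eq FactGroup_def
      using FG.coset_join2[OF _ rel_subgroup subgroup.one_closed[OF rel_subgroup]] by simp
    ultimately show ?thesis using T0 by simp
  qed
  have "Poly_Mapping.keys F \<subseteq> S" using F by simp
  then have "P (rel #>\<^bsub>FG\<^esub> F)"
  proof (induction F rule: free_Abelian_group_induct[consumes 1, case_names zero diff of])
    case zero
    then show ?case by (rule 0)
  next
    case (diff x y)
    have c: "x \<in> carrier FG" "y \<in> carrier FG" using diff by simp_all
    have "(rel #>\<^bsub>FG\<^esub> (x - y)) \<otimes>\<^bsub>G\<^esub> (rel #>\<^bsub>FG\<^esub> y) = rel #>\<^bsub>FG\<^esub> x"
      using coset_mult[OF FG_diff[OF c] c(2)] by simp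
    then have "rel #>\<^bsub>FG\<^esub> (x - y) = (rel #>\<^bsub>FG\<^esub> x) \<otimes>\<^bsub>G\<^esub> inv\<^bsub>G\<^esub> (rel #>\<^bsub>FG\<^esub> y)"
      using coset_closed[OF FG_diff[OF c]] coset_closed[OF c(1)] coset_closed[OF c(2)] by (metis G.inv_solve_right)
    then show ?case using diff Pm Pi coset_closed c by simp
  next
    case (of a)
    then obtain f v where "a = (L.cl f, v)" "f \<in> carrier AL" "v \<in> carrier V" unfolding L.carrier_env by blast
    then show ?case using PT by (simp add: T_def del: free_alg_simps(1))
  qed
  then show ?thesis using F by simp
qed

subsection \<open>Left multiplication\<close>

abbreviation lmul :: "('a word \<Rightarrow>\<^sub>0 complex) set \<Rightarrow> (('a word \<Rightarrow>\<^sub>0 complex) set \<times> 'v \<Rightarrow>\<^sub>0 int) \<Rightarrow> (('a word \<Rightarrow>\<^sub>0 complex) set \<times> 'v \<Rightarrow>\<^sub>0 int)" where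
  "lmul u \<equiv> frag_extend (\<lambda>(a, v). frag_of (u \<otimes>\<^bsub>env_alg L\<^esub> a, v))"

lemma lmul_of: "u \<in> carrier AL \<Longrightarrow> f \<in> carrier AL \<Longrightarrow> lmul (L.cl u) (frag_of (L.cl f, v)) = frag_of (L.cl (u * f), v)"
  using L.cl_mult[of u f] by (simp del: free_alg_simps(1))

lemma lmul_closed:
  assumes "u \<in> carrier AL" "F \<in> carrier FG" shows "lmul (L.cl u) F \<in> carrier FG"
proof -
  have "Poly_Mapping.keys F \<subseteq> S" using assms by simp
  then show ?thesis
  proof (induction F rule: free_Abelian_group_induct[consumes 1, case_names zero diff of])
    case (diff x y)
    then show ?case using FG_diff by (simp add: frag_extend_diff del: carrier_free_Abelian_group_iff frag_of_in_free_Abelian_group)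
  next
    case (of a)
    then obtain f v where "a = (L.cl f, v)" "f \<in> carrier AL" "v \<in> carrier V" unfolding L.carrier_env by blast
    then show ?case using lmul_of[OF assms(1)] frag_closed free_mult_closed[OF assms(1)]
      by (simp del: carrier_free_Abelian_group_iff free_alg_simps(1))
  qed simp
qed

text \<open>Each generating relation is sent to a relation of the same family, and the elements sent
  into \<open>rel\<close> form a subgroup. Left multiplication is thus well defined on
  cosets.\<close>

lemma lmul_rel:
  assumes u: "u \<in> carrier AL" and F: "F \<in> rel" shows "lmul (L.cl u) F \<in> rel"
proof -
  have "rel \<subseteq> {F \<in> carrier FG. lmul (L.cl u) F \<in> rel}"
    unfolding rel_eq
  proof (rule FG.generate_subgroup_incl)
    show "gens \<subseteq> {F \<in> carrier FG. lmul (L.cl u) F \<in> generate FG gens}"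
    proof
      fix F assume F: "F \<in> gens"
      have "lmul (L.cl u) F \<in> gens"
        using F unfolding gens_def
      proof (elim UnE CollectE exE conjE)
        fix f g v assume h: "F = frag_of (L.cl (f + g), v) - frag_of (L.cl f, v) - frag_of (L.cl g, v)" "f \<in> carrier AL" "g \<in> carrier AL" "v \<in> carrier V"
        then have "lmul (L.cl u) F = frag_of (L.cl (u * f + u * g), v) - frag_of (L.cl (u * f), v) - frag_of (L.cl (u * g), v)"
          using lmul_of[OF u] free_add_closed[OF h(2,3)] by (simp add: frag_extend_diff distrib_left del: free_alg_simps(1) frag_extend_of)
        then show "lmul (L.cl u) F \<in> {frag_of (L.cl (f + g), v) - frag_of (L.cl f, v) - frag_of (L.cl g, v) | f g v.
            f \<in> carrier AL \<and> g \<in> carrier AL \<and> v \<in> carrier V} \<union>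
         {frag_of (L.cl f, v \<oplus>\<^bsub>V\<^esub> w) - frag_of (L.cl f, v) - frag_of (L.cl f, w) | f v w.
            f \<in> carrier AL \<and> v \<in> carrier V \<and> w \<in> carrier V} \<union>
         {frag_of (L.cl (f * s), v) - frag_of (L.cl f, V.act s v) | f s v.
            f \<in> carrier AL \<and> s \<in> carrier AK \<and> v \<in> carrier V}"
          using free_mult_closed[OF u h(2)] free_mult_closed[OF u h(3)] h(4) by blast
      next
        fix f v w assume h: "F = frag_of (L.cl f, v \<oplus>\<^bsub>V\<^esub> w) - frag_of (L.cl f, v) - frag_of (L.cl f, w)" "f \<in> carrier AL" "v \<in> carrier V" "w \<in> carrier V"
        then have "lmul (L.cl u) F = frag_of (L.cl (u * f), v \<oplus>\<^bsub>V\<^esub> w) - frag_of (L.cl (u * f), v) - frag_of (L.cl (u * f), w)"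
          using lmul_of[OF u] by (simp add: frag_extend_diff del: free_alg_simps(1) frag_extend_of)
        then show "lmul (L.cl u) F \<in> {frag_of (L.cl (f + g), v) - frag_of (L.cl f, v) - frag_of (L.cl g, v) | f g v.
            f \<in> carrier AL \<and> g \<in> carrier AL \<and> v \<in> carrier V} \<union>
         {frag_of (L.cl f, v \<oplus>\<^bsub>V\<^esub> w) - frag_of (L.cl f, v) - frag_of (L.cl f, w) | f v w.
            f \<in> carrier AL \<and> v \<in> carrier V \<and> w \<in> carrier V} \<union>
         {frag_of (L.cl (f * s), v) - frag_of (L.cl f, V.act s v) | f s v.
            f \<in> carrier AL \<and> s \<in> carrier AK \<and> v \<in> carrier V}"
          using free_mult_closed[OF u h(2)] h(3,4) by blast
      next
        fix f s v assume h: "F = frag_of (L.cl (f * s), v) - frag_of (L.cl f, V.act s v)" "f \<in> carrier AL" "s \<in> carrier AK" "v \<in> carrier V"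
        then have "lmul (L.cl u) F = frag_of (L.cl (u * f * s), v) - frag_of (L.cl (u * f), V.act s v)"
          using lmul_of[OF u] free_mult_closed[OF h(2) AK_AL[OF h(3)]] by (simp add: frag_extend_diff mult.assoc del: free_alg_simps(1) frag_extend_of)
        then show "lmul (L.cl u) F \<in> {frag_of (L.cl (f + g), v) - frag_of (L.cl f, v) - frag_of (L.cl g, v) | f g v.
            f \<in> carrier AL \<and> g \<in> carrier AL \<and> v \<in> carrier V} \<union>
         {frag_of (L.cl f, v \<oplus>\<^bsub>V\<^esub> w) - frag_of (L.cl f, v) - frag_of (L.cl f, w) | f v w.
            f \<in> carrier AL \<and> v \<in> carrier V \<and> w \<in> carrier V} \<union>
         {frag_of (L.cl (f * s), v) - frag_of (L.cl f, V.act s v) | f s v.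
            f \<in> carrier AL \<and> s \<in> carrier AK \<and> v \<in> carrier V}"
          using free_mult_closed[OF u h(2)] h(3,4) by blast
      qed
      then show "F \<in> {F \<in> carrier FG. lmul (L.cl u) F \<in> generate FG gens}"
        using F gens_closed by (auto intro: generate.incl simp del: carrier_free_Abelian_group_iff frag_of_in_free_Abelian_group)
    qed
    show "subgroup {F \<in> carrier FG. lmul (L.cl u) F \<in> generate FG gens} FG"
    proof (rule FG.subgroupI)
      show "{F \<in> carrier FG. lmul (L.cl u) F \<in> generate FG gens} \<noteq> {}"
        using generate.one[of FG gens] by (auto intro!: exI[of _ 0])
      fix a assume a: "a \<in> {F \<in> carrier FG. lmul (L.cl u) F \<in> generate FG gens}"
      then have "inv\<^bsub>FG\<^esub> (lmul (L.cl u) a) \<in> generate FG gens"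
        using FG.generate_m_inv_closed[OF gens_closed] by blast
      then show "inv\<^bsub>FG\<^esub> a \<in> {F \<in> carrier FG. lmul (L.cl u) F \<in> generate FG gens}"
        using a lmul_closed[OF u, of a] by (simp add: frag_extend_minus)
      fix b assume b: "b \<in> {F \<in> carrier FG. lmul (L.cl u) F \<in> generate FG gens}"
      then have "lmul (L.cl u) a + lmul (L.cl u) b \<in> generate FG gens"
        using a generate.eng[of "lmul (L.cl u) a" FG gens "lmul (L.cl u) b"] by simp
      then show "a \<otimes>\<^bsub>FG\<^esub> b \<in> {F \<in> carrier FG. lmul (L.cl u) F \<in> generate FG gens}"
        using a b FG.m_closed[of a b] by (simp add: frag_extend_add)
    qed auto
  qed
  then show ?thesis using F by blast
qed

abbreviation "imul \<equiv> ind_mult L K V \<rho>"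

lemma imul_coset:
  assumes u: "u \<in> carrier AL" and F: "F \<in> carrier FG"
  shows "imul (L.cl u) (rel #>\<^bsub>FG\<^esub> F) = rel #>\<^bsub>FG\<^esub> lmul (L.cl u) F"
proof -
  have "rel #>\<^bsub>FG\<^esub> lmul (L.cl u) F' = rel #>\<^bsub>FG\<^esub> lmul (L.cl u) F" if F': "F' \<in> rel #>\<^bsub>FG\<^esub> F" for F'
  proof -
    obtain r where r: "r \<in> rel" "F' = r + F" using F' unfolding r_coset_def by auto
    have rc: "r \<in> carrier FG" using r subgroup.subset[OF rel_subgroup] by blast
    have "F' \<in> carrier FG" using FG.m_closed[OF rc F] r by simp
    then show ?thesis
      using r lmul_rel[OF u r(1)] by (intro coset_cong lmul_closed u F) (simp_all add: frag_extend_add)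
  qed
  moreover have "F \<in> rel #>\<^bsub>FG\<^esub> F" using FG.rcos_self[OF F rel_subgroup] .
  ultimately show ?thesis unfolding ind_mult_def by blast
qed

lemma imul_T: "u \<in> carrier AL \<Longrightarrow> f \<in> carrier AL \<Longrightarrow> v \<in> carrier V \<Longrightarrow> imul (L.cl u) (T f v) = T (u * f) v"
  using imul_coset[of u, OF _ frag_closed] lmul_of by (simp add: T_def del: free_alg_simps(1) frag_extend_of)

lemma imul_closed: "u \<in> carrier AL \<Longrightarrow> X \<in> carrier G \<Longrightarrow> imul (L.cl u) X \<in> carrier G"
  using carrier_G imul_coset lmul_closed coset_closed by metis

lemma imul_mult:
  assumes u: "u \<in> carrier AL" and X: "X \<in> carrier G" and Y: "Y \<in> carrier G"
  shows "imul (L.cl u) (X \<otimes>\<^bsub>G\<^esub> Y) = imul (L.cl u) X \<otimes>\<^bsub>G\<^esub> imul (L.cl u) Y"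
proof -
  obtain F F' where F: "F \<in> carrier FG" "X = rel #>\<^bsub>FG\<^esub> F" "F' \<in> carrier FG" "Y = rel #>\<^bsub>FG\<^esub> F'"
    using carrier_G X Y by metis
  have "F + F' \<in> carrier FG" using FG.m_closed F by simp
  then show ?thesis
    unfolding F coset_mult[OF F(1,3)] imul_coset[OF u F(1)] imul_coset[OF u F(3)]
    using imul_coset[OF u] coset_mult[OF lmul_closed[OF u F(1)] lmul_closed[OF u F(3)]] by (simp add: frag_extend_add del: carrier_free_Abelian_group_iff frag_of_in_free_Abelian_group)
qed

lemma imul_inv:
  assumes u: "u \<in> carrier AL" and X: "X \<in> carrier G"
  shows "imul (L.cl u) (inv\<^bsub>G\<^esub> X) = inv\<^bsub>G\<^esub> (imul (L.cl u) X)"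
proof -
  have "imul (L.cl u) \<in> hom G G" by (rule homI) (auto simp: imul_closed u imul_mult simp del: free_alg_simps(1))
  then interpret group_hom G G "imul (L.cl u)" by unfold_locales
  show ?thesis using hom_inv X by simp
qed

subsection \<open>The universal property\<close>

text \<open>Existence half of Frobenius reciprocity. The assignment of \<open>f\<close> acting on
  \<open>\<iota> v\<close> to the pair of the class of \<open>f\<close> and \<open>v\<close> is
  biadditive, and balanced because \<open>\<iota>\<close> is equivariant under \<open>K\<close>; so
  the induced map on the free abelian group kills all relations.\<close>

lemma universal:
  assumes N: "lie_module L N \<sigma>"
    and \<iota>: "\<And>v. v \<in> carrier V \<Longrightarrow> \<iota> v \<in> carrier N"
      "\<And>v w. v \<in> carrier V \<Longrightarrow> w \<in> carrier V \<Longrightarrow> \<iota> (v \<oplus>\<^bsub>V\<^esub> w) = \<iota> v \<oplus>\<^bsub>N\<^esub> \<iota> w"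
      "\<And>c v. v \<in> carrier V \<Longrightarrow> \<iota> (c \<odot>\<^bsub>V\<^esub> v) = c \<odot>\<^bsub>N\<^esub> \<iota> v"
      "\<And>y v. y \<in> carrier K \<Longrightarrow> v \<in> carrier V \<Longrightarrow> \<sigma> y (\<iota> v) = \<iota> (\<rho> y v)"
  obtains \<Psi> where "\<Psi> \<in> hom G (add_monoid N)"
    "\<And>f v. f \<in> carrier AL \<Longrightarrow> v \<in> carrier V \<Longrightarrow> \<Psi> (T f v) = free_act N \<sigma> f (\<iota> v)"
proof -
  interpret N: rep L N \<sigma> using N by (simp add: rep_def L.lie_ops_axioms)
  have N0: "\<iota> \<zero>\<^bsub>V\<^esub> = \<zero>\<^bsub>N\<^esub>" using \<iota>(3)[of "\<zero>\<^bsub>V\<^esub>" 0] \<iota>(1) by simp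
  have fold: "foldr \<sigma> xs (\<iota> v) = \<iota> (foldr \<rho> xs v)" if "set xs \<subseteq> carrier K" "v \<in> carrier V" for xs v
    using that by (induction xs) (auto simp: \<iota>(4) V.fold_closed)
  \<comment> \<open>Equivariance passes from single elements of \<open>K\<close> to words over
    \<open>K\<close> and their combinations; this is the balancing condition.\<close>
  have actK: "N.act s (\<iota> v) = \<iota> (V.act s v)" if "s \<in> carrier AK" "v \<in> carrier V" for s v
    using that(1)
  proof (induction s rule: free_induct)
    case zero
    then show ?case by (simp add: N.fact_zero V.fact_zero N0)
  next
    case (single xs c)
    then have "set xs \<subseteq> carrier L" using K_sub by blast
    then show ?case using single that(2) by (simp add: N.fact_single V.fact_single \<iota> V.fold_closed fold)
  next
    case (add f g)
    then show ?case using that(2) by (simp add: N.fact_add V.fact_add \<iota> V.fact_closed AK_AL del: free_alg_simps(1))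
  qed
  interpret NG: comm_group "add_monoid N" by (rule N.V.a_comm_group)
  let ?f = "\<lambda>(a, v). env_act N \<sigma> a (\<iota> v)"
  have fv: "?f (L.cl f, v) = N.act f (\<iota> v)" if "f \<in> carrier AL" "v \<in> carrier V" for f v
    using N.env_act_cl[OF that(1) \<iota>(1)[OF that(2)]] by simp
  have "?f ` S \<subseteq> carrier (add_monoid N)"
  proof
    fix y assume "y \<in> ?f ` S"
    then obtain f v where "y = ?f (L.cl f, v)" "f \<in> carrier AL" "v \<in> carrier V" unfolding L.carrier_env by blast
    then show "y \<in> carrier (add_monoid N)" using fv N.fact_closed \<iota>(1) by (simp del: free_alg_simps(1))
  qed
  from comm_group.free_Abelian_group_universal[OF N.V.a_comm_group this]
  obtain h where h: "h \<in> hom FG (add_monoid N)" "\<And>x. x \<in> S \<Longrightarrow> h (frag_of x) = ?f x" by blast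
  interpret h: group_hom FG "add_monoid N" h using h(1) by unfold_locales
  have hT: "h (frag_of (L.cl f, v)) = N.act f (\<iota> v)" if "f \<in> carrier AL" "v \<in> carrier V" for f v
    using h(2)[of "(L.cl f, v)"] fv[OF that] that L.cl_closed by (simp del: free_alg_simps(1))
  have hd: "h (x - y) = h x \<ominus>\<^bsub>N\<^esub> h y" if "x \<in> carrier FG" "y \<in> carrier FG" for x y
  proof -
    have "h (x \<otimes>\<^bsub>FG\<^esub> inv\<^bsub>FG\<^esub> y) = h x \<oplus>\<^bsub>N\<^esub> inv\<^bsub>add_monoid N\<^esub> (h y)"
      using h.hom_mult[OF that(1) FG.inv_closed[OF that(2)]] h.hom_inv[OF that(2)] by simp
    moreover have "x \<otimes>\<^bsub>FG\<^esub> inv\<^bsub>FG\<^esub> y = x - y" using that by simp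
    ultimately show ?thesis by (simp add: a_minus_def a_inv_def)
  qed
  have gens_ker: "h F = \<zero>\<^bsub>N\<^esub>" if "F \<in> gens" for F
    using that unfolding gens_def
  proof (elim UnE CollectE exE conjE)
    fix f g v assume e: "F = frag_of (L.cl (f + g), v) - frag_of (L.cl f, v) - frag_of (L.cl g, v)" "f \<in> carrier AL" "g \<in> carrier AL" "v \<in> carrier V"
    show ?thesis unfolding e(1) using e(2-) \<iota>(1)
      by (simp add: hd hT FG_diff frag_closed free_add_closed N.fact_add N.fact_closed N.V.add_minus_minus del: free_alg_simps(1) carrier_free_Abelian_group_iff frag_of_in_free_Abelian_group)
  next
    fix f v w assume e: "F = frag_of (L.cl f, v \<oplus>\<^bsub>V\<^esub> w) - frag_of (L.cl f, v) - frag_of (L.cl f, w)" "f \<in> carrier AL" "v \<in> carrier V" "w \<in> carrier V"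
    show ?thesis unfolding e(1) using e(2-) \<iota>(1,2)
      by (simp add: hd hT FG_diff frag_closed N.fact_add_r N.fact_closed N.V.add_minus_minus del: free_alg_simps(1) carrier_free_Abelian_group_iff frag_of_in_free_Abelian_group)
  next
    fix f s v assume e: "F = frag_of (L.cl (f * s), v) - frag_of (L.cl f, V.act s v)" "f \<in> carrier AL" "s \<in> carrier AK" "v \<in> carrier V"
    show ?thesis unfolding e(1) using e(2-) \<iota>(1)
      by (simp add: hd hT frag_closed free_mult_closed AK_AL V.fact_closed N.fact_mult N.fact_closed actK a_minus_def N.V.r_neg del: free_alg_simps(1) carrier_free_Abelian_group_iff frag_of_in_free_Abelian_group)
  qed
  have "rel \<subseteq> kernel FG (add_monoid N) h"
    unfolding rel_eq
  proof (rule FG.generate_subgroup_incl)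
    show "gens \<subseteq> kernel FG (add_monoid N) h" using gens_ker gens_closed unfolding kernel_def by (simp del: carrier_free_Abelian_group_iff) blast
    show "subgroup (kernel FG (add_monoid N) h) FG" by (rule h.subgroup_kernel)
  qed
  from h.FactGroup_universal_kernel[OF rel_normal this]
  obtain g where g: "g \<in> hom (FG Mod rel) (add_monoid N)" "\<And>x. x \<in> carrier FG \<Longrightarrow> g (rel #>\<^bsub>FG\<^esub> x) = h x" by blast
  show ?thesis
  proof (rule that[of g])
    show "g \<in> hom G (add_monoid N)" using g(1) by (simp add: G_eq)
    show "g (T f v) = free_act N \<sigma> f (\<iota> v)" if "f \<in> carrier AL" "v \<in> carrier V" for f v
      unfolding T_def using g(2)[OF frag_closed[OF that]] hT[OF that] by simp
  qed
qed

text \<open>Both sides are additive in \<open>X\<close>, and on pure tensors the claim is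
  multiplicativity of the action on \<open>N\<close>.\<close>

lemma universal_mul:
  assumes N: "lie_module L N \<sigma>"
    and \<iota>: "\<And>v. v \<in> carrier V \<Longrightarrow> \<iota> v \<in> carrier N"
    and \<Psi>: "\<Psi> \<in> hom G (add_monoid N)" "\<And>f v. f \<in> carrier AL \<Longrightarrow> v \<in> carrier V \<Longrightarrow> \<Psi> (T f v) = free_act N \<sigma> f (\<iota> v)"
    and u: "u \<in> carrier AL" and X: "X \<in> carrier G"
  shows "\<Psi> (imul (L.cl u) X) = free_act N \<sigma> u (\<Psi> X)"
proof -
  interpret N: rep L N \<sigma> using N by (simp add: rep_def L.lie_ops_axioms)
  interpret NG: comm_group "add_monoid N" by (rule N.V.a_comm_group)
  interpret \<Psi>: group_hom G "add_monoid N" \<Psi> using \<Psi>(1) by unfold_locales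
  have \<Psi>c: "\<Psi> X \<in> carrier N" if "X \<in> carrier G" for X using \<Psi>.hom_closed[OF that] by simp
  have \<Psi>i: "\<Psi> (inv\<^bsub>G\<^esub> X) = \<ominus>\<^bsub>N\<^esub> \<Psi> X" if "X \<in> carrier G" for X using \<Psi>.hom_inv[OF that] by (simp add: a_inv_def)
  have ainv: "N.act u (\<ominus>\<^bsub>N\<^esub> x) = \<ominus>\<^bsub>N\<^esub> N.act u x" if "x \<in> carrier N" for x
    using N.fact_smult_r[OF u that, of "- 1"] that N.fact_closed[OF u that] by (simp add: N.V.sm_neg_one)
  show ?thesis using X
  proof (induction X rule: G_induct)
    case (T f v)
    then show ?case using \<Psi>(2)[of "u * f" v] \<Psi>(2)[of f v] N.fact_mult[OF u] \<iota> u
      by (simp add: imul_T free_mult_closed del: free_alg_simps(1))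
  next
    case (mult X Y)
    then show ?case using \<Psi>.hom_mult \<Psi>c imul_closed[OF u] by (simp add: imul_mult u N.fact_add_r[OF u] del: free_alg_simps(1))
  next
    case (inv X)
    then show ?case
      unfolding imul_inv[OF u inv(1)] \<Psi>i[OF imul_closed[OF u inv(1)]] \<Psi>i[OF inv(1)] ainv[OF \<Psi>c[OF inv(1)]] by simp
  qed
qed

end

subsection \<open>Transport of structure\<close>

lemma subspace_iff:
  assumes "vectorspace class_ring (V :: (complex, 'v) module)"
  shows "VectorSpace.subspace class_ring W V \<longleftrightarrow> W \<subseteq> carrier V \<and> \<zero>\<^bsub>V\<^esub> \<in> W \<and>
    (\<forall>v\<in>W. \<forall>w\<in>W. v \<oplus>\<^bsub>V\<^esub> w \<in> W) \<and> (\<forall>c. \<forall>v\<in>W. c \<odot>\<^bsub>V\<^esub> v \<in> W)"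
proof -
  interpret vectorspace class_ring V by (rule assms)
  show ?thesis
    unfolding VectorSpace.subspace_def LinearCombinations.submodule_def using assms module_axioms by auto
qed

lemma vectorspace_classI:
  fixes V :: "(complex, 'v) module" (structure)
  assumes "abelian_group V"
    and "\<And>c v. v \<in> carrier V \<Longrightarrow> c \<odot> v \<in> carrier V"
    and "\<And>c d v. v \<in> carrier V \<Longrightarrow> (c + d) \<odot> v = c \<odot> v \<oplus> d \<odot> v"
    and "\<And>c v w. \<lbrakk>v \<in> carrier V; w \<in> carrier V\<rbrakk> \<Longrightarrow> c \<odot> (v \<oplus> w) = c \<odot> v \<oplus> c \<odot> w"
    and "\<And>c d v. v \<in> carrier V \<Longrightarrow> (c * d) \<odot> v = c \<odot> (d \<odot> v)"
    and "\<And>v. v \<in> carrier V \<Longrightarrow> 1 \<odot> v = v"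
  shows "vectorspace class_ring V"
proof -
  have "field (class_ring :: complex ring)" using matrix_vs[of 0 0] by (rule vectorspace.axioms(2))
  moreover have "module class_ring V"
    by (rule moduleI) (use assms class_cring.cring_axioms in auto)
  ultimately show ?thesis by (simp add: vectorspace_def)
qed

text \<open>Only closure is assumed of \<open>P\<close>. Every law is verified after applying the
  injective map \<open>\<Psi>\<close>, where it holds in \<open>N\<close>.\<close>

locale transport =
  fixes L :: "'a lie_algebra" and P :: "(complex, 'p) module" and a and N :: "(complex, 'n) module" and \<sigma> and \<Psi>
  assumes N: "lie_module L N \<sigma>"
    and bij: "bij_betw \<Psi> (carrier P) (carrier N)"
    and P0: "\<zero>\<^bsub>P\<^esub> \<in> carrier P" and Padd: "\<And>x y. x \<in> carrier P \<Longrightarrow> y \<in> carrier P \<Longrightarrow> x \<oplus>\<^bsub>P\<^esub> y \<in> carrier P"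
    and Psm: "\<And>c x. x \<in> carrier P \<Longrightarrow> c \<odot>\<^bsub>P\<^esub> x \<in> carrier P"
    and Pa: "\<And>l x. l \<in> carrier L \<Longrightarrow> x \<in> carrier P \<Longrightarrow> a l x \<in> carrier P"
    and h0: "\<Psi> \<zero>\<^bsub>P\<^esub> = \<zero>\<^bsub>N\<^esub>"
    and hadd: "\<And>x y. x \<in> carrier P \<Longrightarrow> y \<in> carrier P \<Longrightarrow> \<Psi> (x \<oplus>\<^bsub>P\<^esub> y) = \<Psi> x \<oplus>\<^bsub>N\<^esub> \<Psi> y"
    and hsm: "\<And>c x. x \<in> carrier P \<Longrightarrow> \<Psi> (c \<odot>\<^bsub>P\<^esub> x) = c \<odot>\<^bsub>N\<^esub> \<Psi> x"
    and ha: "\<And>l x. l \<in> carrier L \<Longrightarrow> x \<in> carrier P \<Longrightarrow> \<Psi> (a l x) = \<sigma> l (\<Psi> x)"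
    and L_add: "\<And>x y. \<lbrakk>x \<in> carrier L; y \<in> carrier L\<rbrakk> \<Longrightarrow> x \<oplus>\<^bsub>L\<^esub> y \<in> carrier L"
    and L_smult: "\<And>c x. x \<in> carrier L \<Longrightarrow> c \<odot>\<^bsub>L\<^esub> x \<in> carrier L"
    and L_bracket: "\<And>x y. \<lbrakk>x \<in> carrier L; y \<in> carrier L\<rbrakk> \<Longrightarrow> lie_bracket L x y \<in> carrier L"
begin

interpretation N: lie_module L N \<sigma> by (rule N)
interpretation NV: cvec N unfolding cvec_def by (rule N.vectorspace)

lemma hcl: "x \<in> carrier P \<Longrightarrow> \<Psi> x \<in> carrier N"
  using bij by (auto simp: bij_betw_def)

lemma eqI: "x \<in> carrier P \<Longrightarrow> y \<in> carrier P \<Longrightarrow> \<Psi> x = \<Psi> y \<Longrightarrow> x = y"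
  using bij by (auto simp: bij_betw_def inj_on_def)

lemma P_abelian: "abelian_group P"
proof (rule abelian_groupI)
  fix x assume x: "x \<in> carrier P"
  have "(- 1) \<odot>\<^bsub>P\<^esub> x \<oplus>\<^bsub>P\<^esub> x = \<zero>\<^bsub>P\<^esub>"
    by (rule eqI) (use x in \<open>simp_all add: Psm Padd P0 h0 hadd hsm hcl NV.sm_neg_one NV.l_neg\<close>)
  then show "\<exists>y\<in>carrier P. y \<oplus>\<^bsub>P\<^esub> x = \<zero>\<^bsub>P\<^esub>" using Psm[OF x] by blast
next
  fix x y z assume "x \<in> carrier P" "y \<in> carrier P" "z \<in> carrier P"
  then show "x \<oplus>\<^bsub>P\<^esub> y \<oplus>\<^bsub>P\<^esub> z = x \<oplus>\<^bsub>P\<^esub> (y \<oplus>\<^bsub>P\<^esub> z)"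
    by (intro eqI Padd) (simp_all add: hadd Padd hcl NV.a_assoc)
next
  fix x y assume "x \<in> carrier P" "y \<in> carrier P"
  then show "x \<oplus>\<^bsub>P\<^esub> y = y \<oplus>\<^bsub>P\<^esub> x"
    by (intro eqI Padd) (simp_all add: hadd hcl NV.a_comm)
next
  fix x assume "x \<in> carrier P"
  then show "\<zero>\<^bsub>P\<^esub> \<oplus>\<^bsub>P\<^esub> x = x" by (intro eqI Padd P0) (simp_all add: hadd P0 h0 hcl)
qed (simp_all add: Padd P0)

lemma P_vs: "vectorspace class_ring P"
proof (rule vectorspace_classI[OF P_abelian])
  fix c d :: complex and v assume "v \<in> carrier P"
  then show "(c + d) \<odot>\<^bsub>P\<^esub> v = c \<odot>\<^bsub>P\<^esub> v \<oplus>\<^bsub>P\<^esub> d \<odot>\<^bsub>P\<^esub> v" "(c * d) \<odot>\<^bsub>P\<^esub> v = c \<odot>\<^bsub>P\<^esub> (d \<odot>\<^bsub>P\<^esub> v)"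
    "1 \<odot>\<^bsub>P\<^esub> v = v"
    by (intro eqI Padd Psm; simp add: hadd hsm Psm hcl NV.sm_ladd NV.sm_assoc)+
next
  fix c :: complex and v w assume "v \<in> carrier P" "w \<in> carrier P"
  then show "c \<odot>\<^bsub>P\<^esub> (v \<oplus>\<^bsub>P\<^esub> w) = c \<odot>\<^bsub>P\<^esub> v \<oplus>\<^bsub>P\<^esub> c \<odot>\<^bsub>P\<^esub> w"
    by (intro eqI Padd Psm; simp add: hadd hsm Psm Padd hcl NV.sm_radd)
qed (rule Psm)

lemma P_lie_module: "lie_module L P a"
proof (rule lie_module.intro)
  interpret PV: cvec P unfolding cvec_def by (rule P_vs)
  show "vectorspace class_ring P" by (rule P_vs)
  have hm: "\<Psi> (x \<ominus>\<^bsub>P\<^esub> y) = \<Psi> x \<ominus>\<^bsub>N\<^esub> \<Psi> y" if "x \<in> carrier P" "y \<in> carrier P" for x y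
    unfolding a_minus_def using that by (simp add: PV.sm_neg_one[symmetric] NV.sm_neg_one[symmetric] hadd hsm Psm hcl)
  fix x y v w c assume x: "x \<in> carrier L" and v: "v \<in> carrier P"
  show "a x v \<in> carrier P" by (rule Pa[OF x v])
  show "a x (c \<odot>\<^bsub>P\<^esub> v) = c \<odot>\<^bsub>P\<^esub> a x v"
    using x v by (intro eqI Pa Psm) (simp_all add: ha Psm hsm Pa N.act_smult hcl)
  show "a (c \<odot>\<^bsub>L\<^esub> x) v = c \<odot>\<^bsub>P\<^esub> a x v"
    using x v by (intro eqI Pa Psm L_smult) (simp_all add: ha Psm hsm Pa N.smult_act hcl L_smult)
  show "a x (v \<oplus>\<^bsub>P\<^esub> w) = a x v \<oplus>\<^bsub>P\<^esub> a x w" if "w \<in> carrier P"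
    using x v that by (intro eqI Pa Padd) (simp_all add: ha Padd hadd Pa N.act_add hcl)
  assume y: "y \<in> carrier L"
  show "a (x \<oplus>\<^bsub>L\<^esub> y) v = a x v \<oplus>\<^bsub>P\<^esub> a y v"
    using x v y by (intro eqI Pa Padd L_add) (simp_all add: ha Padd hadd Pa N.add_act hcl L_add)
  show "a (lie_bracket L x y) v = a x (a y v) \<ominus>\<^bsub>P\<^esub> a y (a x v)"
    using x v y by (intro eqI Pa PV.minus_closed L_bracket) (simp_all add: ha hm Pa N.bracket_act hcl L_bracket)
qed

lemma simple_iff: "simple_lie_module L P a \<longleftrightarrow> simple_lie_module L N \<sigma>"
proof -
  let ?\<Phi> = "inv_into (carrier P) \<Psi>"
  have bij': "bij_betw ?\<Phi> (carrier N) (carrier P)" by (rule bij_betw_inv_into[OF bij])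
  have inv: "\<Psi> (?\<Phi> z) = z" if "z \<in> carrier N" for z using bij that by (rule bij_betw_inv_into_right)
  have cl: "?\<Phi> z \<in> carrier P" if "z \<in> carrier N" for z using bij' that by (auto simp: bij_betw_def)
  have inv': "?\<Phi> (\<Psi> z) = z" if "z \<in> carrier P" for z using bij that by (rule bij_betw_inv_into_left)
  have S1: "lie_submodule L N \<sigma> (\<Psi> ` W)" if W: "lie_submodule L P a W" for W
  proof -
    have WP: "W \<subseteq> carrier P" using W unfolding lie_submodule_def subspace_iff[OF P_vs] by blast
    have "\<zero>\<^bsub>N\<^esub> \<in> \<Psi> ` W" using W h0 unfolding lie_submodule_def subspace_iff[OF P_vs] by (metis imageI)
    moreover have "\<Psi> v \<oplus>\<^bsub>N\<^esub> \<Psi> w \<in> \<Psi> ` W" if "v \<in> W" "w \<in> W" for v w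
      using that W hadd[of v w] WP unfolding lie_submodule_def subspace_iff[OF P_vs] by (metis imageI subsetD)
    moreover have "c \<odot>\<^bsub>N\<^esub> \<Psi> v \<in> \<Psi> ` W" if "v \<in> W" for v c
      using that W hsm[of v c] WP unfolding lie_submodule_def subspace_iff[OF P_vs] by (metis imageI subsetD)
    moreover have "\<sigma> l (\<Psi> v) \<in> \<Psi> ` W" if "v \<in> W" "l \<in> carrier L" for v l
      using that W ha[of l v] WP unfolding lie_submodule_def by (metis imageI subsetD)
    ultimately show ?thesis using WP hcl unfolding lie_submodule_def subspace_iff[OF N.vectorspace] by blast
  qed
  have S2: "lie_submodule L P a {x \<in> carrier P. \<Psi> x \<in> W}" if W: "lie_submodule L N \<sigma> W" for W
    using W unfolding lie_submodule_def subspace_iff[OF N.vectorspace] subspace_iff[OF P_vs]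
    by (auto simp: P0 h0 Padd hadd Psm hsm Pa ha)
  show ?thesis
  proof
    assume s: "simple_lie_module L P a"
    have "carrier N \<noteq> {\<zero>\<^bsub>N\<^esub>}"
    proof
      assume "carrier N = {\<zero>\<^bsub>N\<^esub>}"
      then have "carrier P = {\<zero>\<^bsub>P\<^esub>}" using hcl eqI P0 h0 by fastforce
      then show False using s by (simp add: simple_lie_module_def)
    qed
    moreover have "W = {\<zero>\<^bsub>N\<^esub>} \<or> W = carrier N" if W: "lie_submodule L N \<sigma> W" for W
    proof -
      have WN: "W \<subseteq> carrier N" using W unfolding lie_submodule_def subspace_iff[OF N.vectorspace] by blast
      have "z \<in> \<Psi> ` {x \<in> carrier P. \<Psi> x \<in> W}" if "z \<in> W" for z
        by (rule image_eqI[of _ _ "?\<Phi> z"]) (use that WN cl inv in auto)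
      then have eq: "W = \<Psi> ` {x \<in> carrier P. \<Psi> x \<in> W}" by blast
      have "{x \<in> carrier P. \<Psi> x \<in> W} = {\<zero>\<^bsub>P\<^esub>} \<or> {x \<in> carrier P. \<Psi> x \<in> W} = carrier P"
        using s S2[OF W] by (simp add: simple_lie_module_def)
      then show ?thesis using eq h0 bij by (metis (no_types, lifting) bij_betw_imp_surj_on image_empty image_insert)
    qed
    ultimately show "simple_lie_module L N \<sigma>" using N by (simp add: simple_lie_module_def)
  next
    assume s: "simple_lie_module L N \<sigma>"
    have "carrier P \<noteq> {\<zero>\<^bsub>P\<^esub>}"
    proof
      assume "carrier P = {\<zero>\<^bsub>P\<^esub>}"
      then have "carrier N = {\<zero>\<^bsub>N\<^esub>}" using bij h0 by (auto simp: bij_betw_def)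
      then show False using s by (simp add: simple_lie_module_def)
    qed
    moreover have "W = {\<zero>\<^bsub>P\<^esub>} \<or> W = carrier P" if W: "lie_submodule L P a W" for W
    proof -
      have WP: "W \<subseteq> carrier P" using W unfolding lie_submodule_def subspace_iff[OF P_vs] by blast
      have eq: "W = ?\<Phi> ` (\<Psi> ` W)"
        using bij WP by (simp add: bij_betw_def inv_into_image_cancel)
      have "\<Psi> ` W = {\<zero>\<^bsub>N\<^esub>} \<or> \<Psi> ` W = carrier N"
        using s S1[OF W] by (simp add: simple_lie_module_def)
      moreover have "?\<Phi> \<zero>\<^bsub>N\<^esub> = \<zero>\<^bsub>P\<^esub>" using inv'[OF P0] h0 by simp
      moreover have "?\<Phi> ` carrier N = carrier P" using bij' by (simp add: bij_betw_def)
      ultimately show ?thesis using eq by (metis (no_types, lifting) image_empty image_insert)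
    qed
    ultimately show "simple_lie_module L P a" using P_lie_module by (simp add: simple_lie_module_def)
  qed
qed

end

context induced
begin

abbreviation "P \<equiv> ind_module L K V \<rho>"

lemma P_simps [simp]: "carrier P = carrier G" "zero P = \<one>\<^bsub>G\<^esub>" "add P = mult G"
  "smult P = (\<lambda>c. imul (L.cl (free_const c)))"
  by (simp_all add: ind_module_def)

text \<open>The module structure of the induced module is transported from a bijective image, so no
  identity has to be checked on cosets.\<close>

lemma induced_simple_iff:
  assumes N: "lie_module L N \<sigma>"
    and \<iota>: "\<And>v. v \<in> carrier V \<Longrightarrow> \<iota> v \<in> carrier N"
    and \<Psi>: "\<Psi> \<in> hom G (add_monoid N)" "\<And>f v. f \<in> carrier AL \<Longrightarrow> v \<in> carrier V \<Longrightarrow> \<Psi> (T f v) = free_act N \<sigma> f (\<iota> v)"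
    and bij: "bij_betw \<Psi> (carrier G) (carrier N)"
  shows "simple_lie_module L (ind_module L K V \<rho>) (ind_act L K V \<rho>) \<longleftrightarrow> simple_lie_module L N \<sigma>"
proof -
  interpret N: rep L N \<sigma> using N by (simp add: rep_def L.lie_ops_axioms)
  interpret NG: comm_group "add_monoid N" by (rule N.V.a_comm_group)
  interpret \<Psi>: group_hom G "add_monoid N" \<Psi> using \<Psi>(1) by unfold_locales
  have mul: "\<Psi> (imul (L.cl u) X) = free_act N \<sigma> u (\<Psi> X)" if "u \<in> carrier AL" "X \<in> carrier G" for u X
    using universal_mul[of N \<sigma> \<iota> \<Psi>] N \<iota> \<Psi> that by blast
  have cl: "\<Psi> x \<in> carrier N" if "x \<in> carrier G" for x using \<Psi>.hom_closed[OF that] by simp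
  interpret transport L P "ind_act L K V \<rho>" N \<sigma> \<Psi>
  proof (rule transport.intro)
    show "lie_module L N \<sigma>" by (rule N)
    show "bij_betw \<Psi> (carrier P) (carrier N)" using bij by simp
    show "\<Psi> \<zero>\<^bsub>P\<^esub> = \<zero>\<^bsub>N\<^esub>" using \<Psi>.hom_one by simp
    show "\<Psi> (x \<oplus>\<^bsub>P\<^esub> y) = \<Psi> x \<oplus>\<^bsub>N\<^esub> \<Psi> y" if "x \<in> carrier P" "y \<in> carrier P" for x y
      using \<Psi>.hom_mult[of x y] that by simp
    show "\<Psi> (c \<odot>\<^bsub>P\<^esub> x) = c \<odot>\<^bsub>N\<^esub> \<Psi> x" if "x \<in> carrier P" for c x
      using mul[of "free_const c" x] free_const_closed[of c "carrier L"] that cl by (simp add: N.fact_const del: free_alg_simps(1))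
    show "\<Psi> (ind_act L K V \<rho> l x) = \<sigma> l (\<Psi> x)" if "l \<in> carrier L" "x \<in> carrier P" for l x
      using mul[of "free_gen l" x] that free_gen_closed[OF that(1)] cl by (simp add: ind_act_def N.fact_gen del: free_alg_simps(1))
    show "ind_act L K V \<rho> l x \<in> carrier P" if "l \<in> carrier L" "x \<in> carrier P" for l x
      using that imul_closed free_gen_closed[OF that(1)] by (simp add: ind_act_def del: free_alg_simps(1))
    show "c \<odot>\<^bsub>P\<^esub> x \<in> carrier P" if "x \<in> carrier P" for c x
      using that imul_closed[OF free_const_closed] by simp
  qed (simp_all add: L.L_add L.L_smult L.L_bracket)
  show ?thesis by (rule simple_iff)
qed

end

subsection \<open>The parabolic subalgebra\<close>

abbreviation MM :: "nat \<Rightarrow> complex mat set" where "MM m \<equiv> carrier_mat (Suc m) (Suc m)"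

abbreviation mspan :: "nat \<Rightarrow> complex mat set \<Rightarrow> complex mat set" where
  "mspan m \<equiv> LinearCombinations.module.span class_ring (module_mat TYPE(complex) (Suc m) (Suc m))"

text \<open>From here on indices start at \<open>0\<close>, so \<open>m\<close> is the last index and \<open>E\<^sub>i\<^sub>,\<^sub>j\<close> of the paper sits in row \<open>i - 1\<close>,
  column \<open>j - 1\<close>. The matrices \<open>hm m s t\<close>, \<open>um m s\<close> and \<open>xm m t\<close> span \<open>l\<close>, \<open>u\<close> and the opposite of \<open>u\<close>;
  \<open>hm m s s\<close> is the element corresponding to \<open>E\<^sub>s\<^sub>,\<^sub>s\<close> in \<open>gl(m)\<close>.\<close>

definition hm :: "nat \<Rightarrow> nat \<Rightarrow> nat \<Rightarrow> complex mat" where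
  "hm m s t = mat (Suc m) (Suc m) (\<lambda>(i, j). (if i = s \<and> j = t then 1 else 0) - (if s = t \<and> i = m \<and> j = m then 1 else 0))"

definition um :: "nat \<Rightarrow> nat \<Rightarrow> complex mat" where
  "um m s = mat (Suc m) (Suc m) (\<lambda>(i, j). if i = s \<and> j = m then 1 else 0)"

definition xm :: "nat \<Rightarrow> nat \<Rightarrow> complex mat" where
  "xm m t = mat (Suc m) (Suc m) (\<lambda>(i, j). if i = m \<and> j = t then 1 else 0)"

lemma hm_closed [simp]: "hm m s t \<in> MM m" and um_closed [simp]: "um m s \<in> MM m" and xm_closed [simp]: "xm m t \<in> MM m"
  by (simp_all add: hm_def um_def xm_def)

lemma unit_dims [simp]: "dim_row (hm m s t) = Suc m" "dim_col (hm m s t) = Suc m" "dim_row (um m s) = Suc m"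
  "dim_col (um m s) = Suc m" "dim_row (xm m s) = Suc m" "dim_col (xm m s) = Suc m"
  by (simp_all add: hm_def um_def xm_def)

lemma unit_entries [simp]:
  assumes "i < Suc m" "j < Suc m"
  shows "hm m s t $$ (i, j) = (if i = s \<and> j = t then 1 else 0) - (if s = t \<and> i = m \<and> j = m then 1 else 0)"
    "um m s $$ (i, j) = (if i = s \<and> j = m then 1 else 0)"
    "xm m t $$ (i, j) = (if i = m \<and> j = t then 1 else 0)"
  using assms by (simp_all add: hm_def um_def xm_def)

lemma E_off: "s \<noteq> t \<Longrightarrow> E (Suc m) (Suc s) (Suc t) = hm m s t"
  by (rule eq_matI) (auto simp: E_def hm_def)

lemma E_diag: "E (Suc m) (Suc s) (Suc s) - E (Suc m) (Suc m) (Suc m) = hm m s s"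
  by (rule eq_matI) (auto simp: E_def hm_def)

lemma E_um: "E (Suc m) (Suc s) (Suc m) = um m s"
  by (rule eq_matI) (auto simp: E_def um_def)

lemma levi_span: "levi m = mspan m {hm m s t | s t. s < m \<and> t < m}"
proof -
  have "{E (Suc m) i j | i j. i \<in> {1..m} \<and> j \<in> {1..m} \<and> i \<noteq> j} \<union> {E (Suc m) i i - E (Suc m) (Suc m) (Suc m) | i. i \<in> {1..m}}
     = {hm m s t | s t. s < m \<and> t < m}" (is "?A \<union> ?B = ?C")
  proof
    show "?A \<union> ?B \<subseteq> ?C"
    proof
      fix X assume "X \<in> ?A \<union> ?B"
      then show "X \<in> ?C"
      proof
        assume "X \<in> ?A"
        then obtain i j where X: "X = E (Suc m) i j" "i \<in> {1..m}" "j \<in> {1..m}" "i \<noteq> j" by blast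
        then have "X = hm m (i - 1) (j - 1)" using E_off[of "i - 1" "j - 1" m] by auto
        then show "X \<in> ?C" using X by (intro CollectI exI[of _ "i - 1"] exI[of _ "j - 1"]) auto
      next
        assume "X \<in> ?B"
        then obtain i where X: "X = E (Suc m) i i - E (Suc m) (Suc m) (Suc m)" "i \<in> {1..m}" by blast
        then have "X = hm m (i - 1) (i - 1)" using E_diag[of m "i - 1"] by auto
        then show "X \<in> ?C" using X by (intro CollectI exI[of _ "i - 1"] exI[of _ "i - 1"]) auto
      qed
    qed
    show "?C \<subseteq> ?A \<union> ?B"
    proof
      fix X assume "X \<in> ?C"
      then obtain s t where X: "X = hm m s t" "s < m" "t < m" by blast
      show "X \<in> ?A \<union> ?B"
      proof (cases "s = t")
        case True
        then show ?thesis using X E_diag[of m s] by (intro UnI2 CollectI exI[of _ "Suc s"]) auto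
      next
        case False
        then show ?thesis using X E_off[of s t m] by (intro UnI1 CollectI exI[of _ "Suc s"] exI[of _ "Suc t"]) auto
      qed
    qed
  qed
  then show ?thesis by (simp add: levi_def)
qed

lemma nilrad_span: "nilrad m = mspan m {um m s | s. s < m}"
proof -
  have "{E (Suc m) s (Suc m) | s. s \<in> {1..m}} = {um m s | s. s < m}"
  proof
    show "{E (Suc m) s (Suc m) | s. s \<in> {1..m}} \<subseteq> {um m s | s. s < m}"
    proof clarify
      fix s assume s: "s \<in> {1..m}"
      then have "E (Suc m) s (Suc m) = um m (s - 1)" using E_um[of m "s - 1"] by auto
      then show "\<exists>t. E (Suc m) s (Suc m) = um m t \<and> t < m" using s by (intro exI[of _ "s - 1"]) auto
    qed
    show "{um m s | s. s < m} \<subseteq> {E (Suc m) s (Suc m) | s. s \<in> {1..m}}"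
    proof clarify
      fix s assume "s < m"
      then show "\<exists>t. um m s = E (Suc m) t (Suc m) \<and> t \<in> {1..m}" using E_um[of m s] by (intro exI[of _ "Suc s"]) auto
    qed
  qed
  then show ?thesis by (simp add: nilrad_def)
qed

lemma mspan_props:
  assumes S: "S \<subseteq> MM m"
  shows "S \<subseteq> mspan m S" "0\<^sub>m (Suc m) (Suc m) \<in> mspan m S" "\<lbrakk>A \<in> mspan m S; B \<in> mspan m S\<rbrakk> \<Longrightarrow> A + B \<in> mspan m S"
    "A \<in> mspan m S \<Longrightarrow> c \<cdot>\<^sub>m A \<in> mspan m S" "mspan m S \<subseteq> MM m"
    "\<lbrakk>S \<subseteq> N; N \<subseteq> MM m; 0\<^sub>m (Suc m) (Suc m) \<in> N; \<And>A B. \<lbrakk>A \<in> N; B \<in> N\<rbrakk> \<Longrightarrow> A + B \<in> N; \<And>c A. A \<in> N \<Longrightarrow> c \<cdot>\<^sub>m A \<in> N\<rbrakk> \<Longrightarrow> mspan m S \<subseteq> N"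
proof -
  interpret vectorspace class_ring "module_mat TYPE(complex) (Suc m) (Suc m)" by (rule matrix_vs)
  have S': "S \<subseteq> carrier (module_mat TYPE(complex) (Suc m) (Suc m))" using S by (simp add: module_mat_simps)
  interpret s: LinearCombinations.submodule class_ring "mspan m S" "module_mat TYPE(complex) (Suc m) (Suc m)"
    by (rule span_is_submodule[OF S'])
  show "S \<subseteq> mspan m S" by (rule in_own_span[OF S'])
  show "0\<^sub>m (Suc m) (Suc m) \<in> mspan m S" using s.zero_closed by (simp add: module_mat_simps)
  show "\<lbrakk>A \<in> mspan m S; B \<in> mspan m S\<rbrakk> \<Longrightarrow> A + B \<in> mspan m S" using s.m_closed[of A B] by (simp add: module_mat_simps)
  show "A \<in> mspan m S \<Longrightarrow> c \<cdot>\<^sub>m A \<in> mspan m S" using s.smult_closed[of c A] by (simp add: module_mat_simps)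
  show "mspan m S \<subseteq> MM m" using s.subset by (simp add: module_mat_simps)
  assume N: "S \<subseteq> N" "N \<subseteq> MM m" "0\<^sub>m (Suc m) (Suc m) \<in> N" "\<And>A B. \<lbrakk>A \<in> N; B \<in> N\<rbrakk> \<Longrightarrow> A + B \<in> N" "\<And>c A. A \<in> N \<Longrightarrow> c \<cdot>\<^sub>m A \<in> N"
  have "LinearCombinations.submodule class_ring N (module_mat TYPE(complex) (Suc m) (Suc m))"
    unfolding LinearCombinations.submodule_def using N module_axioms by (auto simp: module_mat_simps)
  then show "mspan m S \<subseteq> N" by (rule span_is_subset[OF N(1)])
qed

lemma hms: "{hm m s t | s t. s < m \<and> t < m} \<subseteq> MM m" and ums: "{um m s | s. s < m} \<subseteq> MM m"
  by auto

lemmas levi_props = mspan_props[OF hms, folded levi_span]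
lemmas nilrad_props = mspan_props[OF ums, folded nilrad_span]

lemma hm_levi: "s < m \<Longrightarrow> t < m \<Longrightarrow> hm m s t \<in> levi m"
  using levi_props(1) by blast

lemma levi_induct [consumes 1, case_names zero hm add smult]:
  assumes "A \<in> levi m" "P (0\<^sub>m (Suc m) (Suc m))" "\<And>s t. s < m \<Longrightarrow> t < m \<Longrightarrow> P (hm m s t)"
    and "\<And>A B. \<lbrakk>A \<in> levi m; B \<in> levi m; P A; P B\<rbrakk> \<Longrightarrow> P (A + B)"
    and "\<And>c A. \<lbrakk>A \<in> levi m; P A\<rbrakk> \<Longrightarrow> P (c \<cdot>\<^sub>m A)"
  shows "P A"
proof -
  have "levi m \<subseteq> {A \<in> levi m. P A}"
    using levi_props(5) by (intro levi_props(6)) (auto intro: assms(2-) levi_props(2-4) simp: hm_levi)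
  then show ?thesis using assms(1) by blast
qed

lemma sl_iff: "A \<in> carrier (sl (Suc m)) \<longleftrightarrow> A \<in> MM m \<and> (\<Sum>i<m. A $$ (i, i)) + A $$ (m, m) = 0"
  by (simp add: sl_def)

lemma sl_ops [simp]: "add (sl n) = (+)" "smult (sl n) = (\<cdot>\<^sub>m)" "lie_bracket (sl n) = (\<lambda>A B. A * B - B * A)"
  by (simp_all add: sl_def)

lemma sub_ops [simp]: "add (lie_subalgebra_on L K) = add L" "smult (lie_subalgebra_on L K) = smult L"
  "lie_bracket (lie_subalgebra_on L K) = lie_bracket L" "carrier (lie_subalgebra_on L K) = K"
  by (simp_all add: lie_subalgebra_on_def)

text \<open>For the converse, the nonzero entries of the upper left block are removed one at a time
  by subtracting multiples of \<open>hm m s t\<close>, by induction on a finite set \<open>Q\<close>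
  of positions containing them. When the block is empty, the trace condition forces the corner entry
  to vanish too.\<close>

lemma levi_iff: "A \<in> levi m \<longleftrightarrow> A \<in> carrier (sl (Suc m)) \<and> (\<forall>i<m. A $$ (i, m) = 0 \<and> A $$ (m, i) = 0)"
proof
  assume "A \<in> levi m"
  then show "A \<in> carrier (sl (Suc m)) \<and> (\<forall>i<m. A $$ (i, m) = 0 \<and> A $$ (m, i) = 0)"
  proof (induction A rule: levi_induct)
    case (hm s t)
    have "(\<Sum>i<m. hm m s t $$ (i, i)) = (\<Sum>i<m. if i = s then (if s = t then 1 else 0) else 0)"
      using hm by (intro sum.cong) auto
    then show ?case using hm by (simp add: sl_iff)
  next
    case (add A B)
    then show ?case by (auto simp: sl_iff sum.distrib algebra_simps)
  next
    case (smult c A)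
    then show ?case by (auto simp: sl_iff sum_distrib_left[symmetric] distrib_left[symmetric])
  qed (simp add: sl_iff)
next
  have main: "finite Q \<Longrightarrow> \<forall>A. A \<in> carrier (sl (Suc m)) \<and> (\<forall>i<m. A $$ (i, m) = 0 \<and> A $$ (m, i) = 0) \<and>
     (\<forall>i<m. \<forall>j<m. A $$ (i, j) \<noteq> 0 \<longrightarrow> (i, j) \<in> Q) \<longrightarrow> A \<in> levi m" for Q
  proof (induction Q rule: finite_induct)
    case empty
    show ?case
    proof (intro allI impI)
      fix A assume A: "A \<in> carrier (sl (Suc m)) \<and> (\<forall>i<m. A $$ (i, m) = 0 \<and> A $$ (m, i) = 0) \<and> (\<forall>i<m. \<forall>j<m. A $$ (i, j) \<noteq> 0 \<longrightarrow> (i, j) \<in> {})"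
      have "A = 0\<^sub>m (Suc m) (Suc m)"
      proof (rule eq_matI)
        fix i j assume "i < dim_row (0\<^sub>m (Suc m) (Suc m) :: complex mat)" "j < dim_col (0\<^sub>m (Suc m) (Suc m) :: complex mat)"
        then have ij: "i < Suc m" "j < Suc m" by auto
        have "(\<Sum>k<m. A $$ (k, k)) = 0" using A by (intro sum.neutral) auto
        then have "A $$ (m, m) = 0" using A by (simp add: sl_iff)
        then have "A $$ (i, j) = 0" using A ij by (cases "i = m"; cases "j = m") auto
        then show "A $$ (i, j) = 0\<^sub>m (Suc m) (Suc m) $$ (i, j)" using ij by simp
      qed (use A in \<open>auto simp: sl_iff\<close>)
      then show "A \<in> levi m" using levi_props(2) by simp
    qed
  next
    case (insert q Q)
    obtain s t where q: "q = (s, t)" by force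
    show ?case
    proof (intro allI impI)
      fix A assume A: "A \<in> carrier (sl (Suc m)) \<and> (\<forall>i<m. A $$ (i, m) = 0 \<and> A $$ (m, i) = 0) \<and> (\<forall>i<m. \<forall>j<m. A $$ (i, j) \<noteq> 0 \<longrightarrow> (i, j) \<in> insert q Q)"
      then have AM: "A \<in> MM m" by (simp add: sl_iff)
      show "A \<in> levi m"
      proof (cases "s < m \<and> t < m")
        case False
        then show ?thesis using insert.IH A q by auto
      next
        case True
        \<comment> \<open>This clears position \<open>(s, t)\<close>. The trace stays zero because
          \<open>hm m s s\<close> carries a compensating -1 in the corner.\<close>
        let ?B = "A + (- (A $$ (s, t))) \<cdot>\<^sub>m hm m s t"
        have ent: "?B $$ (i, j) = A $$ (i, j) - A $$ (s, t) * ((if i = s \<and> j = t then 1 else 0) - (if s = t \<and> i = m \<and> j = m then 1 else 0))"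
          if "i < Suc m" "j < Suc m" for i j
          using that AM by simp
        have "(\<Sum>i<m. ?B $$ (i, i)) = (\<Sum>i<m. A $$ (i, i) - (if i = s then (if s = t then A $$ (s, t) else 0) else 0))"
          by (rule sum.cong) (auto simp: ent)
        also have "\<dots> = (\<Sum>i<m. A $$ (i, i)) - (if s = t then A $$ (s, t) else 0)" using True by (simp add: sum_subtractf)
        finally have "?B \<in> carrier (sl (Suc m))" using A ent[of m m] AM True by (auto simp: sl_iff)
        moreover have "?B $$ (i, m) = 0 \<and> ?B $$ (m, i) = 0" if "i < m" for i
          using that A True ent[of i m] ent[of m i] by auto
        moreover have "(i, j) \<in> Q" if "i < m" "j < m" "?B $$ (i, j) \<noteq> 0" for i j
          using that A ent[of i j] q by (auto split: if_splits)
        ultimately have "?B \<in> levi m" using insert.IH by blast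
        then have "?B + A $$ (s, t) \<cdot>\<^sub>m hm m s t \<in> levi m"
          using True by (blast intro: levi_props(3) levi_props(4)[OF hm_levi])
        moreover have "?B + A $$ (s, t) \<cdot>\<^sub>m hm m s t = A" by (rule eq_matI) (use AM in auto)
        ultimately show ?thesis by simp
      qed
    qed
  qed
  assume "A \<in> carrier (sl (Suc m)) \<and> (\<forall>i<m. A $$ (i, m) = 0 \<and> A $$ (m, i) = 0)"
  then show "A \<in> levi m" using main[of "{..<m} \<times> {..<m}"] by simp
qed

lemma nilrad_iff: "A \<in> nilrad m \<longleftrightarrow> A \<in> MM m \<and> (\<forall>i<Suc m. \<forall>j<Suc m. A $$ (i, j) \<noteq> 0 \<longrightarrow> i < m \<and> j = m)"
proof
  have "nilrad m \<subseteq> {A \<in> MM m. \<forall>i<Suc m. \<forall>j<Suc m. A $$ (i, j) \<noteq> 0 \<longrightarrow> i < m \<and> j = m}"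
    by (rule nilrad_props(6)) (auto split: if_splits, metis add_cancel_left_right, metis add_cancel_left_right)
  then show "A \<in> nilrad m \<Longrightarrow> A \<in> MM m \<and> (\<forall>i<Suc m. \<forall>j<Suc m. A $$ (i, j) \<noteq> 0 \<longrightarrow> i < m \<and> j = m)" by blast
next
  have main: "finite Q \<Longrightarrow> \<forall>A. A \<in> MM m \<and> (\<forall>i<Suc m. \<forall>j<Suc m. A $$ (i, j) \<noteq> 0 \<longrightarrow> i < m \<and> i \<in> Q \<and> j = m) \<longrightarrow> A \<in> nilrad m" for Q
  proof (induction Q rule: finite_induct)
    case empty
    show ?case
    proof (intro allI impI)
      fix A assume A: "A \<in> MM m \<and> (\<forall>i<Suc m. \<forall>j<Suc m. A $$ (i, j) \<noteq> 0 \<longrightarrow> i < m \<and> i \<in> {} \<and> j = m)"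
      have "A = 0\<^sub>m (Suc m) (Suc m)" by (rule eq_matI) (use A in auto)
      then show "A \<in> nilrad m" using nilrad_props(2) by simp
    qed
  next
    case (insert s Q)
    show ?case
    proof (intro allI impI)
      fix A assume A: "A \<in> MM m \<and> (\<forall>i<Suc m. \<forall>j<Suc m. A $$ (i, j) \<noteq> 0 \<longrightarrow> i < m \<and> i \<in> insert s Q \<and> j = m)"
      then have AM: "A \<in> MM m" by blast
      show "A \<in> nilrad m"
      proof (cases "s < m")
        case False
        then show ?thesis using insert.IH A by blast
      next
        case True
        let ?B = "A + (- (A $$ (s, m))) \<cdot>\<^sub>m um m s"
        have "?B \<in> MM m" using A by simp
        moreover have "i < m \<and> i \<in> Q \<and> j = m" if "i < Suc m" "j < Suc m" "?B $$ (i, j) \<noteq> 0" for i j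
        proof -
          have "?B $$ (i, j) = A $$ (i, j) - A $$ (s, m) * (if i = s \<and> j = m then 1 else 0)"
            using that AM by simp
          then show ?thesis using that A True by (auto split: if_splits)
        qed
        ultimately have "?B \<in> nilrad m" using insert.IH by blast
        moreover have "um m s \<in> nilrad m" using True nilrad_props(1) by blast
        ultimately have "?B + A $$ (s, m) \<cdot>\<^sub>m um m s \<in> nilrad m" by (blast intro: nilrad_props(3) nilrad_props(4))
        moreover have "?B + A $$ (s, m) \<cdot>\<^sub>m um m s = A" by (rule eq_matI) (use A in auto)
        ultimately show ?thesis by simp
      qed
    qed
  qed
  assume "A \<in> MM m \<and> (\<forall>i<Suc m. \<forall>j<Suc m. A $$ (i, j) \<noteq> 0 \<longrightarrow> i < m \<and> j = m)"
  then show "A \<in> nilrad m" using main[of "{..<m}"] by simp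
qed

text \<open>On \<open>parabolic m\<close> this is the projection onto the Levi factor along the
  nilradical. It is given by entries so that it is total and manifestly linear.\<close>

definition lev :: "nat \<Rightarrow> complex mat \<Rightarrow> complex mat" where
  "lev m A = mat (Suc m) (Suc m) (\<lambda>(i, j). if i < m \<and> j = m then 0 else A $$ (i, j))"

definition nilp_part :: "nat \<Rightarrow> complex mat \<Rightarrow> complex mat" where
  "nilp_part m A = mat (Suc m) (Suc m) (\<lambda>(i, j). if i < m \<and> j = m then A $$ (i, j) else 0)"

lemma lev_levi: "\<lbrakk>A \<in> carrier (sl (Suc m)); \<And>i. i < m \<Longrightarrow> A $$ (m, i) = 0\<rbrakk> \<Longrightarrow> lev m A \<in> levi m"
  by (auto simp: levi_iff sl_iff lev_def)

lemma lev_split: "A \<in> MM m \<Longrightarrow> A = lev m A + nilp_part m A"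
  by (rule eq_matI) (auto simp: lev_def nilp_part_def)

lemma nilp_part_nilrad: "nilp_part m A \<in> nilrad m"
  by (auto simp: nilrad_iff nilp_part_def)

lemma parabolic_iff: "A \<in> parabolic m \<longleftrightarrow> A \<in> carrier (sl (Suc m)) \<and> (\<forall>i<m. A $$ (m, i) = 0)"
proof
  assume "A \<in> parabolic m"
  then obtain B C where A: "A = B + C" and B: "B \<in> levi m" and C: "C \<in> nilrad m" by (auto simp: parabolic_def)
  have BC: "B \<in> MM m" "C \<in> MM m" using B C by (auto simp: levi_iff sl_iff nilrad_iff)
  have C0: "C $$ (i, j) = 0" if "i < Suc m" "j < Suc m" "\<not> (i < m \<and> j = m)" for i j
    using C that by (auto simp: nilrad_iff)
  have "(\<Sum>i<m. A $$ (i, i)) = (\<Sum>i<m. B $$ (i, i))"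
    unfolding A using BC C0 by (intro sum.cong) auto
  then show "A \<in> carrier (sl (Suc m)) \<and> (\<forall>i<m. A $$ (m, i) = 0)"
    using B BC C0 unfolding A by (auto simp: levi_iff sl_iff)
next
  assume A: "A \<in> carrier (sl (Suc m)) \<and> (\<forall>i<m. A $$ (m, i) = 0)"
  then have "A = lev m A + nilp_part m A" using lev_split[of A m] by (simp add: sl_iff)
  then show "A \<in> parabolic m" unfolding parabolic_def using lev_levi[of A m] A nilp_part_nilrad by blast
qed

text \<open>The sum of Levi factor and nilradical is direct; this makes the definite description in
  \<open>parabolic_act\<close> meaningful.\<close>

lemma lev_unique:
  assumes "B \<in> levi m" "C \<in> nilrad m" shows "lev m (B + C) = B"
proof (rule eq_matI)
  have BC: "B \<in> MM m" "C \<in> MM m" using assms by (auto simp: levi_iff sl_iff nilrad_iff)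
  then show "dim_row (lev m (B + C)) = dim_row B" "dim_col (lev m (B + C)) = dim_col B" by (auto simp: lev_def)
  fix i j assume "i < dim_row B" "j < dim_col B"
  then have ij: "i < Suc m" "j < Suc m" using BC by auto
  have "C $$ (i, j) = 0" if "\<not> (i < m \<and> j = m)" using assms(2) ij that by (auto simp: nilrad_iff)
  then show "lev m (B + C) $$ (i, j) = B $$ (i, j)" using assms(1) ij BC by (auto simp: lev_def levi_iff)
qed

lemma parabolic_act_eq: 
  assumes "A \<in> parabolic m" shows "parabolic_act m \<rho> A = \<rho> (lev m A)"
proof -
  have "(THE B. B \<in> levi m \<and> (\<exists>C\<in>nilrad m. A = B + C)) = lev m A"
  proof (rule the_equality)
    have "A \<in> MM m" using assms by (simp add: parabolic_iff sl_iff)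
    then show "lev m A \<in> levi m \<and> (\<exists>C\<in>nilrad m. A = lev m A + C)"
      using lev_split[of A m] nilp_part_nilrad lev_levi[of A m] assms by (auto simp: parabolic_iff)
  qed (use lev_unique in auto)
  then show ?thesis by (simp add: parabolic_act_def)
qed

lemma mult_entry: "A \<in> MM m \<Longrightarrow> B \<in> MM m \<Longrightarrow> i < Suc m \<Longrightarrow> j < Suc m \<Longrightarrow> (A * B) $$ (i, j) = (\<Sum>k<Suc m. A $$ (i, k) * B $$ (k, j))"
  by (auto simp: times_mat_def scalar_prod_def atLeast0LessThan intro!: sum.cong)

lemma bracket_entry: "A \<in> MM m \<Longrightarrow> B \<in> MM m \<Longrightarrow> i < Suc m \<Longrightarrow> j < Suc m \<Longrightarrow>
  (A * B - B * A) $$ (i, j) = (\<Sum>k<Suc m. A $$ (i, k) * B $$ (k, j)) - (\<Sum>k<Suc m. B $$ (i, k) * A $$ (k, j))"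
  by (simp add: mult_entry[symmetric] del: sum.lessThan_Suc)

lemma lie_ops_sl: "lie_ops (sl (Suc m))"
proof (rule lie_ops.intro)
  fix x y :: "complex mat" and c assume x: "x \<in> carrier (sl (Suc m))"
  then show "c \<odot>\<^bsub>sl (Suc m)\<^esub> x \<in> carrier (sl (Suc m))"
    by (auto simp: sl_iff sum_distrib_left[symmetric] distrib_left[symmetric])
  assume y: "y \<in> carrier (sl (Suc m))"
  show "x \<oplus>\<^bsub>sl (Suc m)\<^esub> y \<in> carrier (sl (Suc m))"
  proof -
    have M: "x \<in> MM m" "y \<in> MM m" using x y by (auto simp: sl_iff)
    have "(\<Sum>i<m. (x + y) $$ (i, i)) = (\<Sum>i<m. x $$ (i, i)) + (\<Sum>i<m. y $$ (i, i))"
      unfolding sum.distrib[symmetric] using M by (intro sum.cong) auto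
    then have eq: "(\<Sum>i<m. (x + y) $$ (i, i)) + (x + y) $$ (m, m) = ((\<Sum>i<m. x $$ (i, i)) + x $$ (m, m)) + ((\<Sum>i<m. y $$ (i, i)) + y $$ (m, m))"
      using M by simp
    have "(\<Sum>i<m. x $$ (i, i)) + x $$ (m, m) = 0" "(\<Sum>i<m. y $$ (i, i)) + y $$ (m, m) = 0"
      using x y by (auto simp: sl_iff)
    with eq have "(\<Sum>i<m. (x + y) $$ (i, i)) + (x + y) $$ (m, m) = 0" by (simp only: add_0)
    then show ?thesis using M by (simp only: sl_iff sl_ops) simp
  qed
  show "lie_bracket (sl (Suc m)) x y \<in> carrier (sl (Suc m))"
  proof -
    have M: "x \<in> MM m" "y \<in> MM m" using x y by (auto simp: sl_iff)
    have "(\<Sum>i<Suc m. (x * y - y * x) $$ (i, i)) = (\<Sum>i<Suc m. (\<Sum>k<Suc m. x $$ (i, k) * y $$ (k, i)) - (\<Sum>k<Suc m. y $$ (i, k) * x $$ (k, i)))"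
      using M by (intro sum.cong refl bracket_entry) auto
    also have "\<dots> = (\<Sum>i<Suc m. \<Sum>k<Suc m. x $$ (i, k) * y $$ (k, i)) - (\<Sum>i<Suc m. \<Sum>k<Suc m. y $$ (i, k) * x $$ (k, i))"
      by (rule sum_subtractf)
    also have "(\<Sum>i<Suc m. \<Sum>k<Suc m. y $$ (i, k) * x $$ (k, i)) = (\<Sum>i<Suc m. \<Sum>k<Suc m. x $$ (i, k) * y $$ (k, i))"
      by (subst sum.swap) (simp only: mult.commute)
    finally have "(\<Sum>i<Suc m. (x * y - y * x) $$ (i, i)) = 0" by simp
    moreover have "x * y - y * x \<in> MM m" using M by (intro minus_carrier_mat mult_carrier_mat) auto
    ultimately show ?thesis unfolding sl_iff sl_ops sum.lessThan_Suc by blast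
  qed
qed

lemma lie_ops_parabolic: "lie_ops (lie_subalgebra_on (sl (Suc m)) (parabolic m))"
proof -
  interpret sl: lie_ops "sl (Suc m)" by (rule lie_ops_sl)
  show ?thesis
  proof (rule lie_ops.intro; unfold sub_ops)
    fix x y c assume x: "x \<in> parabolic m"
    then show "c \<odot>\<^bsub>sl (Suc m)\<^esub> x \<in> parabolic m" using sl.L_smult[of x c] by (auto simp: parabolic_iff sl_iff)
    assume y: "y \<in> parabolic m"
    then show "x \<oplus>\<^bsub>sl (Suc m)\<^esub> y \<in> parabolic m" using x sl.L_add[of x y] by (auto simp: parabolic_iff sl_iff)
    have M: "x \<in> MM m" "y \<in> MM m" using x y by (auto simp: parabolic_iff sl_iff)
    have "(x * y - y * x) $$ (m, i) = 0" if "i < m" for i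
      using that x y by (subst bracket_entry[OF M]) (auto simp: parabolic_iff)
    then show "lie_bracket (sl (Suc m)) x y \<in> parabolic m" using x y sl.L_bracket[of x y] by (auto simp: parabolic_iff)
  qed
qed

text \<open>The nilradical is an ideal of the parabolic subalgebra. In entries: the matrices are
  block upper triangular, and the diagonal blocks of a product are the products of the diagonal
  blocks. Hence extension by zero gives a module of the parabolic subalgebra.\<close>

lemma lev_bracket:
  assumes x: "x \<in> parabolic m" and y: "y \<in> parabolic m"
  shows "lev m (x * y - y * x) = lev m x * lev m y - lev m y * lev m x"
proof (rule eq_matI)
  have M: "x \<in> MM m" "y \<in> MM m" using x y by (auto simp: parabolic_iff sl_iff)
  have LM: "lev m x \<in> MM m" "lev m y \<in> MM m" by (auto simp: lev_def)
  show "dim_row (lev m (x * y - y * x)) = dim_row (lev m x * lev m y - lev m y * lev m x)"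
    "dim_col (lev m (x * y - y * x)) = dim_col (lev m x * lev m y - lev m y * lev m x)" using LM by (auto simp: lev_def)
  fix i j assume "i < dim_row (lev m x * lev m y - lev m y * lev m x)" "j < dim_col (lev m x * lev m y - lev m y * lev m x)"
  then have ij: "i < Suc m" "j < Suc m" using LM by auto
  have le: "lev m z $$ (a, b) = (if a < m \<and> b = m then 0 else z $$ (a, b))" if "a < Suc m" "b < Suc m" for z a b
    using that by (simp add: lev_def)
  have prod: "(\<Sum>k<Suc m. lev m z $$ (i, k) * lev m w $$ (k, j)) = (if i < m \<and> j = m then 0 else \<Sum>k<Suc m. z $$ (i, k) * w $$ (k, j))"
    if z: "z \<in> parabolic m" and w: "w \<in> parabolic m" for z w
  proof (cases "i < m \<and> j = m")
    case True
    then have "lev m z $$ (i, k) * lev m w $$ (k, j) = 0" if "k < Suc m" for k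
      using that by (cases "k = m") (auto simp: le)
    then have "(\<Sum>k<Suc m. lev m z $$ (i, k) * lev m w $$ (k, j)) = 0" by (intro sum.neutral) blast
    then show ?thesis using True by (simp only: if_True simp_thms)
  next
    case False
    have "lev m z $$ (i, k) * lev m w $$ (k, j) = z $$ (i, k) * w $$ (k, j)" if "k < Suc m" for k
    proof (cases "k = m")
      case True
      then show ?thesis using False ij w by (cases "i = m") (auto simp: le parabolic_iff)
    next
      case ne: False
      then have "k < m" using that by simp
      then show ?thesis using False ij z by (cases "i = m") (auto simp: le parabolic_iff)
    qed
    then have "(\<Sum>k<Suc m. lev m z $$ (i, k) * lev m w $$ (k, j)) = (\<Sum>k<Suc m. z $$ (i, k) * w $$ (k, j))"
      by (intro sum.cong) auto
    then show ?thesis using False by (simp only: if_False)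
  qed
  show "lev m (x * y - y * x) $$ (i, j) = (lev m x * lev m y - lev m y * lev m x) $$ (i, j)"
    unfolding bracket_entry[OF LM ij] le[OF ij] bracket_entry[OF M ij] prod[OF x y] prod[OF y x] by simp
qed

text \<open>The matrices \<open>hm m s t\<close> satisfy the relations of the matrix units of
  \<open>gl(m)\<close>: the corner entries contribute to each product a term symmetric in the two
  factors, which drops out of the commutator. The right side uses only addition and scalar
  multiplication, so that the module axioms apply to it.\<close>

lemma hm_bracket:
  assumes "s < m" "t < m" "u < m" "v < m"
  shows "hm m s t * hm m u v - hm m u v * hm m s t =
    (if t = u then hm m s v else 0\<^sub>m (Suc m) (Suc m)) + (- 1) \<cdot>\<^sub>m (if v = s then hm m u t else 0\<^sub>m (Suc m) (Suc m))"
proof (rule eq_matI)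
  fix i j assume "i < dim_row ((if t = u then hm m s v else 0\<^sub>m (Suc m) (Suc m)) + (- 1) \<cdot>\<^sub>m (if v = s then hm m u t else 0\<^sub>m (Suc m) (Suc m)))"
    "j < dim_col ((if t = u then hm m s v else 0\<^sub>m (Suc m) (Suc m)) + (- 1) \<cdot>\<^sub>m (if v = s then hm m u t else 0\<^sub>m (Suc m) (Suc m)))"
  then have ij: "i < Suc m" "j < Suc m" by (auto split: if_splits simp: hm_def)
  have prod: "(\<Sum>k<Suc m. hm m s t $$ (i, k) * hm m u v $$ (k, j)) =
    (if i = s \<and> j = v \<and> t = u then 1 else 0) + (if s = t \<and> u = v \<and> i = m \<and> j = m then 1 else 0)"
    if "s < m" "t < m" "u < m" "v < m" for s t u v
  proof -
    have "(\<Sum>k<Suc m. hm m s t $$ (i, k) * hm m u v $$ (k, j)) =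
      (\<Sum>k<Suc m. (if k = t then (if i = s \<and> j = v \<and> t = u then 1 else 0) else 0)
        + (if k = m then (if s = t \<and> u = v \<and> i = m \<and> j = m then 1 else 0) else 0))"
      by (rule sum.cong) (use that ij in auto)
    also have "\<dots> = (if i = s \<and> j = v \<and> t = u then 1 else 0) + (if s = t \<and> u = v \<and> i = m \<and> j = m then 1 else 0)"
      unfolding sum.distrib using that by (simp add: sum.delta)
    finally show ?thesis .
  qed
  let ?X = "if t = u then hm m s v else 0\<^sub>m (Suc m) (Suc m)" and ?Y = "if v = s then hm m u t else 0\<^sub>m (Suc m) (Suc m)"
  have XY: "?X $$ (i, j) = (if t = u then (if i = s \<and> j = v then 1 else 0) - (if s = v \<and> i = m \<and> j = m then 1 else 0) else 0)"
    "?Y $$ (i, j) = (if v = s then (if i = u \<and> j = t then 1 else 0) - (if u = t \<and> i = m \<and> j = m then 1 else 0) else 0)"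
    using ij by simp_all
  have XmY: "(?X + (- 1) \<cdot>\<^sub>m ?Y) $$ (i, j) = ?X $$ (i, j) - ?Y $$ (i, j)"
    using ij by (cases "v = s") simp_all
  have br: "(hm m s t * hm m u v - hm m u v * hm m s t) $$ (i, j) =
      ((if i = s \<and> j = v \<and> t = u then 1 else 0) + (if s = t \<and> u = v \<and> i = m \<and> j = m then 1 else 0)) -
      ((if i = u \<and> j = t \<and> v = s then 1 else 0) + (if u = v \<and> s = t \<and> i = m \<and> j = m then 1 else 0))"
    unfolding bracket_entry[OF hm_closed hm_closed ij] prod[OF assms] prod[OF assms(3,4,1,2)] ..
  have "((if i = s \<and> j = v \<and> t = u then 1 else 0) + (if s = t \<and> u = v \<and> i = m \<and> j = m then 1 else 0)) -
      ((if i = u \<and> j = t \<and> v = s then 1 else 0) + (if u = v \<and> s = t \<and> i = m \<and> j = m then 1 else 0)) =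
      (if t = u then (if i = s \<and> j = v then 1 else 0) - (if s = v \<and> i = m \<and> j = m then 1 else 0) else 0) -
      (if v = s then (if i = u \<and> j = t then 1 else 0) - (if u = t \<and> i = m \<and> j = m then 1 else (0::complex)) else 0)"
  proof -
    have "(s = t \<and> u = v \<and> i = m \<and> j = m) = (u = v \<and> s = t \<and> i = m \<and> j = m)" by blast
    then show ?thesis
      by (cases "t = u"; cases "v = s"; simp only: simp_thms if_True if_False refl add_diff_cancel_right
          diff_0 diff_0_right add_0_right diff_diff_eq2; force?)
  qed
  then show "(hm m s t * hm m u v - hm m u v * hm m s t) $$ (i, j) = (?X + (- 1) \<cdot>\<^sub>m ?Y) $$ (i, j)"
    unfolding XmY br XY .
qed (simp_all add: hm_def)

subsection \<open>Words in the operators of a representation of gl(n)\<close>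

(* Keeps membership in lists of pairs in a form on which list induction works. *)
declare in_lists_conv_set [simp del] in_listsD [rule del] in_listsI [rule del]

text \<open>Covers both \<open>gl(m)\<close> acting on the inducing module and
  \<open>gl(m+1)\<close> acting on the polynomial model.\<close>

locale gl_rep =
  fixes n :: nat and R :: "nat \<Rightarrow> nat \<Rightarrow> 'p::ab_group_add \<Rightarrow> 'p"
  assumes R_add: "\<lbrakk>i < n; j < n\<rbrakk> \<Longrightarrow> R i j (x + y) = R i j x + R i j y"
    and R_comm: "\<lbrakk>i < n; j < n; k < n; l < n\<rbrakk> \<Longrightarrow>
      R i j (R k l x) = R k l (R i j x) + (if j = k then R i l x else 0) - (if l = i then R k j x else 0)"
begin

lemma R_zero: "\<lbrakk>i < n; j < n\<rbrakk> \<Longrightarrow> R i j 0 = 0"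
  using R_add[of i j 0 0] by simp

lemma R_minus: "\<lbrakk>i < n; j < n\<rbrakk> \<Longrightarrow> R i j (- x) = - R i j x"
  using R_add[of i j x "- x"] R_zero[of i j] by (simp add: eq_neg_iff_add_eq_0 add.commute)

lemma R_diff: "\<lbrakk>i < n; j < n\<rbrakk> \<Longrightarrow> R i j (x - y) = R i j x - R i j y"
  using R_add[of i j x "- y"] R_minus[of i j y] by simp

definition wact :: "(nat \<times> nat) list \<Rightarrow> 'p \<Rightarrow> 'p" where
  "wact u z = foldr (\<lambda>(i, j). R i j) u z"

lemma wact_simps [simp]:
  "wact [] z = z" "wact ((i, j) # u) z = R i j (wact u z)" "wact (u @ v) z = wact u (wact v z)"
  by (simp_all add: wact_def)

lemma wact_add: "u \<in> lists ({..<n} \<times> {..<n}) \<Longrightarrow> wact u (x + y) = wact u x + wact u y"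
  by (induction u) (auto simp: R_add)

lemma wact_zero: "u \<in> lists ({..<n} \<times> {..<n}) \<Longrightarrow> wact u 0 = 0"
  by (induction u) (auto simp: R_zero)

lemma wact_minus: "u \<in> lists ({..<n} \<times> {..<n}) \<Longrightarrow> wact u (- x) = - wact u x"
  by (induction u) (auto simp: R_minus)

lemma wact_diff: "u \<in> lists ({..<n} \<times> {..<n}) \<Longrightarrow> wact u (x - y) = wact u x - wact u y"
  using wact_add[of u x "- y"] wact_minus[of u y] by simp

text \<open>The vectors of \<open>D\<close> whose images under all words over \<open>S\<close> lie
  in \<open>Z0\<close> are stable under every operator. Moving \<open>R k l\<close> past the letter
  next to it produces shorter words applied to admissible vectors, and \<open>base\<close> handles
  the empty word. Applied with the raising operators and the kernel of a functional, and with the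
  nilradical and vanishing constant term.\<close>

lemma word_stable:
  assumes S: "S \<subseteq> {..<n} \<times> {..<n}"
    and dom: "\<And>k l z. \<lbrakk>k < n; l < n; z \<in> D\<rbrakk> \<Longrightarrow> R k l z \<in> D"
    and Z0: "0 \<in> Z0" "\<And>x y. \<lbrakk>x \<in> Z0; y \<in> Z0\<rbrakk> \<Longrightarrow> x + y \<in> Z0" "\<And>x. x \<in> Z0 \<Longrightarrow> - x \<in> Z0"
    and base: "\<And>k l z. \<lbrakk>k < n; l < n; z \<in> D; z \<in> Z0; \<forall>(i, j)\<in>S. R i j z \<in> Z0\<rbrakk> \<Longrightarrow> R k l z \<in> Z0"
    and kl: "k < n" "l < n" and z: "z \<in> D" "\<forall>u\<in>lists S. wact u z \<in> Z0"
  shows "\<forall>u\<in>lists S. wact u (R k l z) \<in> Z0"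
proof -
  have "wact u (R k l z) \<in> Z0"
    if "u \<in> lists S" "k < n" "l < n" "z \<in> D" "\<forall>u\<in>lists S. wact u z \<in> Z0" for u k l z
    using that
  proof (induction u arbitrary: k l z rule: rev_induct)
    case Nil
    have "\<forall>(i, j)\<in>S. R i j z \<in> Z0"
    proof clarify
      fix i j assume "(i, j) \<in> S"
      then have "[(i, j)] \<in> lists S" by simp
      with Nil.prems(5) have "wact [(i, j)] z \<in> Z0" by blast
      then show "R i j z \<in> Z0" by simp
    qed
    moreover have "z \<in> Z0"
      using Nil.prems(5) by (metis lists.Nil wact_simps(1))
    ultimately show ?case using base Nil.prems by simp
  next
    case (snoc e u)
    obtain i j where e: "e = (i, j)" by force
    have eS: "(i, j) \<in> S" and uS: "u \<in> lists S" using snoc.prems e by auto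
    then have ij: "i < n" "j < n" using S by auto
    have uR: "u \<in> lists ({..<n} \<times> {..<n})" using uS S by (meson lists_mono subsetD)
    \<comment> \<open>Words are peeled from the right because this preserves the hypothesis: a word
      applied to \<open>R i j z\<close> is a longer word applied to \<open>z\<close>.\<close>
    have Rz: "\<forall>w\<in>lists S. wact w (R i j z) \<in> Z0"
    proof
      fix w assume "w \<in> lists S"
      then have "w @ [(i, j)] \<in> lists S" using eS by simp
      from bspec[OF snoc.prems(5) this] show "wact w (R i j z) \<in> Z0" by simp
    qed
    have 1: "wact u (R k l (R i j z)) \<in> Z0"
      using snoc.IH[OF uS snoc.prems(2,3) dom[OF ij snoc.prems(4)] Rz] .
    have 2: "wact u (if j = k then R i l z else 0) \<in> Z0"
      using snoc.IH[OF uS ij(1) snoc.prems(3,4,5)] Z0(1) wact_zero[OF uR] by simp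
    have 3: "wact u (if l = i then R k j z else 0) \<in> Z0"
      using snoc.IH[OF uS snoc.prems(2) ij(2) snoc.prems(4,5)] Z0(1) wact_zero[OF uR] by simp
    have "wact (u @ [e]) (R k l z) = wact u (R k l (R i j z)) + wact u (if j = k then R i l z else 0)
       + - wact u (if l = i then R k j z else 0)"
      using R_comm[OF ij snoc.prems(2,3), of z] e by (simp add: wact_diff[OF uR] wact_add[OF uR])
    then show ?case using 1 2 3 Z0 by metis
  qed
  then show ?thesis using kl z by blast
qed

text \<open>Takes the place of boundedness of weights: local nilpotency of the raising operators is
  what supplies highest weight vectors in submodules.\<close>

fun nilp :: "nat \<Rightarrow> 'p \<Rightarrow> bool" where
  "nilp 0 z \<longleftrightarrow> z = 0"
| "nilp (Suc a) z \<longleftrightarrow> (\<forall>i j. i < j \<and> j < n \<longrightarrow> nilp a (R i j z))"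

lemma nilp_zero: "nilp a 0"
  by (induction a) (auto simp: R_zero)

lemma nilp_Suc: "nilp a z \<Longrightarrow> nilp (Suc a) z"
proof (induction a arbitrary: z)
  case 0
  then show ?case by (auto simp: R_zero)
next
  case (Suc a)
  then show ?case by (metis nilp.simps(2))
qed

lemma nilp_mono: "nilp a z \<Longrightarrow> a \<le> b \<Longrightarrow> nilp b z"
  by (induction b) (metis le_Suc_eq nilp_Suc le_zero_eq)+

lemma nilp_add: "nilp a x \<Longrightarrow> nilp a y \<Longrightarrow> nilp a (x + y)"
  by (induction a arbitrary: x y) (auto simp: R_add)

lemma nilp_minus: "nilp a x \<Longrightarrow> nilp a (- x)"
  by (induction a arbitrary: x) (auto simp: R_minus)

text \<open>The number \<open>n + k - l\<close> measures how far \<open>R k l\<close> lowers,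
  shifted by \<open>n\<close> to stay positive. Commuting a raising operator past
  \<open>R k l\<close> leaves \<open>R i l\<close> with \<open>i < k\<close> or \<open>R k j\<close>
  with \<open>l < j\<close>, and both have smaller measure; this pays for the raising operator used
  up.\<close>

lemma nilp_R: "\<lbrakk>nilp a z; k < n; l < n\<rbrakk> \<Longrightarrow> nilp (a + (n + k - l)) (R k l z)"
proof (induction "a + (n + k - l)" arbitrary: a k l z rule: less_induct)
  case less
  show ?case
  proof (cases a)
    case 0
    then show ?thesis using less.prems by (auto simp: R_zero nilp_zero)
  next
    case (Suc b)
    have "nilp (b + (n + k - l)) (R i j (R k l z))" if ij: "i < j" "j < n" for i j
    proof -
      have i: "i < n" using ij by simp
      have "nilp b (R i j z)" using less.prems(1) Suc ij by simp
      then have 1: "nilp (b + (n + k - l)) (R k l (R i j z))"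
        using less.hyps[of b k l "R i j z"] less.prems Suc by simp
      have 2: "nilp (b + (n + k - l)) (if j = k then R i l z else 0)"
      proof (cases "j = k")
        case True
        have "nilp (a + (n + i - l)) (R i l z)"
          using less.hyps[of a i l z] less.prems True ij by simp
        then have "nilp (b + (n + k - l)) (R i l z)"
          by (rule nilp_mono) (use True ij less.prems(3) Suc in simp)
        then show ?thesis using True by simp
      qed (simp add: nilp_zero)
      have 3: "nilp (b + (n + k - l)) (- (if l = i then R k j z else 0))"
      proof (cases "l = i")
        case True
        have "nilp (a + (n + k - j)) (R k j z)"
          using less.hyps[of a k j z] less.prems True ij by simp
        then have "nilp (b + (n + k - l)) (R k j z)"
          by (rule nilp_mono) (use True ij less.prems(3) Suc in simp)
        then show ?thesis using True by (simp add: nilp_minus)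
      qed (simp add: nilp_zero)
      show ?thesis
        using nilp_add[OF nilp_add[OF 1 2] 3] R_comm[OF i ij(2) less.prems(2,3), of z] by simp
    qed
    then show ?thesis using Suc by simp
  qed
qed

text \<open>Raising operators are applied as long as some result is nonzero; \<open>nilp\<close>
  bounds the number of steps.\<close>

lemma nilp_imp_highest:
  assumes W: "\<And>i j w. \<lbrakk>i < j; j < n; w \<in> W\<rbrakk> \<Longrightarrow> R i j w \<in> W"
  shows "\<lbrakk>nilp a z; z \<in> W; z \<noteq> 0\<rbrakk> \<Longrightarrow> \<exists>w\<in>W. w \<noteq> 0 \<and> (\<forall>i j. i < j \<and> j < n \<longrightarrow> R i j w = 0)"
proof (induction a arbitrary: z)
  case 0
  then show ?case by simp
next
  case (Suc a)
  show ?case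
  proof (cases "\<exists>i j. i < j \<and> j < n \<and> R i j z \<noteq> 0")
    case True
    then show ?thesis using Suc W by (metis nilp.simps(2))
  qed (use Suc in blast)
qed

end

subsection \<open>Simple highest weight modules of gl(m)\<close>

text \<open>The inducing module is a subspace \<open>U\<close> of a type that is itself a vector
  space, so that spans and bases of the type are at hand. Indices and weights start at 0.\<close>

locale hw_module = vector_space sc + gl_rep m A
  for sc :: "complex \<Rightarrow> 't::ab_group_add \<Rightarrow> 't" and m and A :: "nat \<Rightarrow> nat \<Rightarrow> 't \<Rightarrow> 't" +
  fixes U :: "'t set" and v0 :: 't and \<mu> :: "nat \<Rightarrow> complex"
  assumes A_scale: "\<lbrakk>i < m; j < m\<rbrakk> \<Longrightarrow> A i j (sc c x) = sc c (A i j x)"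
    and U_subspace: "subspace U"
    and U_A: "\<lbrakk>i < m; j < m; y \<in> U\<rbrakk> \<Longrightarrow> A i j y \<in> U"
    and v0_U: "v0 \<in> U" and v0_nz: "v0 \<noteq> 0"
    and simple: "\<lbrakk>subspace W; W \<subseteq> U; \<And>i j y. \<lbrakk>i < m; j < m; y \<in> W\<rbrakk> \<Longrightarrow> A i j y \<in> W\<rbrakk> \<Longrightarrow> W = {0} \<or> W = U"
    and raise_v0: "\<lbrakk>i < j; j < m\<rbrakk> \<Longrightarrow> A i j v0 = 0"
    and weight_v0: "i < m \<Longrightarrow> A i i v0 = sc (\<mu> i) v0"
begin

lemma generated:
  "\<lbrakk>subspace W; W \<subseteq> U; \<And>i j y. \<lbrakk>i < m; j < m; y \<in> W\<rbrakk> \<Longrightarrow> A i j y \<in> W; v0 \<in> W\<rbrakk> \<Longrightarrow> W = U"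
  using simple[of W] v0_nz by blast

definition Low :: "(nat \<times> nat) set" where "Low = {(i, j). j < i \<and> i < m}"
definition Up :: "(nat \<times> nat) set" where "Up = {(i, j). i < j \<and> j < m}"

fun wt :: "(nat \<times> nat) list \<Rightarrow> nat \<Rightarrow> complex" where
  "wt [] i = \<mu> i"
| "wt ((a, b) # u) i = wt u i + (if i = a then 1 else 0) - (if i = b then 1 else 0)"

lemma A_sub: "subspace S \<Longrightarrow> k < m \<Longrightarrow> l < m \<Longrightarrow> subspace {y. A k l y \<in> S}"
  unfolding subspace_def by (auto simp: R_add R_zero A_scale)

lemma word_weight: "\<lbrakk>u \<in> lists Low; i < m\<rbrakk> \<Longrightarrow> A i i (wact u v0) = sc (wt u i) (wact u v0)"
proof (induction u)
  case Nil
  then show ?case by (simp add: weight_v0)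
next
  case (Cons e u)
  obtain a b where e: "e = (a, b)" by force
  have ab: "b < a" "a < m" "b < m" using Cons.prems e by (auto simp: Low_def)
  have IH: "A i i (wact u v0) = sc (wt u i) (wact u v0)" using Cons by auto
  have "A i i (A a b (wact u v0)) = A a b (sc (wt u i) (wact u v0))
     + (if i = a then A i b (wact u v0) else 0) - (if b = i then A a i (wact u v0) else 0)"
    using R_comm[of i i a b "wact u v0"] ab Cons.prems IH by simp
  then show ?case
    using e ab by (auto simp: A_scale scale_left_diff_distrib scale_left_distrib)
qed

text \<open>An operator is commuted past the first letter of the word; the two correction terms act
  on a shorter word. At the empty word the operator kills \<open>v0\<close>, scales it, or is itself
  a lowering letter.\<close>

lemma word_span:
  "\<lbrakk>u \<in> lists Low; k < m; l < m\<rbrakk> \<Longrightarrow> A k l (wact u v0) \<in> span ((\<lambda>u. wact u v0) ` lists Low)"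
proof (induction u arbitrary: k l)
  case Nil
  consider "k < l" | "k = l" | "l < k" by linarith
  then show ?case
  proof cases
    case 1
    then show ?thesis using Nil by (simp add: raise_v0 span_zero)
  next
    case 2
    have "wact [] v0 \<in> (\<lambda>u. wact u v0) ` lists Low" by (rule imageI) simp
    then have "v0 \<in> (\<lambda>u. wact u v0) ` lists Low" by (simp only: wact_simps)
    then show ?thesis using Nil 2 by (simp add: weight_v0 span_scale span_base)
  next
    case 3
    have "wact [(k, l)] v0 \<in> (\<lambda>u. wact u v0) ` lists Low" by (rule imageI) (use 3 Nil in \<open>simp add: Low_def\<close>)
    then show ?thesis using Nil 3 by (auto intro!: span_base)
  qed
next
  case (Cons e u)
  let ?S = "span ((\<lambda>u. wact u v0) ` lists Low)"
  obtain a b where e: "e = (a, b)" by force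
  have ab: "b < a" "a < m" "b < m" using Cons.prems e by (auto simp: Low_def)
  have uL: "u \<in> lists Low" using Cons.prems by auto
  have 1: "A a b y \<in> ?S" if "y \<in> ?S" for y
  proof -
    have "?S \<subseteq> {y. A a b y \<in> ?S}"
    proof (rule span_minimal)
      show "subspace {y. A a b y \<in> ?S}" using A_sub[of ?S a b] ab by simp
      show "(\<lambda>u. wact u v0) ` lists Low \<subseteq> {y. A a b y \<in> ?S}"
      proof clarify
        fix w assume "w \<in> lists Low"
        then have "wact ((a, b) # w) v0 \<in> (\<lambda>u. wact u v0) ` lists Low"
          using ab by (intro imageI) (simp add: Low_def)
        then show "A a b (wact w v0) \<in> ?S" by (auto intro: span_base)
      qed
    qed
    with that show ?thesis by blast
  qed
  have "A k l (wact (e # u) v0) = A a b (A k l (wact u v0))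
     + (if l = a then A k b (wact u v0) else 0) - (if b = k then A a l (wact u v0) else 0)"
    unfolding e wact_simps by (rule R_comm) (use ab Cons.prems in auto)
  moreover have "\<dots> \<in> ?S"
    using 1[OF Cons.IH[OF uL Cons.prems(2,3)]] Cons.IH[OF uL Cons.prems(2) ab(3)]
      Cons.IH[OF uL ab(2) Cons.prems(3)]
    by (auto intro!: span_add span_diff simp: span_zero)
  ultimately show ?case by simp
qed

lemma word_U: "u \<in> lists Low \<Longrightarrow> wact u v0 \<in> U"
  by (induction u) (auto simp: v0_U Low_def intro!: U_A)

lemma U_eq_span: "U = span ((\<lambda>u. wact u v0) ` lists Low)"
proof (rule generated[symmetric])
  let ?S = "span ((\<lambda>u. wact u v0) ` lists Low)"
  show "subspace ?S" by simp
  show "?S \<subseteq> U" by (rule span_minimal[OF _ U_subspace]) (auto intro: word_U)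
  have "wact [] v0 \<in> (\<lambda>u. wact u v0) ` lists Low" by (rule imageI) simp
  then show "v0 \<in> ?S" by (auto intro: span_base)
  fix i j y assume ij: "i < m" "j < m" and y: "y \<in> ?S"
  have "?S \<subseteq> {y. A i j y \<in> ?S}"
    by (rule span_minimal) (use ij word_span A_sub[of ?S i j] in auto)
  then show "A i j y \<in> ?S" using y by blast
qed

text \<open>Intended complement of the line through \<open>v0\<close> in \<open>U\<close>: it
  receives the image of every lowering operator, and \<phi> will be made to vanish on it. That
  \<open>v0\<close> lies outside is not evident, since words may satisfy relations.\<close>

definition L :: "'t set" where "L = span ((\<lambda>u. wact u v0) ` {u \<in> lists Low. u \<noteq> []})"

lemma low_L:
  assumes "j < i" "i < m" "y \<in> U" shows "A i j y \<in> L"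
proof -
  have "U \<subseteq> {y. A i j y \<in> L}" unfolding U_eq_span
  proof (rule span_minimal)
    show "subspace {y. A i j y \<in> L}" using assms by (auto simp: L_def intro!: A_sub)
    show "(\<lambda>u. wact u v0) ` lists Low \<subseteq> {y. A i j y \<in> L}"
    proof clarify
      fix u assume "u \<in> lists Low"
      then have "wact ((i, j) # u) v0 \<in> (\<lambda>u. wact u v0) ` {u \<in> lists Low. u \<noteq> []}"
        using assms by (intro imageI) (simp add: Low_def)
      then show "A i j (wact u v0) \<in> L" unfolding L_def by (auto intro: span_base)
    qed
  qed
  then show ?thesis using assms by blast
qed

lemma diag_L:
  assumes "i < m" "y \<in> L" shows "A i i y \<in> L"
proof -
  have "L \<subseteq> {y. A i i y \<in> L}" unfolding L_def
  proof (rule span_minimal)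
    show "subspace {y. A i i y \<in> span ((\<lambda>u. wact u v0) ` {u \<in> lists Low. u \<noteq> []})}"
      by (rule A_sub) (use assms in auto)
    show "(\<lambda>u. wact u v0) ` {u \<in> lists Low. u \<noteq> []} \<subseteq> {y. A i i y \<in> span ((\<lambda>u. wact u v0) ` {u \<in> lists Low. u \<noteq> []})}"
    proof (intro image_subsetI CollectI)
      fix u assume u: "u \<in> {u \<in> lists Low. u \<noteq> []}"
      then have "A i i (wact u v0) = sc (wt u i) (wact u v0)" using word_weight assms(1) by blast
      then show "A i i (wact u v0) \<in> span ((\<lambda>u. wact u v0) ` {u \<in> lists Low. u \<noteq> []})"
        using u by (simp add: span_scale span_base del: mem_Collect_eq)
    qed
  qed
  then show ?thesis using assms by blast
qed

lemma U_decomp: "y \<in> U \<Longrightarrow> \<exists>c. \<exists>z\<in>L. y = sc c v0 + z"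
proof -
  have "(\<lambda>u. wact u v0) ` lists Low \<subseteq> insert v0 ((\<lambda>u. wact u v0) ` {u \<in> lists Low. u \<noteq> []})"
  proof (rule image_subsetI)
    fix u assume "u \<in> lists Low"
    then show "wact u v0 \<in> insert v0 ((\<lambda>u. wact u v0) ` {u \<in> lists Low. u \<noteq> []})"
      by (cases "u = []") simp_all
  qed
  then have "U \<subseteq> span (insert v0 ((\<lambda>u. wact u v0) ` {u \<in> lists Low. u \<noteq> []}))"
    unfolding U_eq_span by (rule span_mono)
  moreover assume "y \<in> U"
  ultimately obtain c where "y - sc c v0 \<in> L" unfolding L_def span_insert by blast
  then show ?thesis by (intro exI[of _ c] bexI[of _ "y - sc c v0"]) simp_all
qed

text \<open>The words are eigenvectors of this height operator, with the eigenvalue of \<open>v0\<close> strictly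
  separated from those of nonempty words.\<close>

definition height :: "'t \<Rightarrow> 't" where "height y = (\<Sum>i<m. sc (of_nat i) (A i i y))"

lemma height_add: "height (x + y) = height x + height y"
  by (simp add: height_def R_add scale_right_distrib sum.distrib)

lemma height_scale: "height (sc c x) = sc c (height x)"
  by (simp add: height_def A_scale scale_sum_right mult.commute)

lemma height_word:
  assumes "u \<in> lists Low"
  shows "\<exists>k\<ge>length u. height (wact u v0) = sc ((\<Sum>i<m. of_nat i * \<mu> i) + of_nat k) (wact u v0)"
proof -
  have "u \<in> lists Low \<Longrightarrow> \<exists>k\<ge>length u. (\<Sum>i<m. of_nat i * wt u i) = (\<Sum>i<m. of_nat i * \<mu> i) + of_nat k"
  proof (induction u)
    case Nil
    then show ?case by (intro exI[of _ 0]) simp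
  next
    case (Cons e u)
    obtain a b where e: "e = (a, b)" by force
    have ab: "b < a" "a < m" "b < m" using Cons.prems e by (auto simp: Low_def)
    obtain k where k: "k \<ge> length u" "(\<Sum>i<m. of_nat i * wt u i) = (\<Sum>i<m. of_nat i * \<mu> i) + of_nat k"
      using Cons by auto
    have "(\<Sum>i<m. of_nat i * wt (e # u) i) = (\<Sum>i<m. of_nat i * wt u i)
       + (\<Sum>i<m. if i = a then of_nat i else 0) - (\<Sum>i<m. if i = b then of_nat i else 0)"
      unfolding e sum.distrib[symmetric] sum_subtractf[symmetric]
      by (rule sum.cong) (auto simp: algebra_simps)
    also have "\<dots> = (\<Sum>i<m. of_nat i * \<mu> i) + of_nat (k + (a - b))"
      using ab k by (simp add: of_nat_diff)
    finally show ?case using k ab by (intro exI[of _ "k + (a - b)"]) auto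
  qed
  then obtain k where k: "k \<ge> length u" "(\<Sum>i<m. of_nat i * wt u i) = (\<Sum>i<m. of_nat i * \<mu> i) + of_nat k"
    using assms by blast
  have "height (wact u v0) = sc (\<Sum>i<m. of_nat i * wt u i) (wact u v0)"
    unfolding height_def scale_sum_left by (rule sum.cong) (auto simp: word_weight[OF assms])
  with k show ?thesis by auto
qed

text \<open>\<open>hpoly N\<close> is \<open>\<Prod>\<^sub>k\<^sub><\<^sub>N (height - c - (k + 1))\<close> for the eigenvalue \<open>c\<close> of \<open>v0\<close>: it annihilates any given combination of
  nonempty words for large \<open>N\<close>, but never \<open>v0\<close>.\<close>

fun hpoly :: "nat \<Rightarrow> 't \<Rightarrow> 't" where
  "hpoly 0 y = y"
| "hpoly (Suc N) y = height (hpoly N y) - sc ((\<Sum>i<m. of_nat i * \<mu> i) + of_nat (Suc N)) (hpoly N y)"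

lemma hpoly_add: "hpoly N (x + y) = hpoly N x + hpoly N y"
  by (induction N) (simp_all add: height_add scale_right_distrib)

lemma hpoly_scale: "hpoly N (sc c y) = sc c (hpoly N y)"
  by (induction N) (simp_all add: height_scale scale_right_diff_distrib mult.commute)

lemma hpoly_eigen:
  assumes "height y = sc ((\<Sum>i<m. of_nat i * \<mu> i) + e) y"
  shows "hpoly N y = sc (\<Prod>k<N. e - of_nat (Suc k)) y"
proof (induction N)
  case 0
  then show ?case by simp
next
  case (Suc N)
  show ?case
    unfolding hpoly.simps Suc height_scale assms
    by (simp add: scale_left_diff_distrib[symmetric] algebra_simps)
qed

lemma v0_notin_L: "v0 \<notin> L"
proof
  assume "v0 \<in> L"
  have "L \<subseteq> {y. \<exists>N. \<forall>M\<ge>N. hpoly M y = 0}" unfolding L_def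
  proof (rule span_minimal)
    have z: "hpoly N 0 = 0" for N using hpoly_scale[of N 0 0] by simp
    have "\<exists>N. \<forall>M\<ge>N. hpoly M (x + y) = 0"
      if "\<forall>M\<ge>N. hpoly M x = 0" "\<forall>M\<ge>N'. hpoly M y = 0" for x y N N'
      using that by (intro exI[of _ "max N N'"]) (simp add: hpoly_add)
    then show "subspace {y. \<exists>N. \<forall>M\<ge>N. hpoly M y = 0}"
      unfolding subspace_def using z by (auto simp: hpoly_scale)
    show "(\<lambda>u. wact u v0) ` {u \<in> lists Low. u \<noteq> []} \<subseteq> {y. \<exists>N. \<forall>M\<ge>N. hpoly M y = 0}"
    proof clarify
      fix u assume u: "u \<in> lists Low" "u \<noteq> []"
      obtain k where k: "k \<ge> length u" "height (wact u v0) = sc ((\<Sum>i<m. of_nat i * \<mu> i) + of_nat k) (wact u v0)"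
        using height_word[OF u(1)] by blast
      have k1: "k \<ge> 1" using k u by (cases u) auto
      have "hpoly M (wact u v0) = 0" if "M \<ge> k" for M
      proof -
        \<comment> \<open>The factor with index \<open>k - 1\<close> vanishes;
          \<open>k \<ge> 1\<close> because the word is nonempty.\<close>
        have "(\<Prod>i<M. of_nat k - of_nat (Suc i)) = (0 :: complex)"
          using that k1 by (intro prod_zero) (auto intro!: bexI[of _ "k - 1"])
        then show ?thesis using hpoly_eigen[OF k(2), of M] by simp
      qed
      then show "\<exists>N. \<forall>M\<ge>N. hpoly M (wact u v0) = 0" by blast
    qed
  qed
  with \<open>v0 \<in> L\<close> obtain N where "hpoly N v0 = 0" by blast
  moreover have "height v0 = sc ((\<Sum>i<m. of_nat i * \<mu> i) + 0) v0"
    unfolding height_def by (simp add: weight_v0 scale_sum_left)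
  from hpoly_eigen[OF this, of N] have "hpoly N v0 = sc (\<Prod>k<N. - of_nat (Suc k)) v0" by simp
  moreover have "(\<Prod>k<N. - of_nat (Suc k)) \<noteq> (0::complex)"
    by (simp add: prod_zero_iff del: of_nat_Suc)
  ultimately show False using v0_nz by simp
qed

lemma weight_functional_exists:
  "\<exists>\<phi>. (\<forall>x y. \<phi> (x + y) = \<phi> x + \<phi> y) \<and> (\<forall>c x. \<phi> (sc c x) = c * \<phi> x) \<and> \<phi> v0 = (1::complex) \<and> (\<forall>y\<in>L. \<phi> y = 0)"
proof -
  interpret c: vector_space "(*) :: complex \<Rightarrow> complex \<Rightarrow> complex"
    by unfold_locales (auto simp: algebra_simps)
  interpret p: vector_space_pair sc "(*) :: complex \<Rightarrow> complex \<Rightarrow> complex" ..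
  obtain B where B: "B \<subseteq> L" "independent B" "L \<subseteq> span B"
    using maximal_independent_subset[of L] by blast
  have "span B \<subseteq> L" using B(1) unfolding L_def by (metis span_minimal subspace_span)
  then have sB: "span B = L" using B by blast
  \<comment> \<open>Adjoining \<open>v0\<close> to a basis of \<open>L\<close> keeps independence,
    so the values 1 on \<open>v0\<close> and 0 on the basis can be prescribed together.\<close>
  have "independent (insert v0 B)" using v0_notin_L sB B(2) by (intro independent_insertI) auto
  from p.linear_independent_extend[OF this, of "\<lambda>x. if x = v0 then 1 else 0"]
  obtain g where g: "Vector_Spaces.linear sc (*) g" "\<forall>x\<in>insert v0 B. g x = (if x = v0 then 1 else 0)" by blast
  interpret g: Vector_Spaces.linear sc "(*)" g by (rule g(1))
  have "B \<subseteq> {y. g y = 0}" using g(2) v0_notin_L B(1) by auto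
  moreover have "subspace {y. g y = 0}" unfolding subspace_def by (auto simp: g.add g.scale g.zero)
  ultimately have "L \<subseteq> {y. g y = 0}" using sB span_minimal by metis
  then show ?thesis using g.add g.scale g(2) by (intro exI[of _ g]) auto
qed

definition \<phi> :: "'t \<Rightarrow> complex" where
  "\<phi> = (SOME \<phi>. (\<forall>x y. \<phi> (x + y) = \<phi> x + \<phi> y) \<and> (\<forall>c x. \<phi> (sc c x) = c * \<phi> x) \<and> \<phi> v0 = 1 \<and> (\<forall>y\<in>L. \<phi> y = 0))"

lemma \<phi>_add: "\<phi> (x + y) = \<phi> x + \<phi> y" and \<phi>_scale: "\<phi> (sc c x) = c * \<phi> x"
  and \<phi>_v0: "\<phi> v0 = 1" and \<phi>_L: "y \<in> L \<Longrightarrow> \<phi> y = 0"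
  using someI_ex[OF weight_functional_exists] unfolding \<phi>_def by blast+

lemma \<phi>_low: "\<lbrakk>j < i; i < m; y \<in> U\<rbrakk> \<Longrightarrow> \<phi> (A i j y) = 0"
  by (simp add: \<phi>_L low_L)

text \<open>A diagonal operator preserves both summands of \<open>U_decomp\<close>, the line through
  \<open>v0\<close> and \<open>L\<close>.\<close>

lemma \<phi>_diag: 
  assumes "i < m" "y \<in> U" shows "\<phi> (A i i y) = \<mu> i * \<phi> y"
proof -
  obtain c z where z: "z \<in> L" "y = sc c v0 + z" using U_decomp assms by blast
  then show ?thesis using assms by (simp add: R_add A_scale weight_v0 \<phi>_add \<phi>_scale \<phi>_v0 \<phi>_L diag_L)
qed

lemma Up_sub: "Up \<subseteq> {..<m} \<times> {..<m}" by (auto simp: Up_def)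

lemma Up_lists: "u \<in> lists Up \<Longrightarrow> u \<in> lists ({..<m} \<times> {..<m})"
  using Up_sub lists_mono by blast

lemma Up_word_kills:
  assumes "\<And>a b. \<lbrakk>a < b; b < m\<rbrakk> \<Longrightarrow> A a b y = 0" "u \<in> lists Up" "u \<noteq> []"
  shows "wact u y = 0"
proof -
  obtain v a b where "u = v @ [(a, b)]" using assms(3) by (metis rev_exhaust surj_pair)
  then show ?thesis using assms(1,2) wact_zero[OF Up_lists, of v] by (simp add: Up_def)
qed

lemma wact_scale: "u \<in> lists ({..<m} \<times> {..<m}) \<Longrightarrow> wact u (sc c x) = sc c (wact u x)"
  by (induction u) (auto simp: A_scale)

text \<open>Since \<open>\<psi>\<close> is killed by lowering operators and is an eigenvector for
  diagonal ones, \<open>word_stable\<close> shows that \<open>Z\<close> is a submodule. The weight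
  \<open>\<nu>\<close> is left general because the lemma serves both \<phi> and the composition of
  \<phi> with a power of a raising operator.\<close>

lemma functional_kernel:
  fixes \<psi> :: "'t \<Rightarrow> complex"
  assumes add: "\<And>x y. \<psi> (x + y) = \<psi> x + \<psi> y" and scl: "\<And>c x. \<psi> (sc c x) = c * \<psi> x"
    and low: "\<And>i j y. \<lbrakk>j < i; i < m; y \<in> U\<rbrakk> \<Longrightarrow> \<psi> (A i j y) = 0"
    and diag: "\<And>i y. \<lbrakk>i < m; y \<in> U\<rbrakk> \<Longrightarrow> \<psi> (A i i y) = \<nu> i * \<psi> y"
  defines "Z \<equiv> {y \<in> U. \<forall>u\<in>lists Up. \<psi> (wact u y) = 0}"
  shows "Z = {0} \<or> Z = U"
proof (rule simple)
  have \<psi>0: "\<psi> 0 = 0" using scl[of 0 0] by simp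
  have \<psi>m: "\<psi> (- x) = - \<psi> x" for x using add[of x "- x"] \<psi>0 by (simp add: eq_neg_iff_add_eq_0 add.commute)
  show "subspace Z"
    using U_subspace unfolding Z_def subspace_def
    by (auto simp: wact_add wact_zero wact_scale \<psi>0 add scl Up_lists)
  show "Z \<subseteq> U" by (auto simp: Z_def)
  fix k l y assume kl: "k < m" "l < m" and y: "y \<in> Z"
  have "\<forall>u\<in>lists Up. wact u (A k l y) \<in> {z. \<psi> z = 0}"
  proof (rule word_stable[where D = U])
    fix i j z assume ij: "i < m" "j < m" and z: "z \<in> U" "z \<in> {z. \<psi> z = 0}" "\<forall>(i, j)\<in>Up. A i j z \<in> {z. \<psi> z = 0}"
    consider "i < j" | "i = j" | "j < i" by linarith
    then show "A i j z \<in> {z. \<psi> z = 0}"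
      using low[of j i z] diag[of i z] ij z by cases (auto simp: Up_def)
  qed (use Up_sub U_A kl y in \<open>auto simp: \<psi>0 \<psi>m add Z_def\<close>)
  then show "A k l y \<in> Z" using y kl U_A by (auto simp: Z_def)
qed

text \<open>The vectors that fail to be detected form a submodule without \<open>v0\<close>, as the
  empty word shows, so by simplicity only zero remains.\<close>

lemma \<phi>_separates:
  assumes "y \<in> U" "\<And>u. u \<in> lists Up \<Longrightarrow> \<phi> (wact u y) = 0" shows "y = 0"
proof -
  let ?Z = "{y \<in> U. \<forall>u\<in>lists Up. \<phi> (wact u y) = 0}"
  have "?Z = {0} \<or> ?Z = U" by (rule functional_kernel[of _ \<mu>]) (auto simp: \<phi>_add \<phi>_scale \<phi>_low \<phi>_diag)
  moreover have "v0 \<notin> ?Z" using \<phi>_v0 by (auto intro!: bexI[of _ "[]"])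
  ultimately have "?Z = {0}" using v0_U by blast
  then show ?thesis using assms by blast
qed

text \<open>The composition of \<phi> with a power of the raising operator is again a weight
  functional; each factor shifts its weight by one simple root.\<close>

lemma \<phi>_pow_diag:
  assumes i: "Suc i < m" and k: "k < m" and y: "y \<in> U"
  shows "\<phi> ((A i (Suc i) ^^ N) (A k k y)) =
    (\<mu> k - (if k = i then of_nat N else 0) + (if k = Suc i then of_nat N else 0)) * \<phi> ((A i (Suc i) ^^ N) y)"
  using y
proof (induction N arbitrary: y)
  case 0
  then show ?case using \<phi>_diag k by simp
next
  case (Suc N)
  have i': "i < m" using i by simp
  let ?e = "A i (Suc i)"
  have e: "?e (A k k y) = A k k (?e y) + (if Suc i = k then ?e y else 0) - (if k = i then ?e y else 0)"
    using R_comm[of i "Suc i" k k y] i k by (auto split: if_splits)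
  have add: "(?e ^^ N) (x + y) = (?e ^^ N) x + (?e ^^ N) y" for x y by (induction N) (auto simp: R_add i i')
  have zero: "(?e ^^ N) 0 = 0" using add[of 0 0] by simp
  have minus: "(?e ^^ N) (- x) = - (?e ^^ N) x" for x
    using add[of x "- x"] zero by (simp add: eq_neg_iff_add_eq_0 add.commute)
  have diff: "(?e ^^ N) (x - y) = (?e ^^ N) x - (?e ^^ N) y" for x y using add[of x "- y"] minus[of y] by simp
  have \<phi>d: "\<phi> (x - y) = \<phi> x - \<phi> y" for x y using \<phi>_add[of "x - y" y] by simp
  have \<phi>0: "\<phi> 0 = 0" using \<phi>_add[of 0 0] by simp
  have "\<phi> ((?e ^^ Suc N) (A k k y)) = \<phi> ((?e ^^ N) (?e (A k k y)))" by (simp add: funpow_swap1)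
  also have "\<dots> = \<phi> ((?e ^^ N) (A k k (?e y))) + (if Suc i = k then \<phi> ((?e ^^ N) (?e y)) else 0)
     - (if k = i then \<phi> ((?e ^^ N) (?e y)) else 0)"
    unfolding e by (auto simp: add diff zero \<phi>_add \<phi>d \<phi>0)
  also have "\<dots> = (\<mu> k - (if k = i then of_nat (Suc N) else 0) + (if k = Suc i then of_nat (Suc N) else 0)) * \<phi> ((?e ^^ N) (?e y))"
    using Suc.IH[of "?e y"] U_A[OF i' i Suc.prems] by (auto simp: algebra_simps)
  finally show ?case by (simp add: funpow_swap1)
qed

text \<open>The \<open>sl(2)\<close> identity for moving one lowering operator through a power of a
  raising operator, seen through \<phi>. The coefficient vanishes for
  \<open>N = \<mu> i - \<mu> (Suc i)\<close>, so that the power \<open>Suc N\<close> composed with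
  \<phi> then kills the image of every lowering operator.\<close>

lemma \<phi>_pow_low:
  assumes i: "Suc i < m" and kl: "l < k" "k < m" and y: "y \<in> U"
  shows "\<phi> ((A i (Suc i) ^^ Suc N) (A k l y)) =
    (if k = Suc i \<and> l = i then of_nat (Suc N) * (\<mu> i - \<mu> (Suc i) - of_nat N) * \<phi> ((A i (Suc i) ^^ N) y) else 0)"
  using y kl
proof (induction N arbitrary: y k l)
  case 0
  have i': "i < m" and l: "l < m" using i 0 by simp_all
  have \<phi>d: "\<phi> (x - y) = \<phi> x - \<phi> y" for x y using \<phi>_add[of "x - y" y] by simp
  have \<phi>0: "\<phi> 0 = 0" using \<phi>_add[of 0 0] by simp
  have "\<phi> (A i (Suc i) (A k l y)) = \<phi> (A k l (A i (Suc i) y)) + (if Suc i = k then \<phi> (A i l y) else 0)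
     - (if l = i then \<phi> (A k (Suc i) y) else 0)"
    unfolding R_comm[OF i' i 0(3) l, of y] by (auto simp: \<phi>_add \<phi>d \<phi>0)
  moreover have "\<phi> (A k (Suc i) y) = 0" if "l = i" "k \<noteq> Suc i"
    using that 0 by (intro \<phi>_low) auto
  moreover have "\<phi> (A i l y) = 0" if "l \<noteq> i" "k = Suc i"
    using that 0 i by (intro \<phi>_low) auto
  ultimately show ?case
    using 0 i i' l U_A[OF i' i 0(1)]
    by (cases "l = i"; cases "k = Suc i") (auto simp: \<phi>_low \<phi>_diag algebra_simps)
next
  case (Suc N)
  have i': "i < m" and l: "l < m" using i Suc.prems by simp_all
  let ?e = "A i (Suc i)"
  have add: "(?e ^^ N) (x + y) = (?e ^^ N) x + (?e ^^ N) y" for x y N by (induction N) (auto simp: R_add i i')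
  have zero: "(?e ^^ N) 0 = 0" for N using add[of N 0 0] by simp
  have minus: "(?e ^^ N) (- x) = - (?e ^^ N) x" for x N
    using add[of N x "- x"] zero by (simp add: eq_neg_iff_add_eq_0 add.commute)
  have diff: "(?e ^^ N) (x - y) = (?e ^^ N) x - (?e ^^ N) y" for x y N using add[of N x "- y"] minus[of N y] by simp
  have \<phi>d: "\<phi> (x - y) = \<phi> x - \<phi> y" for x y using \<phi>_add[of "x - y" y] by simp
  have \<phi>0: "\<phi> 0 = 0" using \<phi>_add[of 0 0] by simp
  have U1: "?e y \<in> U" using U_A i i' Suc.prems by simp
  have "\<phi> ((?e ^^ Suc (Suc N)) (A k l y)) = \<phi> ((?e ^^ Suc N) (?e (A k l y)))" by (simp only: funpow_Suc_right comp_apply)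
  also have "\<dots> = \<phi> ((?e ^^ Suc N) (A k l (?e y))) + (if Suc i = k then \<phi> ((?e ^^ Suc N) (A i l y)) else 0)
     - (if l = i then \<phi> ((?e ^^ Suc N) (A k (Suc i) y)) else 0)"
    unfolding R_comm[OF i' i Suc.prems(3) l, of y] by (auto simp only: add diff zero \<phi>_add \<phi>d \<phi>0 split: if_splits)
  also have "\<dots> = (if k = Suc i \<and> l = i then of_nat (Suc (Suc N)) * (\<mu> i - \<mu> (Suc i) - of_nat (Suc N)) * \<phi> ((?e ^^ Suc N) y) else 0)"
  proof -
    \<comment> \<open>In case a the corrections are diagonal operators and extend the
      \<open>sl(2)\<close> sum. In cases b and c the single correction is another lowering operator,
      covered by the induction hypothesis; in case d the operators commute.\<close>
    consider (a) "k = Suc i" "l = i" | (b) "k = Suc i" "l < i" | (c) "l = i" "k > Suc i" | (d) "k \<noteq> Suc i" "l \<noteq> i"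
      using Suc.prems by linarith
    then show ?thesis
    proof cases
      case a
      have IH: "\<phi> ((?e ^^ Suc N) (A k l (?e y))) = of_nat (Suc N) * (\<mu> i - \<mu> (Suc i) - of_nat N) * \<phi> ((?e ^^ Suc N) y)"
        using Suc.IH[OF U1 Suc.prems(2,3)] a by (simp add: funpow_swap1)
      show ?thesis
        unfolding IH using \<phi>_pow_diag[OF i i' Suc.prems(1), of "Suc N"] \<phi>_pow_diag[OF i i Suc.prems(1), of "Suc N"] a
        by (simp add: algebra_simps)
    next
      case b
      then show ?thesis using Suc.IH[OF U1 Suc.prems(2,3)] Suc.IH[OF Suc.prems(1) b(2) i'] by simp
    next
      case c
      then show ?thesis using Suc.IH[OF U1 Suc.prems(2,3)] Suc.IH[OF Suc.prems(1) c(2) Suc.prems(3)] by simp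
    next
      case d
      then show ?thesis using Suc.IH[OF U1 Suc.prems(2,3)] by simp
    qed
  qed
  finally show ?case .
qed

text \<open>By \<open>\<phi>_pow_low\<close> the composed functional satisfies the hypotheses of
  \<open>functional_kernel\<close>. As \<open>v0\<close> is killed by raising operators it belongs
  to the resulting submodule, which must be all of \<open>U\<close>.\<close>

lemma \<phi>_pow_vanishes:
  assumes i: "Suc i < m" and d: "\<mu> i - \<mu> (Suc i) = of_nat N" and y: "y \<in> U"
  shows "\<phi> ((A i (Suc i) ^^ Suc N) y) = 0"
proof -
  let ?\<psi> = "\<lambda>y. \<phi> ((A i (Suc i) ^^ Suc N) y)"
  let ?Z = "{y \<in> U. \<forall>u\<in>lists Up. ?\<psi> (wact u y) = 0}"
  have i': "i < m" using i by simp
  have add: "(A i (Suc i) ^^ k) (x + y) = (A i (Suc i) ^^ k) x + (A i (Suc i) ^^ k) y" for x y k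
    by (induction k) (auto simp: R_add i i')
  have scl: "(A i (Suc i) ^^ k) (sc c x) = sc c ((A i (Suc i) ^^ k) x)" for x c k
    by (induction k) (auto simp: A_scale i i')
  have zero: "(A i (Suc i) ^^ k) 0 = 0" for k using add[of k 0 0] by simp
  have \<phi>0: "\<phi> 0 = 0" using \<phi>_add[of 0 0] by simp
  have "?Z = {0} \<or> ?Z = U"
  proof (rule functional_kernel)
    fix k l y assume "l < k" "k < m" "y \<in> U"
    then show "\<phi> ((A i (Suc i) ^^ Suc N) (A k l y)) = 0"
      using \<phi>_pow_low[OF i, of l k y N] d by auto
  next
    fix k y assume "k < m" "y \<in> U"
    then show "\<phi> ((A i (Suc i) ^^ Suc N) (A k k y)) = (\<mu> k - (if k = i then of_nat (Suc N) else 0) + (if k = Suc i then of_nat (Suc N) else 0)) * \<phi> ((A i (Suc i) ^^ Suc N) y)"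
      using \<phi>_pow_diag[OF i, of k y "Suc N"] by blast
  qed (simp_all only: add scl \<phi>_add \<phi>_scale)
  moreover have "v0 \<in> ?Z"
  proof -
    have e: "(A i (Suc i) ^^ Suc N) v0 = 0" by (simp only: funpow_Suc_right comp_apply) (simp add: raise_v0 i zero)
    have "\<phi> ((A i (Suc i) ^^ Suc N) (wact u v0)) = 0" if "u \<in> lists Up" for u
    proof (cases "u = []")
      case True
      then show ?thesis using e \<phi>0 by (simp del: funpow.simps)
    next
      case False
      have "wact u v0 = 0" by (rule Up_word_kills) (use that False in \<open>auto simp: raise_v0\<close>)
      then show ?thesis using zero[of "Suc N"] \<phi>0 by (simp del: funpow.simps)
    qed
    then show ?thesis using v0_U by blast
  qed
  ultimately have "?Z = U" using v0_nz by blast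
  then have "\<forall>u\<in>lists Up. ?\<psi> (wact u y) = 0" using y by blast
  from bspec[OF this, of "[]"] show ?thesis by (simp del: funpow.simps)
qed

text \<open>For adjacent indices the lowered vector is killed by all raising operators, the critical
  one giving \<open>\<mu> i - \<mu> (Suc i) = 0\<close>, and \<phi> vanishes on it, so it is zero by
  \<open>\<phi>_separates\<close>. The other lowering operators of the block are commutators of
  adjacent ones.\<close>

lemma block_low:
  assumes "t < s" "s < m" "\<And>i. t \<le> i \<Longrightarrow> i < s \<Longrightarrow> \<mu> i = \<mu> (Suc i)"
  shows "A s t v0 = 0"
  using assms
proof (induction "s - t" arbitrary: s)
  case 0
  then show ?case by simp
next
  case (Suc k)
  have simp1: "A (Suc i) i v0 = 0" if i: "t \<le> i" "i < s" for i
  proof (rule \<phi>_separates)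
    have im: "i < m" "Suc i < m" using i Suc.prems by auto
    show "A (Suc i) i v0 \<in> U" using U_A im v0_U by simp
    have up: "A a b (A (Suc i) i v0) = 0" if ab: "a < b" "b < m" for a b
    proof -
      have am: "a < m" using ab by simp
      have 1: "A (Suc i) i (A a b v0) = 0" using raise_v0[OF ab] im by (simp add: R_zero)
      have eq: "A a b (A (Suc i) i v0) = (if b = Suc i then A a i v0 else 0) - (if i = a then A (Suc i) b v0 else 0)"
        unfolding R_comm[OF am ab(2) im(2,1)] 1 by simp
      consider "b = Suc i" "a = i" | "b = Suc i" "a < i" | "b \<noteq> Suc i" "a = i" | "b \<noteq> Suc i" "a \<noteq> i"
        using ab by linarith
      then show ?thesis
      proof cases
        case 1
        then show ?thesis unfolding eq using weight_v0 im Suc.prems(3)[OF i] by simp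
      next
        case 2
        then show ?thesis unfolding eq using raise_v0[of a i] im by simp
      next
        case 3
        then have "Suc i < b" using ab by simp
        then show ?thesis unfolding eq using raise_v0[of "Suc i" b] 3 ab by simp
      next
        case 4
        then show ?thesis unfolding eq by simp
      qed
    qed
    fix u assume u: "u \<in> lists Up"
    show "\<phi> (wact u (A (Suc i) i v0)) = 0"
    proof (cases "u = []")
      case True
      then show ?thesis using \<phi>_low[of i "Suc i" v0] im v0_U by simp
    next
      case False
      have "wact u (A (Suc i) i v0) = 0" by (rule Up_word_kills[OF up u False])
      then show ?thesis using \<phi>_add[of 0 0] by simp
    qed
  qed
  show ?case
  proof (cases "s = Suc t")
    case True
    then show ?thesis using simp1[of t] by simp
  next
    case False
    define r where "r = s - 1"
    have r: "s = Suc r" "t < r" "r < m" "t < m" using Suc.prems(1,2) False by (auto simp: r_def)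
    have "A r t v0 = 0" by (rule Suc.hyps(1)) (use Suc.hyps(2) Suc.prems(3) r in auto)
    moreover have "A s r v0 = 0" using simp1[of r] r by simp
    ultimately show ?thesis using R_comm[OF Suc.prems(2) r(3,3,4), of v0] R_zero[OF Suc.prems(2) r(3)] R_zero[OF r(3,4)] r by simp
  qed
qed

end

subsection \<open>The polynomial model\<close>

lemma additive_sum:
  fixes f :: "'a::ab_group_add \<Rightarrow> 'b::ab_group_add"
  assumes "\<And>x y. f (x + y) = f x + f y"
  shows "f (\<Sum>i\<in>S. g i) = (\<Sum>i\<in>S. f (g i))"
proof -
  have "f 0 = 0" using assms[of 0 0] by simp
  then show ?thesis by (induction S rule: infinite_finite_induct) (simp_all add: assms)
qed

context hw_module
begin

text \<open>A function \<open>w\<close> stands for \<open>\<Sum>\<^sub>\<alpha> x\<^sup>\<alpha>/\<alpha>! \<otimes> w \<alpha>\<close>. In these divided powers the derivative is a plain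
  shift and multiplication by a variable needs no case distinction.\<close>

definition D :: "nat \<Rightarrow> (nat multiset \<Rightarrow> 't) \<Rightarrow> nat multiset \<Rightarrow> 't" where
  "D t w = (\<lambda>\<alpha>. w (add_mset t \<alpha>))"

definition X :: "nat \<Rightarrow> (nat multiset \<Rightarrow> 't) \<Rightarrow> nat multiset \<Rightarrow> 't" where
  "X t w = (\<lambda>\<alpha>. sc (of_nat (count \<alpha> t)) (w (\<alpha> - {#t#})))"

definition Ap :: "nat \<Rightarrow> nat \<Rightarrow> (nat multiset \<Rightarrow> 't) \<Rightarrow> nat multiset \<Rightarrow> 't" where
  "Ap s t w = (\<lambda>\<alpha>. A s t (w \<alpha>))"

definition smul :: "complex \<Rightarrow> (nat multiset \<Rightarrow> 't) \<Rightarrow> nat multiset \<Rightarrow> 't" where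
  "smul c w = (\<lambda>\<alpha>. sc c (w \<alpha>))"

definition B :: "nat \<Rightarrow> nat \<Rightarrow> (nat multiset \<Rightarrow> 't) \<Rightarrow> nat multiset \<Rightarrow> 't" where
  "B s t w = Ap s t w - X t (D s w)"

definition H :: "(nat multiset \<Rightarrow> 't) \<Rightarrow> nat multiset \<Rightarrow> 't" where
  "H w = (\<Sum>t<m. X t (D t w))"

text \<open>The formula for \<open>e s\<close> results from moving \<open>E\<^sub>s\<^sub>,\<^sub>m\<^sub>+\<^sub>1\<close> past a monomial. The normalisation of \<open>H\<close> is chosen to extend
  the action to \<open>gl(m+1)\<close>, where the commutation relations are uniform.\<close>

definition e :: "nat \<Rightarrow> (nat multiset \<Rightarrow> 't) \<Rightarrow> nat multiset \<Rightarrow> 't" where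
  "e s w = (\<Sum>t<m. B s t (D t w))"

definition R :: "nat \<Rightarrow> nat \<Rightarrow> (nat multiset \<Rightarrow> 't) \<Rightarrow> nat multiset \<Rightarrow> 't" where
  "R i j w = (if i < m then if j < m then B i j w else e i w
    else if j < m then X j w else H w)"

lemma D_add [simp]: "D t (v + w) = D t v + D t w"
  by (auto simp: D_def fun_eq_iff)

lemma X_add [simp]: "X t (v + w) = X t v + X t w"
  by (auto simp: X_def fun_eq_iff scale_right_distrib)

lemma Ap_add [simp]: "\<lbrakk>s < m; t < m\<rbrakk> \<Longrightarrow> Ap s t (v + w) = Ap s t v + Ap s t w"
  by (auto simp: Ap_def fun_eq_iff R_add)

lemma D_diff [simp]: "D t (v - w) = D t v - D t w"
  by (auto simp: D_def fun_eq_iff)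

lemma X_diff [simp]: "X t (v - w) = X t v - X t w"
  by (auto simp: X_def fun_eq_iff scale_right_diff_distrib)

lemma Ap_diff [simp]: "\<lbrakk>s < m; t < m\<rbrakk> \<Longrightarrow> Ap s t (v - w) = Ap s t v - Ap s t w"
  by (auto simp: Ap_def fun_eq_iff R_diff)

lemma D_zero [simp]: "D t 0 = 0" by (simp add: D_def fun_eq_iff)
lemma X_zero [simp]: "X t 0 = 0" by (simp add: X_def fun_eq_iff)
lemma Ap_zero [simp]: "\<lbrakk>s < m; t < m\<rbrakk> \<Longrightarrow> Ap s t 0 = 0" by (simp add: Ap_def fun_eq_iff R_zero)

lemma B_add [simp]: "\<lbrakk>s < m; t < m\<rbrakk> \<Longrightarrow> B s t (v + w) = B s t v + B s t w"
  by (simp add: B_def)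

lemma B_diff [simp]: "\<lbrakk>s < m; t < m\<rbrakk> \<Longrightarrow> B s t (v - w) = B s t v - B s t w"
  by (simp add: B_def)

lemma B_zero [simp]: "\<lbrakk>s < m; t < m\<rbrakk> \<Longrightarrow> B s t 0 = 0"
  by (simp add: B_def)

lemma H_add [simp]: "H (v + w) = H v + H w"
  by (simp add: H_def sum.distrib)

lemma e_add [simp]: "s < m \<Longrightarrow> e s (v + w) = e s v + e s w"
  by (simp add: e_def sum.distrib)

lemma D_sum: "D t (\<Sum>i\<in>S. g i) = (\<Sum>i\<in>S. D t (g i))" by (rule additive_sum[of "D t"]) simp
lemma X_sum: "X t (\<Sum>i\<in>S. g i) = (\<Sum>i\<in>S. X t (g i))" by (rule additive_sum[of "X t"]) simp
lemma B_sum: "\<lbrakk>s < m; t < m\<rbrakk> \<Longrightarrow> B s t (\<Sum>i\<in>S. g i) = (\<Sum>i\<in>S. B s t (g i))" by (rule additive_sum[of "B s t"]) simp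
lemma H_sum: "H (\<Sum>i\<in>S. g i) = (\<Sum>i\<in>S. H (g i))" by (rule additive_sum[of "H"]) simp

text \<open>The Weyl algebra relation. If \<open>t\<close> is absent from \<open>\<alpha>\<close>,
  the truncated difference \<open>\<alpha> - {#t#}\<close> is harmless because its factor
  \<open>count \<alpha> t\<close> is zero.\<close>

lemma DX: "D s (X t w) = X t (D s w) + (if s = t then w else 0)"
proof
  fix \<alpha>
  show "D s (X t w) \<alpha> = (X t (D s w) + (if s = t then w else 0)) \<alpha>"
  proof (cases "s = t")
    case True
    show ?thesis
    proof (cases "t \<in># \<alpha>")
      case True
      then show ?thesis using \<open>s = t\<close> by (simp add: D_def X_def scale_left_distrib add.commute)
    next
      case False
      then show ?thesis using \<open>s = t\<close> by (simp add: D_def X_def not_in_iff)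
    qed
  next
    case False
    show ?thesis
    proof (cases "t \<in># \<alpha>")
      case True
      then show ?thesis using False by (simp add: D_def X_def diff_add_mset_swap)
    next
      case False
      then show ?thesis using \<open>s \<noteq> t\<close> by (simp add: D_def X_def not_in_iff)
    qed
  qed
qed

lemma XX: "X s (X t w) = X t (X s w)"
proof (cases "s = t")
  case False
  show ?thesis
  proof
    fix \<alpha>
    have "\<alpha> - {#s#} - {#t#} = \<alpha> - {#t#} - {#s#}" by (simp add: diff_diff_add_mset add.commute)
    then show "X s (X t w) \<alpha> = X t (X s w) \<alpha>" using False by (simp add: X_def mult.commute)
  qed
qed simp

lemma DD: "D s (D t w) = D t (D s w)"
  by (simp add: D_def add_mset_commute)

lemma Ap_X: "\<lbrakk>s < m; t < m\<rbrakk> \<Longrightarrow> Ap s t (X r w) = X r (Ap s t w)"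
  by (simp add: Ap_def X_def A_scale)

lemma Ap_D: "Ap s t (D r w) = D r (Ap s t w)"
  by (simp add: Ap_def D_def)

lemma Ap_comm: "\<lbrakk>s < m; t < m; u < m; v < m\<rbrakk> \<Longrightarrow>
   Ap s t (Ap u v w) = Ap u v (Ap s t w) + (if t = u then Ap s v w else 0) - (if v = s then Ap u t w else 0)"
  using R_comm[of s t u v "w _"] by (intro ext) (simp add: Ap_def)

lemma B_D: "\<lbrakk>s < m; t < m\<rbrakk> \<Longrightarrow> B s t (D r w) = D r (B s t w) + (if t = r then D s w else 0)"
  by (simp add: B_def Ap_D DX DD)

lemma B_X: "\<lbrakk>s < m; t < m\<rbrakk> \<Longrightarrow> B s t (X r w) = X r (B s t w) - (if s = r then X t w else 0)"
  by (simp add: B_def Ap_X DX XX)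

text \<open>The operators \<open>Ap s t\<close> and \<open>- X t (D s _)\<close> are two
  representations of \<open>gl(m)\<close> that commute with each other, so their sum is a
  representation: the tensor product of the inducing module with the polynomials.\<close>

lemma BB: assumes "s < m" "t < m" "u < m" "v < m"
  shows "B s t (B u v w) = B u v (B s t w) + (if t = u then B s v w else 0) - (if v = s then B u t w else 0)"
proof -
  have 1: "B s t (B u v w) = Ap s t (Ap u v w) - X v (D u (Ap s t w)) - X t (D s (Ap u v w))
      + X t (X v (D s (D u w))) + (if s = v then X t (D u w) else 0)" (is "?l s t u v = ?r s t u v") if "s < m" "t < m" "u < m" "v < m" for s t u v
    using that by (simp add: B_def Ap_X Ap_D DX algebra_simps)
  show ?thesis
    unfolding 1[OF assms] 1[OF assms(3,4,1,2)] Ap_comm[OF assms]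
    by (auto simp: B_def XX[of v t] DD[of u s] algebra_simps)
qed

lemma H_D: "s < m \<Longrightarrow> D s (H w) = H (D s w) + D s w"
  by (simp add: H_def D_sum DX sum.distrib DD[of s] if_distrib[of "\<lambda>x. X _ x"] cong: if_cong)

lemma X_H: "s < m \<Longrightarrow> H (X s w) = X s (H w) + X s w"
  by (simp add: H_def X_sum DX sum.distrib XX[of s] if_distrib[of "\<lambda>x. X _ x"] cong: if_cong)

lemma B_H: "\<lbrakk>s < m; t < m\<rbrakk> \<Longrightarrow> B s t (H w) = H (B s t w)"
  unfolding H_def by (simp add: B_sum B_X DX B_D sum.distrib sum_subtractf if_distrib[of "\<lambda>x. X _ x"] cong: if_cong)

text \<open>The family \<open>e\<close> transforms like a row of matrix units. Commuting past
  \<open>B u v\<close> and past \<open>D v\<close> yields two terms \<open>B u t (D s w)\<close> of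
  opposite sign.\<close>

lemma B_e: assumes "s < m" "t < m" "u < m"
  shows "B s t (e u w) = e u (B s t w) + (if t = u then e s w else 0)"
proof -
  have "B s t (B u v (D v w)) = B u v (D v (B s t w)) + (if t = u then B s v (D v w) else 0)
     - (if v = s then B u t (D v w) else 0) + (if t = v then B u v (D s w) else 0)" if "v < m" for v
    using assms that BB[of s t u v "D v w"] by (simp add: B_D[of s t])
  then have "B s t (e u w) = (\<Sum>v<m. B u v (D v (B s t w)) + (if t = u then B s v (D v w) else 0)
     - (if v = s then B u t (D v w) else 0) + (if t = v then B u v (D s w) else 0))"
    unfolding e_def B_sum[OF assms(1,2)] by (intro sum.cong) auto
  also have "\<dots> = e u (B s t w) + (if t = u then e s w else 0)"
    using assms by (simp add: sum.distrib sum_subtractf e_def)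
  finally show ?thesis .
qed

lemma e_X: assumes "s < m" "v < m"
  shows "e s (X v w) = X v (e s w) + B s v w - (if v = s then H w else 0)"
proof -
  have "B s t (D t (X v w)) = X v (B s t (D t w)) + (if t = v then B s v w else 0) - (if v = s then X t (D t w) else 0)"
    if "t < m" for t using assms that by (auto simp: DX B_X)
  then have "e s (X v w) = (\<Sum>t<m. X v (B s t (D t w)) + (if t = v then B s v w else 0) - (if v = s then X t (D t w) else 0))"
    unfolding e_def by (intro sum.cong) auto
  also have "\<dots> = X v (e s w) + B s v w - (if v = s then H w else 0)"
    using assms by (simp add: sum.distrib sum_subtractf e_def X_sum H_def)
  finally show ?thesis .
qed

lemma e_H: assumes "s < m" shows "e s (H w) = H (e s w) + e s w"
proof -
  have "B s t (D t (H w)) = H (B s t (D t w)) + B s t (D t w)" if "t < m" for t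
    using assms that by (simp add: H_D B_H)
  then show ?thesis unfolding e_def by (simp add: H_sum sum.distrib)
qed

text \<open>Bringing the derivatives inside creates, besides the double sum, a single correction
  sum. By \<open>BB\<close> the double sums for the two orders differ by two single sums, and these
  are exactly the corrections.\<close>

lemma ee: assumes s: "s < m" and u: "u < m" shows "e s (e u w) = e u (e s w)"
proof -
  have exp: "e s (e u w) = (\<Sum>t<m. \<Sum>v<m. B s t (B u v (D t (D v w)))) - (\<Sum>t<m. B s t (D u (D t w)))"
    if s: "s < m" and u: "u < m" for s u
  proof -
    have "B s t (D t (e u w)) = (\<Sum>v<m. B s t (B u v (D t (D v w)))) - B s t (D u (D t w))" if t: "t < m" for t
    proof -
      have "D t (e u w) = (\<Sum>v<m. B u v (D t (D v w)) - (if v = t then D u (D v w) else 0))"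
        unfolding e_def D_sum using u by (intro sum.cong) (auto simp: B_D)
      also have "\<dots> = (\<Sum>v<m. B u v (D t (D v w))) - D u (D t w)"
        using t by (simp add: sum_subtractf)
      finally show ?thesis using s t by (simp add: B_sum)
    qed
    then show ?thesis unfolding e_def[of s] by (simp add: sum_subtractf)
  qed
  have "(\<Sum>t<m. \<Sum>v<m. B s t (B u v (D t (D v w)))) - (\<Sum>t<m. \<Sum>v<m. B u v (B s t (D t (D v w))))
     = (\<Sum>t<m. \<Sum>v<m. (if t = u then B s v (D t (D v w)) else 0) - (if v = s then B u t (D t (D v w)) else 0))"
    unfolding sum_subtractf[symmetric] using s u by (intro sum.cong refl) (simp add: BB[of s _ u])
  also have "\<dots> = (\<Sum>v<m. B s v (D u (D v w))) - (\<Sum>t<m. B u t (D t (D s w)))"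
  proof -
    have "(\<Sum>t<m. \<Sum>v<m. if t = u then B s v (D t (D v w)) else 0) = (\<Sum>v<m. B s v (D u (D v w)))"
      using u by (subst sum.swap) (simp add: sum.delta)
    then show ?thesis using s by (simp add: sum_subtractf)
  qed
  finally have 1: "(\<Sum>t<m. \<Sum>v<m. B s t (B u v (D t (D v w)))) - (\<Sum>t<m. \<Sum>v<m. B u v (B s t (D t (D v w))))
    = (\<Sum>v<m. B s v (D u (D v w))) - (\<Sum>t<m. B u t (D s (D t w)))" by (simp add: DD[of s])
  have "(\<Sum>t<m. \<Sum>v<m. B u v (B s t (D t (D v w)))) = (\<Sum>v<m. \<Sum>t<m. B u v (B s t (D v (D t w))))"
    by (subst sum.swap) (simp add: DD)
  with 1 show ?thesis unfolding exp[OF s u] exp[OF u s] by (simp add: algebra_simps)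
qed

sublocale M: gl_rep "Suc m" R
proof
  fix i j k l and x y :: "nat multiset \<Rightarrow> 't"
  assume ij: "i < Suc m" "j < Suc m"
  show "R i j (x + y) = R i j x + R i j y" using ij by (auto simp: R_def)
  assume kl: "k < Suc m" "l < Suc m"
  consider "i < m" "j < m" | "i < m" "j = m" | "i = m" "j < m" | "i = m" "j = m" using ij by linarith
  then show "R i j (R k l x) = R k l (R i j x) + (if j = k then R i l x else 0) - (if l = i then R k j x else 0)"
  proof cases
    case 1
    consider "k < m" "l < m" | "k < m" "l = m" | "k = m" "l < m" | "k = m" "l = m" using kl by linarith
    then show ?thesis
      using 1 BB[of i j k l x] B_e[of i j k x] B_X[of i j l x] B_H[of i j x] by cases (simp_all add: R_def)
  next
    case 2
    consider "k < m" "l < m" | "k < m" "l = m" | "k = m" "l < m" | "k = m" "l = m" using kl by linarith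
    then show ?thesis
      using 2 B_e[of k l i x] ee[of i k x] e_X[of i l x] e_H[of i x] by cases (simp_all add: R_def)
  next
    case 3
    consider "k < m" "l < m" | "k < m" "l = m" | "k = m" "l < m" | "k = m" "l = m" using kl by linarith
    then show ?thesis
      using 3 B_X[of k l j x] e_X[of k j x] XX[of j l x] X_H[of j x] by cases (simp_all add: R_def)
  next
    case 4
    consider "k < m" "l < m" | "k < m" "l = m" | "k = m" "l < m" | "k = m" "l = m" using kl by linarith
    then show ?thesis
      using 4 B_H[of k l x] e_H[of k x] X_H[of l x] by cases (simp_all add: R_def)
  qed
qed

end

section \<open>Submodules of the polynomial model\<close>

context hw_module
begin

text \<open>The operators are total on functions of multisets; this subset is the actual space of
  polynomials in m variables with coefficients in \<open>U\<close>.\<close>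

definition Mset :: "(nat multiset \<Rightarrow> 't) set" where
  "Mset = {w. finite {\<alpha>. w \<alpha> \<noteq> 0} \<and> (\<forall>\<alpha>. w \<alpha> \<in> U \<and> (w \<alpha> \<noteq> 0 \<longrightarrow> set_mset \<alpha> \<subseteq> {..<m}))}"

definition \<iota> :: "'t \<Rightarrow> nat multiset \<Rightarrow> 't" where
  "\<iota> u = (\<lambda>\<alpha>. if \<alpha> = {#} then u else 0)"

text \<open>The operators \<open>R\<close> represent \<open>gl(m+1)\<close>, whereas the induced
  module belongs to \<open>sl(m+1)\<close>: hence only differences of diagonal units occur.\<close>

definition submod :: "(nat multiset \<Rightarrow> 't) set \<Rightarrow> bool" where
  "submod W \<longleftrightarrow> W \<subseteq> Mset \<and> 0 \<in> W \<and> (\<forall>x\<in>W. \<forall>y\<in>W. x + y \<in> W) \<and> (\<forall>c. \<forall>x\<in>W. smul c x \<in> W) \<and>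
     (\<forall>x\<in>W. \<forall>i<Suc m. \<forall>j<Suc m. i \<noteq> j \<longrightarrow> R i j x \<in> W) \<and> (\<forall>x\<in>W. \<forall>i<m. R i i x - R m m x \<in> W)"

lemma U_zero: "0 \<in> U" and U_add: "x \<in> U \<Longrightarrow> y \<in> U \<Longrightarrow> x + y \<in> U"
  and U_scale: "x \<in> U \<Longrightarrow> sc c x \<in> U"
  using U_subspace by (auto simp: subspace_def)

lemma MsetI:
  assumes "finite S" "\<And>\<alpha>. w \<alpha> \<noteq> 0 \<Longrightarrow> \<alpha> \<in> S" "\<And>\<alpha>. w \<alpha> \<in> U" "\<And>\<alpha>. w \<alpha> \<noteq> 0 \<Longrightarrow> set_mset \<alpha> \<subseteq> {..<m}"
  shows "w \<in> Mset"
  unfolding Mset_def using assms by (auto intro: finite_subset[of _ S])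

lemma Mset_zero: "0 \<in> Mset"
  by (auto simp: Mset_def U_zero)

lemma Mset_add: assumes "v \<in> Mset" "w \<in> Mset" shows "v + w \<in> Mset"
proof (rule MsetI)
  show "finite ({\<alpha>. v \<alpha> \<noteq> 0} \<union> {\<alpha>. w \<alpha> \<noteq> 0})" using assms by (auto simp: Mset_def)
  fix \<alpha> assume nz: "(v + w) \<alpha> \<noteq> 0"
  then have "v \<alpha> \<noteq> 0 \<or> w \<alpha> \<noteq> 0" by auto
  then show "\<alpha> \<in> {\<alpha>. v \<alpha> \<noteq> 0} \<union> {\<alpha>. w \<alpha> \<noteq> 0}" "set_mset \<alpha> \<subseteq> {..<m}"
    using assms unfolding Mset_def by blast+
qed (use assms in \<open>auto simp: Mset_def U_add\<close>)

lemma Mset_smul: assumes "w \<in> Mset" shows "smul c w \<in> Mset"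
proof (rule MsetI)
  show "finite {\<alpha>. w \<alpha> \<noteq> 0}" using assms by (auto simp: Mset_def)
  fix \<alpha> assume "smul c w \<alpha> \<noteq> 0"
  then have "w \<alpha> \<noteq> 0" by (auto simp: smul_def)
  then show "\<alpha> \<in> {\<alpha>. w \<alpha> \<noteq> 0}" "set_mset \<alpha> \<subseteq> {..<m}" using assms unfolding Mset_def by blast+
qed (use assms in \<open>auto simp: Mset_def smul_def U_scale\<close>)

lemma smul_minus_one: "smul (- 1) w = - w"
  by (auto simp: smul_def fun_eq_iff)

lemma Mset_minus: "w \<in> Mset \<Longrightarrow> - w \<in> Mset"
  using Mset_smul[of w "- 1"] by (simp add: smul_minus_one)

lemma Mset_diff: "v \<in> Mset \<Longrightarrow> w \<in> Mset \<Longrightarrow> v - w \<in> Mset"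
  using Mset_add[of v "- w"] Mset_minus by simp

lemma Mset_sum: "(\<And>i. i \<in> S \<Longrightarrow> g i \<in> Mset) \<Longrightarrow> sum g S \<in> Mset"
  by (induction S rule: infinite_finite_induct) (auto simp: Mset_zero Mset_add)

lemma Mset_D: assumes "w \<in> Mset" shows "D t w \<in> Mset"
proof (rule MsetI)
  have "finite {\<alpha>. w \<alpha> \<noteq> 0}" using assms by (auto simp: Mset_def)
  then show "finite ((\<lambda>\<alpha>. \<alpha> - {#t#}) ` {\<alpha>. w \<alpha> \<noteq> 0})" by simp
  fix \<alpha> assume "D t w \<alpha> \<noteq> 0"
  then have nz: "w (add_mset t \<alpha>) \<noteq> 0" by (simp add: D_def)
  then show "\<alpha> \<in> (\<lambda>\<alpha>. \<alpha> - {#t#}) ` {\<alpha>. w \<alpha> \<noteq> 0}" by (auto intro!: image_eqI[of _ _ "add_mset t \<alpha>"])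
  have "set_mset (add_mset t \<alpha>) \<subseteq> {..<m}" using nz assms unfolding Mset_def by blast
  then show "set_mset \<alpha> \<subseteq> {..<m}" by simp
qed (use assms in \<open>auto simp: Mset_def D_def\<close>)

lemma Mset_X: assumes "w \<in> Mset" "t < m" shows "X t w \<in> Mset"
proof (rule MsetI)
  have "finite {\<alpha>. w \<alpha> \<noteq> 0}" using assms by (auto simp: Mset_def)
  then show "finite (add_mset t ` {\<alpha>. w \<alpha> \<noteq> 0})" by simp
  fix \<alpha> assume "X t w \<alpha> \<noteq> 0"
  then have nz: "t \<in># \<alpha>" "w (\<alpha> - {#t#}) \<noteq> 0" by (auto simp: X_def count_eq_zero_iff)
  have a: "add_mset t (\<alpha> - {#t#}) = \<alpha>" using nz by simp
  show "\<alpha> \<in> add_mset t ` {\<alpha>. w \<alpha> \<noteq> 0}" using nz a by (auto intro!: image_eqI[of _ _ "\<alpha> - {#t#}"])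
  have "set_mset (\<alpha> - {#t#}) \<subseteq> {..<m}" using nz assms unfolding Mset_def by blast
  then have "set_mset (add_mset t (\<alpha> - {#t#})) \<subseteq> {..<m}" using assms(2) by simp
  then show "set_mset \<alpha> \<subseteq> {..<m}" unfolding a .
qed (use assms in \<open>auto simp: Mset_def X_def U_scale\<close>)

lemma Mset_Ap: assumes "w \<in> Mset" "s < m" "t < m" shows "Ap s t w \<in> Mset"
proof (rule MsetI)
  show "finite {\<alpha>. w \<alpha> \<noteq> 0}" using assms by (auto simp: Mset_def)
  fix \<alpha> assume "Ap s t w \<alpha> \<noteq> 0"
  then have "w \<alpha> \<noteq> 0" using R_zero assms by (auto simp: Ap_def)
  then show "\<alpha> \<in> {\<alpha>. w \<alpha> \<noteq> 0}" "set_mset \<alpha> \<subseteq> {..<m}" using assms unfolding Mset_def by blast+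
qed (use assms in \<open>auto simp: Mset_def Ap_def U_A\<close>)

lemma Mset_B: "w \<in> Mset \<Longrightarrow> s < m \<Longrightarrow> t < m \<Longrightarrow> B s t w \<in> Mset"
  by (simp add: B_def Mset_diff Mset_Ap Mset_X Mset_D)

lemma Mset_R: "w \<in> Mset \<Longrightarrow> i < Suc m \<Longrightarrow> j < Suc m \<Longrightarrow> R i j w \<in> Mset"
  by (auto simp: R_def Mset_B Mset_X e_def H_def Mset_D intro!: Mset_sum)

lemma smul_add: "smul c (v + w) = smul c v + smul c w"
  by (auto simp: smul_def fun_eq_iff scale_right_distrib)

lemma D_smul: "D t (smul c w) = smul c (D t w)" by (simp add: D_def smul_def)
lemma X_smul: "X t (smul c w) = smul c (X t w)" by (simp add: X_def smul_def mult.commute)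
lemma B_smul: "s < m \<Longrightarrow> t < m \<Longrightarrow> B s t (smul c w) = smul c (B s t w)"
  by (simp add: B_def X_smul D_smul) (simp add: Ap_def smul_def fun_eq_iff A_scale scale_right_diff_distrib)

lemma smul_sum: "smul c (\<Sum>i\<in>S. g i) = (\<Sum>i\<in>S. smul c (g i))"
  by (rule additive_sum[of "smul c"]) (rule smul_add)

lemma R_smul: "i < Suc m \<Longrightarrow> j < Suc m \<Longrightarrow> R i j (smul c w) = smul c (R i j w)"
  by (auto simp: R_def B_smul X_smul e_def H_def D_smul smul_sum)

lemma \<iota>_Mset: "u \<in> U \<Longrightarrow> \<iota> u \<in> Mset"
  by (rule MsetI[of "{{#}}"]) (auto simp: \<iota>_def U_zero split: if_splits)

lemma \<iota>_add: "\<iota> (u + v) = \<iota> u + \<iota> v" by (auto simp: \<iota>_def)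
lemma \<iota>_scale: "\<iota> (sc c u) = smul c (\<iota> u)" by (auto simp: \<iota>_def smul_def)
lemma \<iota>_zero: "\<iota> 0 = 0" by (auto simp: \<iota>_def)

lemma D_\<iota>: "D t (\<iota> u) = 0" by (auto simp: D_def \<iota>_def)

lemma B_\<iota>: "s < m \<Longrightarrow> t < m \<Longrightarrow> B s t (\<iota> u) = \<iota> (A s t u)"
  by (simp add: B_def D_\<iota>) (auto simp: Ap_def \<iota>_def R_zero)

lemma e_\<iota>: "s < m \<Longrightarrow> e s (\<iota> u) = 0" by (simp add: e_def D_\<iota>)
lemma H_\<iota>: "H (\<iota> u) = 0" by (simp add: H_def D_\<iota>)

lemma Mset_generated:
  assumes "\<And>x y. x \<in> W \<Longrightarrow> y \<in> W \<Longrightarrow> x + y \<in> W" "\<And>u. u \<in> U \<Longrightarrow> \<iota> u \<in> W"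
    and "\<And>t w. t < m \<Longrightarrow> w \<in> W \<Longrightarrow> X t w \<in> W"
  shows "Mset \<subseteq> W"
proof
  let ?d = "\<lambda>\<alpha> u. (\<lambda>\<beta>. if \<beta> = \<alpha> then u else 0)"
  have d: "?d \<alpha> u \<in> W" if "set_mset \<alpha> \<subseteq> {..<m}" "u \<in> U" for \<alpha> u
    using that
  proof (induction \<alpha> arbitrary: u)
    case empty
    then show ?case using assms(2)[of u] by (simp add: \<iota>_def)
  next
    case (add t \<alpha>)
    \<comment> \<open>Multiplication by a variable multiplies the divided power at
      \<open>\<alpha>\<close> by \<open>count \<alpha> t + 1\<close>; the factor is divided out
      beforehand.\<close>
    let ?v = "sc (1 / of_nat (Suc (count \<alpha> t))) u"
    have "?d \<alpha> ?v \<in> W" using add by (simp add: U_scale)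
    then have "X t (?d \<alpha> ?v) \<in> W" using assms(3) add.prems by simp
    moreover have "X t (?d \<alpha> ?v) = ?d (add_mset t \<alpha>) u"
    proof
      fix \<beta>
      show "X t (?d \<alpha> ?v) \<beta> = ?d (add_mset t \<alpha>) u \<beta>"
      proof (cases "t \<in># \<beta>")
        case True
        then obtain \<gamma> where \<gamma>: "\<beta> = add_mset t \<gamma>" by (metis insert_DiffM)
        have "of_nat (Suc (count \<alpha> t)) \<noteq> (0::complex)" by (simp del: of_nat_Suc)
        then show ?thesis unfolding \<gamma> X_def by (simp del: of_nat_Suc)
      next
        case False
        then show ?thesis by (auto simp: X_def not_in_iff)
      qed
    qed
    ultimately show ?case by simp
  qed
  fix w assume w: "w \<in> Mset"
  have S: "finite S \<Longrightarrow> (\<lambda>\<beta>. if \<beta> \<in> S then w \<beta> else 0) \<in> W" for S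
  proof (induction S rule: finite_induct)
    case empty
    then show ?case using assms(2)[OF U_zero] by (simp add: \<iota>_zero zero_fun_def)
  next
    case (insert \<alpha> S)
    have "?d \<alpha> (w \<alpha>) \<in> W"
    proof (cases "w \<alpha> = 0")
      case True
      then show ?thesis using assms(2)[OF U_zero] by (simp add: \<iota>_zero zero_fun_def cong: if_cong)
    next
      case False
      then show ?thesis using d w by (auto simp: Mset_def)
    qed
    then have "(\<lambda>\<beta>. if \<beta> \<in> S then w \<beta> else 0) + ?d \<alpha> (w \<alpha>) \<in> W" using insert assms(1) by blast
    moreover have "(\<lambda>\<beta>. if \<beta> \<in> S then w \<beta> else 0) + ?d \<alpha> (w \<alpha>) = (\<lambda>\<beta>. if \<beta> \<in> insert \<alpha> S then w \<beta> else 0)"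
      using insert by (auto simp: fun_eq_iff)
    ultimately show ?case by simp
  qed
  have eq: "(\<lambda>\<beta>. if \<beta> \<in> {\<alpha>. w \<alpha> \<noteq> 0} then w \<beta> else 0) = w" by auto
  have "finite {\<alpha>. w \<alpha> \<noteq> 0}" using w by (simp add: Mset_def)
  from S[OF this] show "w \<in> W" unfolding eq .
qed

text \<open>On constants \<open>H\<close> vanishes, so the Levi part acts there as on
  \<open>U\<close> and generates all constants from \<open>v0\<close>. The operators
  \<open>X t\<close> then generate all polynomials.\<close>

lemma submod_full:
  assumes W: "submod W" and v0: "\<iota> v0 \<in> W"
  shows "W = Mset"
proof
  show "W \<subseteq> Mset" using W by (simp add: submod_def)
  have "{u \<in> U. \<iota> u \<in> W} = U"
  proof (rule generated)
    show "subspace {u \<in> U. \<iota> u \<in> W}"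
      using W unfolding submod_def subspace_def by (auto simp: U_zero U_add U_scale \<iota>_add \<iota>_scale \<iota>_zero)
    show "v0 \<in> {u \<in> U. \<iota> u \<in> W}" using v0 v0_U by simp
    fix i j u assume ij: "i < m" "j < m" and u: "u \<in> {u \<in> U. \<iota> u \<in> W}"
    have "\<iota> (A i j u) \<in> W"
    proof (cases "i = j")
      case True
      have "R i i (\<iota> u) - R m m (\<iota> u) \<in> W" using W u ij by (simp add: submod_def)
      then show ?thesis using True ij by (simp add: R_def B_\<iota> H_\<iota>)
    next
      case False
      have "R i j (\<iota> u) \<in> W" using W u ij False by (simp add: submod_def)
      then show ?thesis using ij by (simp add: R_def B_\<iota>)
    qed
    then show "A i j u \<in> {u \<in> U. \<iota> u \<in> W}" using u ij U_A by simp
  qed auto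
  then have \<iota>: "\<iota> u \<in> W" if "u \<in> U" for u using that by blast
  show "Mset \<subseteq> W"
  proof (rule Mset_generated)
    fix t w assume t: "t < m" and w: "w \<in> W"
    then have "R m t w \<in> W" using W by (simp add: submod_def)
    then show "X t w \<in> W" using t by (simp add: R_def)
  qed (use W \<iota> in \<open>auto simp: submod_def\<close>)
qed

lemma raise_\<iota>_v0: "i < j \<Longrightarrow> j < Suc m \<Longrightarrow> R i j (\<iota> v0) = 0"
  by (cases "j = m") (auto simp: R_def e_\<iota> B_\<iota> raise_v0 \<iota>_zero)

lemma nilp_smul: "M.nilp a w \<Longrightarrow> M.nilp a (smul c w)"
proof (induction a arbitrary: w)
  case 0
  then show ?case by (simp add: smul_def fun_eq_iff)
qed (auto simp: R_smul)

text \<open>By \<open>nilp_R\<close> the locally nilpotent vectors form a submodule, and it contains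
  the generator \<open>\<iota> v0\<close>.\<close>

lemma Mset_nilp:
  assumes "w \<in> Mset" shows "\<exists>a. M.nilp a w"
proof -
  let ?W = "{w \<in> Mset. \<exists>a. M.nilp a w}"
  have R: "R i j w \<in> ?W" if "w \<in> ?W" "i < Suc m" "j < Suc m" for w i j
    using that M.nilp_R Mset_R by blast
  have add: "x + y \<in> ?W" if x: "x \<in> ?W" and y: "y \<in> ?W" for x y
  proof -
    obtain a where "M.nilp a x" using x by blast
    moreover obtain b where "M.nilp b y" using y by blast
    ultimately have "M.nilp (max a b) (x + y)"
      using M.nilp_add M.nilp_mono by (meson max.cobounded1 max.cobounded2)
    then show ?thesis using x y Mset_add by blast
  qed
  have minus: "- x \<in> ?W" if "x \<in> ?W" for x using that M.nilp_minus Mset_minus by blast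
  have "submod ?W" unfolding submod_def
  proof (intro conjI ballI allI impI)
    show "0 \<in> ?W" using Mset_zero M.nilp_zero by blast
    fix x assume x: "x \<in> ?W"
    show "smul c x \<in> ?W" for c using x nilp_smul Mset_smul by blast
    show "R i i x - R m m x \<in> ?W" if "i < m" for i
      using add[OF R[OF x, of i i] minus[OF R[OF x, of m m]]] that by simp
  qed (use add R in auto)
  moreover have "M.nilp (Suc 0) (\<iota> v0)" by (simp add: raise_\<iota>_v0)
  then have "\<iota> v0 \<in> ?W" using \<iota>_Mset v0_U by blast
  ultimately have "?W = Mset" by (rule submod_full)
  with assms show ?thesis by blast
qed

lemma size_eq_sum: "set_mset \<alpha> \<subseteq> {..<m} \<Longrightarrow> (\<Sum>t<m. count \<alpha> t) = size \<alpha>"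
  unfolding size_multiset_overloaded_eq
  by (rule sum.mono_neutral_right) (auto simp: count_eq_zero_iff)

lemma B_apply: "B s t w \<alpha> = A s t (w \<alpha>) - sc (of_nat (count \<alpha> t)) (w (add_mset s (\<alpha> - {#t#})))"
  by (simp add: B_def Ap_def X_def D_def)

lemma e_apply: "e s w \<alpha> = (\<Sum>t<m. A s t (w (add_mset t \<alpha>)) - sc (of_nat (count \<alpha> t)) (w (add_mset s \<alpha>)))"
proof -
  have "B s t (D t w) \<alpha> = A s t (w (add_mset t \<alpha>)) - sc (of_nat (count \<alpha> t)) (w (add_mset s \<alpha>))" for t
  proof (cases "t \<in># \<alpha>")
    case True
    then have "add_mset t (add_mset s (\<alpha> - {#t#})) = add_mset s \<alpha>" by (metis add_mset_commute insert_DiffM)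
    then show ?thesis by (simp only: B_apply D_def)
  next
    case False
    then show ?thesis by (simp add: B_apply D_def not_in_iff)
  qed
  moreover have "(\<Sum>t\<in>S. g t) \<alpha> = (\<Sum>t\<in>S. g t \<alpha>)" for g :: "nat \<Rightarrow> nat multiset \<Rightarrow> 't" and S
    by (induction S rule: infinite_finite_induct) auto
  ultimately show ?thesis by (simp add: e_def)
qed

subsection \<open>Leading coefficients of a singular vector\<close>

definition highest :: "(nat multiset \<Rightarrow> 't) \<Rightarrow> bool" where
  "highest w \<longleftrightarrow> (\<forall>i j. i < j \<and> j < Suc m \<longrightarrow> R i j w = 0)"

text \<open>The equation for a raising operator of the Levi part, read at one coefficient: acting on
  that coefficient replaces a variable \<open>t\<close> by \<open>s\<close> in its index. All
  further statements on singular vectors use this exchange.\<close>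

lemma highest_A:
  assumes "highest w" "s < t" "t < m"
  shows "A s t (w \<alpha>) = sc (of_nat (count \<alpha> t)) (w (add_mset s (\<alpha> - {#t#})))"
proof -
  have "B s t w \<alpha> = 0" using assms by (auto simp: R_def highest_def split: if_splits)
  then show ?thesis by (simp add: B_apply)
qed

lemma \<phi>_zero: "\<phi> 0 = 0" using \<phi>_add[of 0 0] by simp
lemma \<phi>_diff: "\<phi> (x - y) = \<phi> x - \<phi> y" using \<phi>_add[of "x - y" y] by simp
lemma \<phi>_sum: "\<phi> (\<Sum>i\<in>S. g i) = (\<Sum>i\<in>S. \<phi> (g i))"
  by (induction S rule: infinite_finite_induct) (simp_all add: \<phi>_zero \<phi>_add)

text \<open>By \<open>highest_A\<close> a raising word applied to a coefficient is a multiple of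
  another coefficient, on which \<phi> vanishes by assumption; then \<open>\<phi>_separates\<close>
  applies to each coefficient.\<close>

lemma highest_zero:
  assumes hw: "highest w" and w: "w \<in> Mset" and \<phi>: "\<And>\<alpha>. \<phi> (w \<alpha>) = 0"
  shows "w = 0"
proof
  fix \<alpha>
  have "u \<in> lists Up \<Longrightarrow> \<phi> (wact u (w \<alpha>)) = 0" for u \<alpha>
  proof (induction u arbitrary: \<alpha> rule: rev_induct)
    case Nil
    then show ?case using \<phi> by simp
  next
    case (snoc ij u)
    then obtain i j where ij: "ij = (i, j)" "i < j" "j < m" "u \<in> lists Up" by (cases ij) (auto simp: Up_def)
    have "wact (u @ [ij]) (w \<alpha>) = wact u (sc (of_nat (count \<alpha> j)) (w (add_mset i (\<alpha> - {#j#}))))"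
      using highest_A[OF hw ij(2,3), of \<alpha>] ij by simp
    also have "\<dots> = sc (of_nat (count \<alpha> j)) (wact u (w (add_mset i (\<alpha> - {#j#}))))"
      by (rule wact_scale) (rule Up_lists[OF ij(4)])
    finally show ?case using snoc.IH[OF ij(4)] by (simp add: \<phi>_scale)
  qed
  then show "w \<alpha> = 0 \<alpha>" using \<phi>_separates[of "w \<alpha>"] w by (simp add: Mset_def)
qed

text \<open>\<phi> is applied to the coefficient at \<open>\<alpha>\<close> of
  \<open>e s w = 0\<close>. The operator part vanishes for \<open>t < s\<close>, gives
  \<open>\<mu> s\<close> for \<open>t = s\<close>, and for \<open>s < t\<close> becomes by
  \<open>highest_A\<close> the factor \<open>count \<alpha> t + 1\<close>, of which 1 is left after
  subtraction.\<close>

lemma highest_coeff: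
  assumes hw: "highest w" and w: "w \<in> Mset" and s: "s < m"
  shows "(\<mu> s + (\<Sum>t<m. if s < t then 1 else - of_nat (count \<alpha> t))) * \<phi> (w (add_mset s \<alpha>)) = 0"
proof -
  have U: "w \<beta> \<in> U" for \<beta> using w by (simp add: Mset_def)
  have "\<phi> (A s t (w (add_mset t \<alpha>)) - sc (of_nat (count \<alpha> t)) (w (add_mset s \<alpha>)))
     = ((if t = s then \<mu> s else 0) + (if s < t then 1 else - of_nat (count \<alpha> t))) * \<phi> (w (add_mset s \<alpha>))" if t: "t < m" for t
  proof -
    consider "t < s" | "t = s" | "s < t" by linarith
    then show ?thesis
    proof cases
      case 1
      then show ?thesis using \<phi>_low[OF 1 s U] by (simp add: \<phi>_diff \<phi>_scale)
    next
      case 2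
      then show ?thesis using \<phi>_diag[OF s U] by (simp add: \<phi>_diff \<phi>_scale algebra_simps)
    next
      case 3
      show ?thesis unfolding highest_A[OF hw 3 t] using 3 by (simp add: \<phi>_diff \<phi>_scale algebra_simps)
    qed
  qed
  then have "\<phi> (e s w \<alpha>) = (\<Sum>t<m. ((if t = s then \<mu> s else 0) + (if s < t then 1 else - of_nat (count \<alpha> t))) * \<phi> (w (add_mset s \<alpha>)))"
    unfolding e_apply \<phi>_sum by (intro sum.cong) auto
  also have "\<dots> = (\<mu> s + (\<Sum>t<m. if s < t then 1 else - of_nat (count \<alpha> t))) * \<phi> (w (add_mset s \<alpha>))"
    unfolding sum_distrib_right[symmetric] sum.distrib using s by simp
  also have "e s w = 0"
  proof -
    have "R s m w = 0" using hw s by (simp add: highest_def)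
    then show ?thesis using s by (simp add: R_def)
  qed
  finally show ?thesis by (simp add: \<phi>_zero)
qed

text \<open>Iterated \<open>highest_A\<close>: the N variables \<open>Suc i\<close> are exchanged
  for \<open>i\<close> one by one, with factors N, N - 1, down to 1. It links \<phi> at a pure power
  to \<open>\<phi>_pow_vanishes\<close>.\<close>

lemma highest_pow:
  assumes hw: "highest w" and i: "Suc i < m" and "N \<le> k"
  shows "(A i (Suc i) ^^ N) (w (replicate_mset (k - N) i + replicate_mset N (Suc i))) = sc (fact N) (w (replicate_mset k i))"
  using assms(3)
proof (induction N)
  case 0
  then show ?case by simp
next
  case (Suc N)
  have i': "i < m" using i by simp
  have scl: "(A i (Suc i) ^^ N) (sc c x) = sc c ((A i (Suc i) ^^ N) x)" for c x
    by (induction N) (auto simp: A_scale i i')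
  have k: "k - N = Suc (k - Suc N)" using Suc.prems by simp
  have "A i (Suc i) (w (replicate_mset (k - Suc N) i + replicate_mset (Suc N) (Suc i)))
     = sc (of_nat (Suc N)) (w (replicate_mset (k - N) i + replicate_mset N (Suc i)))"
    unfolding highest_A[OF hw lessI i] k by simp
  then show ?case using Suc by (simp only: funpow_Suc_right comp_apply scl) (simp add: mult.commute)
qed

theorem proper_submod_imp:
  assumes W: "submod W" "W \<noteq> {0}" "W \<noteq> Mset"
    and i0: "i0 < m" and b1: "\<And>i. i < i0 \<Longrightarrow> \<mu> i = \<mu> (Suc i)" and b2: "\<And>i. i0 < i \<Longrightarrow> Suc i < m \<Longrightarrow> \<mu> i = \<mu> (Suc i)"
  shows "(\<exists>k\<ge>1. of_nat k = \<mu> (m - 1) + 1) \<or>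
    (i0 \<noteq> m - 1 \<and> (\<exists>k\<ge>1. of_nat k = \<mu> i0 + of_nat (m - i0) \<and> (\<forall>r<k. \<mu> i0 - \<mu> (Suc i0) \<noteq> of_nat r)))"
proof -
  have WM: "W \<subseteq> Mset" and W0: "0 \<in> W" using W(1) by (auto simp: submod_def)
  obtain z where z: "z \<in> W" "z \<noteq> 0" using W(2) W0 by blast
  obtain a where a: "M.nilp a z" using Mset_nilp z WM by blast
  have "R i j w \<in> W" if "i < j" "j < Suc m" "w \<in> W" for i j w
    using W(1) that by (auto simp: submod_def)
  from M.nilp_imp_highest[of W, OF this a z] obtain w where
    w: "w \<in> W" "w \<noteq> 0" and hw: "highest w" unfolding highest_def by blast
  have wM: "w \<in> Mset" using w WM by blast
  have wU: "w \<beta> \<in> U" for \<beta> using wM by (simp add: Mset_def)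
  \<comment> \<open>Otherwise \<open>highest_zero\<close>, applied after subtracting a multiple of
    \<open>\<iota> v0\<close>, makes \<open>w\<close> a multiple of the generator, which contradicts
    properness.\<close>
  have "\<exists>\<alpha>. \<alpha> \<noteq> {#} \<and> \<phi> (w \<alpha>) \<noteq> 0"
  proof (rule ccontr)
    assume only: "\<nexists>\<alpha>. \<alpha> \<noteq> {#} \<and> \<phi> (w \<alpha>) \<noteq> 0"
    define c where "c = \<phi> (w {#})"
    have "w - smul c (\<iota> v0) = 0"
    proof (rule highest_zero)
      have "smul c 0 = 0" by (simp add: smul_def fun_eq_iff)
      then show "highest (w - smul c (\<iota> v0))"
        using hw by (simp add: highest_def M.R_diff R_smul raise_\<iota>_v0)
      show "w - smul c (\<iota> v0) \<in> Mset" using wM by (intro Mset_diff Mset_smul \<iota>_Mset v0_U)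
      show "\<phi> ((w - smul c (\<iota> v0)) \<alpha>) = 0" for \<alpha>
        using only by (cases "\<alpha> = {#}") (auto simp: \<phi>_diff smul_def \<iota>_def \<phi>_scale \<phi>_v0 \<phi>_zero c_def)
    qed
    then have eq: "w = smul c (\<iota> v0)" by simp
    have "c \<noteq> 0" using w(2) eq by (auto simp: smul_def fun_eq_iff)
    then have "\<iota> v0 = smul (1 / c) w" unfolding eq by (simp add: smul_def)
    moreover have "smul (1 / c) w \<in> W" using W(1) w(1) by (auto simp: submod_def)
    ultimately show False using submod_full W by simp
  qed
  then obtain \<alpha> where \<alpha>: "\<alpha> \<noteq> {#}" "\<phi> (w \<alpha>) \<noteq> 0" by blast
  have "w \<alpha> \<noteq> 0" using \<alpha>(2) \<phi>_zero by metis
  then have \<alpha>m: "set_mset \<alpha> \<subseteq> {..<m}" using wM unfolding Mset_def by blast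
  \<comment> \<open>Inside a block the weight difference is 0, so \<phi> kills the image of
    \<open>A i (Suc i)\<close>. Applied to the coefficient with one \<open>i\<close> replaced by
    \<open>Suc i\<close>, this gives a positive multiple of \<phi> of
    \<open>w \<alpha>\<close>.\<close>
  have letters: "i = i0 \<or> i = m - 1" if i: "i \<in># \<alpha>" for i
  proof (rule ccontr)
    assume ne: "\<not> (i = i0 \<or> i = m - 1)"
    have im: "Suc i < m" using i \<alpha>m ne by force
    have "\<mu> i - \<mu> (Suc i) = of_nat 0" using b1[of i] b2[of i] ne im by (cases "i < i0") auto
    from \<phi>_pow_vanishes[OF im this wU]
    have "\<phi> (A i (Suc i) (w (add_mset (Suc i) (\<alpha> - {#i#})))) = 0" by simp
    then show False unfolding highest_A[OF hw lessI im] using \<alpha>(2) i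
      by (simp add: \<phi>_scale del: of_nat_Suc)
  qed
  show ?thesis
  proof (cases "m - 1 \<in># \<alpha>")
    case True
    then obtain \<beta> where \<beta>: "\<alpha> = add_mset (m - 1) \<beta>" by (metis insert_DiffM)
    \<comment> \<open>No index exceeds the last one, so only the degree of \<open>\<beta>\<close>
      remains, one less than the degree of \<open>\<alpha>\<close>. The integer found for the second
      condition is therefore the degree of \<open>\<alpha>\<close>.\<close>
    have "(\<Sum>t<m. if m - 1 < t then 1 else - of_nat (count \<beta> t)) = - (of_nat (\<Sum>t<m. count \<beta> t) :: complex)"
      unfolding of_nat_sum sum_negf[symmetric] by (rule sum.cong) auto
    also have "(\<Sum>t<m. count \<beta> t) = size \<beta>" using \<alpha>m \<beta> by (intro size_eq_sum) auto
    finally have "\<mu> (m - 1) - of_nat (size \<beta>) = 0"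
      using highest_coeff[OF hw wM, of "m - 1" \<beta>] \<alpha> \<beta> i0 by simp
    then have "of_nat (Suc (size \<beta>)) = \<mu> (m - 1) + 1" by simp
    then show ?thesis by (intro disjI1 exI[of _ "Suc (size \<beta>)"]) simp
  next
    case False
    then have "set_mset \<alpha> \<subseteq> {i0}" using letters by blast
    then have "\<alpha> = replicate_mset (size \<alpha>) i0" by (simp add: set_mset_subset_singletonD)
    moreover obtain k where k: "size \<alpha> = Suc k" using \<alpha>(1) by (cases "size \<alpha>") auto
    ultimately have \<alpha>r: "\<alpha> = add_mset i0 (replicate_mset k i0)" by simp
    have ne: "i0 \<noteq> m - 1" using False \<alpha>r by auto
    then have i0m: "Suc i0 < m" using i0 by simp
    \<comment> \<open>Each index beyond \<open>i0\<close> contributes 1, and \<open>i0\<close>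
      itself contributes \<open>- k\<close>. As \<open>\<alpha>\<close> has degree
      \<open>Suc k\<close>, the number \<open>l\<close> is again its degree.\<close>
    have "(\<Sum>t<m. if i0 < t then 1 else - of_nat (count (replicate_mset k i0) t)) = (\<Sum>t<m. (if i0 < t then 1 else 0) - (if t = i0 then of_nat k else 0 :: complex))"
      by (rule sum.cong) auto
    also have "\<dots> = of_nat (m - Suc i0) - of_nat k"
    proof -
      have "{..<m} \<inter> {t. i0 < t} = {Suc i0..<m}" by auto
      then have "(\<Sum>t<m. (if i0 < t then 1 else 0)) = (of_nat (m - Suc i0) :: complex)"
        by (simp add: sum.If_cases)
      then show ?thesis using i0 by (simp add: sum_subtractf)
    qed
    finally have "\<mu> i0 + (of_nat (m - Suc i0) - of_nat k) = 0"
      using highest_coeff[OF hw wM, of i0 "replicate_mset k i0"] \<alpha>(2) \<alpha>r i0 by simp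
    moreover have "m - i0 = Suc (m - Suc i0)" using i0 by simp
    ultimately have l: "of_nat (Suc k) = \<mu> i0 + of_nat (m - i0)" by (simp add: algebra_simps eq_neg_iff_add_eq_0)
    \<comment> \<open>If the difference were \<open>r\<close>, exchange \<open>Suc r\<close> of the
      \<open>Suc k\<close> variables for the next one; this is possible exactly because
      \<open>r < Suc k\<close>. The power \<open>Suc r\<close> of the raising operator recovers the
      pure power, yet \<phi> kills its image.\<close>
    have "\<mu> i0 - \<mu> (Suc i0) \<noteq> of_nat r" if r: "r < Suc k" for r
    proof
      assume "\<mu> i0 - \<mu> (Suc i0) = of_nat r"
      from \<phi>_pow_vanishes[OF i0m this wU]
      have "\<phi> (sc (fact (Suc r)) (w (replicate_mset (Suc k) i0))) = 0"
        using highest_pow[OF hw i0m, of "Suc r" "Suc k"] r by (metis Suc_leI)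
      then show False using \<alpha>(2) \<alpha>r by (simp add: \<phi>_scale del: fact_Suc)
    qed
    then show ?thesis using l ne by (intro disjI2 conjI exI[of _ "Suc k"]) auto
  qed
qed

end

subsection \<open>An explicit singular vector\<close>

context hw_module
begin

text \<open>The operators \<open>A j i0\<close> with \<open>j > i0\<close> commute, so a fold over
  the multiset defines their product. Other indices are skipped; in particular a variable
  \<open>i0\<close> carries no operator.\<close>

definition column :: "nat \<Rightarrow> nat multiset \<Rightarrow> 't" where
  "column i0 = fold_mset (\<lambda>j y. if i0 < j \<and> j < m then A j i0 y else y) v0"

lemma column_simps:
  assumes "i0 < m"
  shows "column i0 {#} = v0"
    and "column i0 (add_mset j \<alpha>) = (if i0 < j \<and> j < m then A j i0 (column i0 \<alpha>) else column i0 \<alpha>)"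
proof -
  interpret comp_fun_commute "\<lambda>j y. if i0 < j \<and> j < m then A j i0 y else y"
  proof
    fix j k
    have "A j i0 (A k i0 y) = A k i0 (A j i0 y)" if "i0 < j" "j < m" "i0 < k" "k < m" for y
      using R_comm[of j i0 k i0 y] that assms by simp
    then show "(\<lambda>y. if i0 < k \<and> k < m then A k i0 y else y) \<circ> (\<lambda>y. if i0 < j \<and> j < m then A j i0 y else y) =
       (\<lambda>y. if i0 < j \<and> j < m then A j i0 y else y) \<circ> (\<lambda>y. if i0 < k \<and> k < m then A k i0 y else y)"
      by (auto simp: fun_eq_iff)
  qed
  show "column i0 {#} = v0" by (simp add: column_def)
  show "column i0 (add_mset j \<alpha>) = (if i0 < j \<and> j < m then A j i0 (column i0 \<alpha>) else column i0 \<alpha>)"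
    unfolding column_def by simp
qed

lemma column_U: "i0 < m \<Longrightarrow> column i0 \<alpha> \<in> U"
  by (induction \<alpha>) (auto simp: column_simps v0_U U_A)

text \<open>For \<open>i0 = m - 1\<close> the condition on \<open>b\<close> is vacuous, and
  \<open>b\<close> may be chosen at will; this covers the second condition of the theorem.\<close>

context
  fixes i0 :: nat and b :: complex
  assumes i0: "i0 < m" and b: "\<And>t. i0 < t \<Longrightarrow> t < m \<Longrightarrow> \<mu> t = b"
begin

lemma column_raise:
  assumes "s < i0" "i0 \<le> t" "t < m" shows "A s t (column i0 \<alpha>) = 0"
  using assms(2,3)
proof (induction \<alpha> arbitrary: t)
  case empty
  then show ?case using assms raise_v0[of s t] i0 by (simp add: column_simps)
next
  case (add j \<alpha>)
  have s: "s < m" using assms(1) i0 by simp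
  show ?case
  proof (cases "i0 < j \<and> j < m")
    case True
    have j: "j < m" using True by simp
    have "A s t (A j i0 (column i0 \<alpha>)) = A j i0 (A s t (column i0 \<alpha>)) + (if t = j then A s i0 (column i0 \<alpha>) else 0)"
      unfolding R_comm[OF s add.prems(2) j i0] using assms(1) by simp
    also have "\<dots> = 0" using add.IH[OF add.prems] add.IH[of i0] i0 R_zero[OF j i0] by simp
    finally show ?thesis using True i0 by (simp add: column_simps)
  qed (use add i0 in \<open>auto simp: column_simps\<close>)
qed

text \<open>By \<open>block_low\<close> the vector \<open>v0\<close> spans a one-dimensional module
  of the block beyond \<open>i0\<close>, with scalar \<open>b\<close>. The column operators
  transform under this block like the variables, whence the substitution of \<open>s\<close> for
  \<open>t\<close>.\<close>

lemma column_block: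
  assumes "i0 < s" "s < m" "i0 < t" "t < m"
  shows "A s t (column i0 \<alpha>) = sc (of_nat (count \<alpha> t)) (column i0 (add_mset s (\<alpha> - {#t#}))) + (if s = t then sc b (column i0 \<alpha>) else 0)"
proof (induction \<alpha>)
  case empty
  consider "s < t" | "s = t" | "t < s" by linarith
  then show ?case
  proof cases
    case 1
    then show ?thesis using raise_v0 assms i0 by (simp add: column_simps)
  next
    case 2
    then show ?thesis using weight_v0[of t] b[of t] assms i0 by (simp add: column_simps)
  next
    case 3
    have "A s t v0 = 0" by (rule block_low[OF 3]) (use assms b in auto)
    then show ?thesis using 3 i0 by (simp add: column_simps)
  qed
next
  case (add j \<alpha>)
  show ?case
  proof (cases "i0 < j \<and> j < m")
    case True
    have j: "j < m" using True by simp
    have 1: "A j i0 (column i0 \<beta>) = column i0 (add_mset j \<beta>)" for \<beta> using True i0 by (simp add: column_simps)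
    have "A s t (A j i0 (column i0 \<alpha>)) = A j i0 (A s t (column i0 \<alpha>)) + (if t = j then A s i0 (column i0 \<alpha>) else 0)"
      unfolding R_comm[OF assms(2,4) j i0] using assms(1) by simp
    also have "A s i0 (column i0 \<alpha>) = column i0 (add_mset s \<alpha>)" using assms i0 by (simp add: column_simps)
    also have "A j i0 (A s t (column i0 \<alpha>)) = sc (of_nat (count \<alpha> t)) (column i0 (add_mset j (add_mset s (\<alpha> - {#t#}))))
       + (if s = t then sc b (column i0 (add_mset j \<alpha>)) else 0)"
      unfolding add.IH by (simp add: R_add[OF j i0] A_scale[OF j i0] R_zero[OF j i0] 1)
    finally have eq: "A s t (column i0 (add_mset j \<alpha>)) = sc (of_nat (count \<alpha> t)) (column i0 (add_mset j (add_mset s (\<alpha> - {#t#}))))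
       + (if s = t then sc b (column i0 (add_mset j \<alpha>)) else 0) + (if t = j then column i0 (add_mset s \<alpha>) else 0)"
      unfolding 1 .
    show ?thesis
    proof (cases "t = j")
      case tj: True
      have "sc (of_nat (count \<alpha> t)) (column i0 (add_mset j (add_mset s (\<alpha> - {#t#})))) = sc (of_nat (count \<alpha> t)) (column i0 (add_mset s \<alpha>))"
        using tj by (cases "t \<in># \<alpha>") (simp_all add: add_mset_commute[of j s] not_in_iff)
      then show ?thesis unfolding eq using tj by (simp add: scale_left_distrib algebra_simps)
    next
      case tj: False
      have "sc (of_nat (count \<alpha> t)) (column i0 (add_mset j (add_mset s (\<alpha> - {#t#})))) = sc (of_nat (count \<alpha> t)) (column i0 (add_mset s (add_mset j \<alpha> - {#t#})))"
        using tj by (cases "t \<in># \<alpha>") (simp_all add: add_mset_commute[of j s] not_in_iff diff_add_mset_swap)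
      then show ?thesis unfolding eq using tj by simp
    qed
  next
    case False
    have jt: "j \<noteq> t" using False assms by auto
    have 1: "column i0 (add_mset j \<beta>) = column i0 \<beta>" for \<beta> unfolding column_simps(2)[OF i0] using False by (rule if_not_P)
    have "sc (of_nat (count \<alpha> t)) (column i0 (add_mset s (add_mset j \<alpha> - {#t#}))) = sc (of_nat (count \<alpha> t)) (column i0 (add_mset s (\<alpha> - {#t#})))"
      using jt by (cases "t \<in># \<alpha>") (simp_all add: diff_add_mset_swap add_mset_commute[of s j] 1 not_in_iff)
    moreover have "count (add_mset j \<alpha>) t = count \<alpha> t" using jt by simp
    ultimately show ?thesis unfolding 1 add.IH by (simp only:)
  qed
qed

text \<open>The number of lowering operators that occur in
  \<open>column i0 \<alpha>\<close>.\<close>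

abbreviation nlow :: "nat multiset \<Rightarrow> complex" where
  "nlow \<alpha> \<equiv> (\<Sum>t=Suc i0..<m. of_nat (count \<alpha> t))"

lemma nlow_add: "nlow (add_mset j \<alpha>) = nlow \<alpha> + (if i0 < j \<and> j < m then 1 else 0)"
proof -
  have "nlow (add_mset j \<alpha>) = (\<Sum>t=Suc i0..<m. of_nat (count \<alpha> t) + (if t = j then 1 else 0))"
    by (rule sum.cong) auto
  then show ?thesis by (simp add: sum.distrib Suc_le_eq)
qed

lemma column_diag: "A i0 i0 (column i0 \<alpha>) = sc (\<mu> i0 - nlow \<alpha>) (column i0 \<alpha>)"
proof (induction \<alpha>)
  case empty
  then show ?case using weight_v0 i0 by (simp add: column_simps)
next
  case (add j \<alpha>)
  show ?case
  proof (cases "i0 < j \<and> j < m")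
    case True
    have j: "j < m" using True by simp
    have "A i0 i0 (A j i0 (column i0 \<alpha>)) = A j i0 (A i0 i0 (column i0 \<alpha>)) - A j i0 (column i0 \<alpha>)"
      unfolding R_comm[OF i0 i0 j i0] using True by simp
    then show ?thesis using True i0 unfolding nlow_add add.IH
      by (simp add: column_simps A_scale[OF j i0] R_diff[OF j i0] scale_left_diff_distrib scale_left_distrib algebra_simps)
  qed (use add i0 nlow_add in \<open>auto simp: column_simps\<close>)
qed

text \<open>Commuting with a column operator yields \<open>A i0 i0\<close> when
  \<open>t = j\<close>, evaluated by \<open>column_diag\<close>, and always the block operator
  \<open>A j t\<close>, evaluated by \<open>column_block\<close>. Together they lower the last
  factor by one for the additional operator.\<close>

lemma column_back:
  assumes "i0 < t" "t < m"
  shows "A i0 t (column i0 \<alpha>) = sc (of_nat (count \<alpha> t) * (\<mu> i0 - b - nlow \<alpha> + 1)) (column i0 (\<alpha> - {#t#}))"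
proof (induction \<alpha>)
  case empty
  then show ?case using raise_v0[of i0 t] assms i0 by (simp add: column_simps)
next
  case (add j \<alpha>)
  show ?case
  proof (cases "i0 < j \<and> j < m")
    case True
    have j: "j < m" "i0 < j" using True by simp_all
    have 1: "A j i0 (column i0 \<beta>) = column i0 (add_mset j \<beta>)" for \<beta> using True i0 by (simp add: column_simps)
    have "A i0 t (A j i0 (column i0 \<alpha>)) = A j i0 (A i0 t (column i0 \<alpha>)) + (if t = j then A i0 i0 (column i0 \<alpha>) else 0)
        - A j t (column i0 \<alpha>)"
      unfolding R_comm[OF i0 assms(2) j(1) i0] by simp
    also have "\<dots> = sc (of_nat (count \<alpha> t) * (\<mu> i0 - b - nlow \<alpha> + 1)) (column i0 (add_mset j (\<alpha> - {#t#})))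
      + (if t = j then sc (\<mu> i0 - nlow \<alpha>) (column i0 \<alpha>) else 0)
      - (sc (of_nat (count \<alpha> t)) (column i0 (add_mset j (\<alpha> - {#t#}))) + (if j = t then sc b (column i0 \<alpha>) else 0))"
      unfolding add.IH column_diag column_block[OF j(2,1) assms] A_scale[OF j(1) i0] 1 ..
    also have "\<dots> = sc (of_nat (count \<alpha> t) * (\<mu> i0 - b - nlow \<alpha>)) (column i0 (add_mset j (\<alpha> - {#t#})))
      + (if t = j then sc (\<mu> i0 - b - nlow \<alpha>) (column i0 \<alpha>) else 0)"
      by (simp add: scale_left_diff_distrib scale_left_distrib algebra_simps)
    finally have eq: "A i0 t (column i0 (add_mset j \<alpha>)) = sc (of_nat (count \<alpha> t) * (\<mu> i0 - b - nlow \<alpha>)) (column i0 (add_mset j (\<alpha> - {#t#})))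
      + (if t = j then sc (\<mu> i0 - b - nlow \<alpha>) (column i0 \<alpha>) else 0)" unfolding 1 .
    have n: "\<mu> i0 - b - nlow (add_mset j \<alpha>) + 1 = \<mu> i0 - b - nlow \<alpha>" unfolding nlow_add using True by simp
    show ?thesis unfolding n
    proof (cases "t = j")
      case tj: True
      let ?c = "\<mu> i0 - b - nlow \<alpha>"
      have K: "sc (of_nat (count \<alpha> t) * ?c) (column i0 (add_mset j (\<alpha> - {#t#}))) = sc (of_nat (count \<alpha> t) * ?c) (column i0 \<alpha>)"
        using tj by (cases "t \<in># \<alpha>") (simp_all add: not_in_iff)
      have "A i0 t (column i0 (add_mset j \<alpha>)) = sc (of_nat (count \<alpha> t) * ?c) (column i0 \<alpha>) + sc ?c (column i0 \<alpha>)"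
        unfolding eq K using tj by simp
      also have "\<dots> = sc (of_nat (Suc (count \<alpha> t)) * ?c) (column i0 \<alpha>)"
        unfolding scale_left_distrib[symmetric] by (rule arg_cong[where f = "\<lambda>c. sc c _"]) (simp add: distrib_right add.commute)
      finally show "A i0 t (column i0 (add_mset j \<alpha>)) = sc (of_nat (count (add_mset j \<alpha>) t) * ?c) (column i0 (add_mset j \<alpha> - {#t#}))"
        using tj by simp
    next
      case tj: False
      have "sc (of_nat (count \<alpha> t) * (\<mu> i0 - b - nlow \<alpha>)) (column i0 (add_mset j (\<alpha> - {#t#}))) = sc (of_nat (count \<alpha> t) * (\<mu> i0 - b - nlow \<alpha>)) (column i0 (add_mset j \<alpha> - {#t#}))"
        using tj by (cases "t \<in># \<alpha>") (simp_all add: not_in_iff diff_add_mset_swap)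
      then show "A i0 t (column i0 (add_mset j \<alpha>)) = sc (of_nat (count (add_mset j \<alpha>) t) * (\<mu> i0 - b - nlow \<alpha>)) (column i0 (add_mset j \<alpha> - {#t#}))"
        unfolding eq using tj by simp
    qed
  next
    case False
    have jt: "j \<noteq> t" using False assms by auto
    have 1: "column i0 (add_mset j \<beta>) = column i0 \<beta>" for \<beta> unfolding column_simps(2)[OF i0] using False by (rule if_not_P)
    have "sc (of_nat (count \<alpha> t) * c) (column i0 (add_mset j \<alpha> - {#t#})) = sc (of_nat (count \<alpha> t) * c) (column i0 (\<alpha> - {#t#}))" for c
      using jt by (cases "t \<in># \<alpha>") (simp_all add: diff_add_mset_swap 1 not_in_iff)
    moreover have "count (add_mset j \<alpha>) t = count \<alpha> t" using jt by simp
    moreover have "nlow (add_mset j \<alpha>) = nlow \<alpha>" unfolding nlow_add using False by simp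
    ultimately show ?thesis unfolding 1 add.IH by (simp only:)
  qed
qed

text \<open>The coefficients solve the recursion \<open>cg n = (\<mu> i0 - b - n) cg (n + 1)\<close>, to which the equations
  \<open>e s (sing l) = 0\<close> reduce once \<open>l = \<mu> i0 + m - i0\<close>. This is where the differences \<open>0, \<dots>, l - 1\<close> are excluded.\<close>

definition cg :: "nat \<Rightarrow> complex" where "cg n = inverse (\<Prod>i<n. \<mu> i0 - b - of_nat i)"

text \<open>Homogeneous of degree \<open>l\<close> in the variables from \<open>i0\<close> on. The
  argument \<open>l - count \<alpha> i0\<close> of \<open>cg\<close> is the number of lowering
  operators in the column.\<close>

definition sing :: "nat \<Rightarrow> nat multiset \<Rightarrow> 't" where
  "sing l \<alpha> = (if size \<alpha> = l \<and> set_mset \<alpha> \<subseteq> {i0..<m} then sc (cg (l - count \<alpha> i0)) (column i0 \<alpha>) else 0)"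

lemma sing_Mset: "sing l \<in> Mset"
proof (rule MsetI)
  have "finite {xs. set xs \<subseteq> {..<m} \<and> length xs = l}" by (rule finite_lists_length_eq) simp
  then show "finite (mset ` {xs. set xs \<subseteq> {..<m} \<and> length xs = l})" by simp
  fix \<alpha> assume "sing l \<alpha> \<noteq> 0"
  then have \<alpha>: "size \<alpha> = l" "set_mset \<alpha> \<subseteq> {i0..<m}" by (auto simp: sing_def split: if_splits)
  then show "set_mset \<alpha> \<subseteq> {..<m}" by auto
  obtain xs where xs: "\<alpha> = mset xs" by (metis ex_mset)
  show "\<alpha> \<in> mset ` {xs. set xs \<subseteq> {..<m} \<and> length xs = l}"
    using \<alpha> xs by (intro image_eqI[of _ _ xs]) auto
qed (auto simp: sing_def column_U i0 U_scale U_zero)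

text \<open>For \<open>s < i0\<close> every term vanishes. For \<open>s = i0\<close> and for
  \<open>s > i0\<close> the recursion for \<open>cg\<close> leaves a multiple of
  \<open>\<mu> i0 + of_nat (m - Suc i0) - of_nat (l - 1)\<close>, which is zero by the choice of
  \<open>l\<close>.\<close>

lemma e_sing:
  assumes l: "l \<ge> 1" "of_nat l = \<mu> i0 + of_nat (m - i0)" and d: "\<And>r. r < l \<Longrightarrow> \<mu> i0 - b \<noteq> of_nat r"
    and s: "s < m"
  shows "e s (sing l) = 0"
proof
  fix \<alpha>
  show "e s (sing l) \<alpha> = 0 \<alpha>"
  proof (cases "size \<alpha> = l - 1 \<and> set_mset \<alpha> \<subseteq> {i0..<m}")
    case False
    then have "sing l (add_mset t \<alpha>) = 0" for t using l by (auto simp: sing_def)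
    then show ?thesis unfolding e_apply using s by (auto simp: R_zero intro!: sum.neutral)
  next
    case True
    then have \<alpha>: "size \<alpha> = l - 1" "set_mset \<alpha> \<subseteq> {i0..<m}" by auto
    \<comment> \<open>The number of lowering operators attached to \<open>\<alpha>\<close>, whose
      degree is \<open>l - 1\<close> since \<open>e s\<close> lowers the degree by one. Adding the
      variable \<open>i0\<close> keeps it, adding a later variable raises it by one.\<close>
    define n where "n = l - 1 - count \<alpha> i0"
    have "count \<alpha> i0 \<le> size \<alpha>" by (simp add: count_le_size)
    then have ln: "l = Suc (n + count \<alpha> i0)" using l \<alpha> by (simp add: n_def)
    have split: "{..<m} = {..<i0} \<union> insert i0 {Suc i0..<m}" using i0 by auto
    have sums: "(\<Sum>t<m. g t) = (\<Sum>t<i0. g t) + (g i0 + (\<Sum>t=Suc i0..<m. g t))" for g :: "nat \<Rightarrow> 'z::ab_group_add"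
      unfolding split by (subst sum.union_disjoint) auto
    have c0: "count \<alpha> t = 0" if "t < i0" for t using \<alpha>(2) that by (force simp: count_eq_zero_iff)
    have "(\<Sum>t<m. count \<alpha> t) = l - 1" using \<alpha> by (subst size_eq_sum) auto
    then have "(of_nat (l - 1) :: complex) = (\<Sum>t<m. of_nat (count \<alpha> t))" by (metis of_nat_sum)
    then have nl: "nlow \<alpha> = of_nat n" using sums[of "\<lambda>t. of_nat (count \<alpha> t) :: complex"] c0 ln by simp
    have w0: "sing l (add_mset t \<alpha>) = 0" if "t < i0" for t using that by (simp add: sing_def)
    have wi: "sing l (add_mset i0 \<alpha>) = sc (cg n) (column i0 \<alpha>)"
      using \<alpha> l i0 ln by (simp add: sing_def column_simps)
    have wt: "sing l (add_mset t \<alpha>) = sc (cg (Suc n)) (column i0 (add_mset t \<alpha>))" if "i0 < t" "t < m" for t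
      using \<alpha> l i0 ln that by (simp add: sing_def)
    have cgn: "cg n = cg (Suc n) * (\<mu> i0 - b - of_nat n)"
    proof -
      have "\<mu> i0 - b - of_nat n \<noteq> 0" using d[of n] ln by simp
      then show ?thesis by (simp add: cg_def)
    qed
    have "e s (sing l) \<alpha> = (\<Sum>t<m. A s t (sing l (add_mset t \<alpha>))) - sc (\<Sum>t<m. of_nat (count \<alpha> t)) (sing l (add_mset s \<alpha>))"
      unfolding e_apply sum_subtractf scale_sum_left ..
    also have "(\<Sum>t<m. of_nat (count \<alpha> t)) = (of_nat (l - 1) :: complex)"
      using \<open>of_nat (l - 1) = _\<close> by simp
    also have "(\<Sum>t<m. A s t (sing l (add_mset t \<alpha>))) = sc (cg n) (A s i0 (column i0 \<alpha>)) + (\<Sum>t=Suc i0..<m. sc (cg (Suc n)) (A s t (column i0 (add_mset t \<alpha>))))"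
      unfolding sums using w0 wi wt R_zero[OF s] i0 A_scale[OF s] by simp
    finally have E: "e s (sing l) \<alpha> = sc (cg n) (A s i0 (column i0 \<alpha>)) + (\<Sum>t=Suc i0..<m. sc (cg (Suc n)) (A s t (column i0 (add_mset t \<alpha>))))
       - sc (of_nat (l - 1)) (sing l (add_mset s \<alpha>))" .
    have cnt: "(\<Sum>t=Suc i0..<m. of_nat (Suc (count \<alpha> t))) = of_nat n + (of_nat (m - Suc i0) :: complex)"
      using nl by (simp add: sum.distrib)
    have mi: "m - i0 = Suc (m - Suc i0)" using i0 by simp
    have \<mu>l: "\<mu> i0 + of_nat (m - Suc i0) = of_nat (l - 1)" using l unfolding mi by (simp add: of_nat_diff)
    consider "s < i0" | "s = i0" | "i0 < s" by linarith
    then show ?thesis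
    proof cases
      case 1
      then show ?thesis unfolding E using w0 column_raise i0 by simp
    next
      case 2
      have "A s t (column i0 (add_mset t \<alpha>)) = sc (of_nat (Suc (count \<alpha> t)) * (\<mu> i0 - b - of_nat n)) (column i0 \<alpha>)"
        if "i0 < t" "t < m" for t
        unfolding 2 column_back[OF that] nlow_add using that nl by (simp add: algebra_simps)
      then have "e s (sing l) \<alpha> = sc (cg n * (\<mu> i0 - of_nat n)) (column i0 \<alpha>)
         + (\<Sum>t=Suc i0..<m. sc (cg (Suc n) * (of_nat (Suc (count \<alpha> t)) * (\<mu> i0 - b - of_nat n))) (column i0 \<alpha>)) - sc (of_nat (l - 1) * cg n) (column i0 \<alpha>)"
        unfolding E unfolding 2 wi column_diag nl by simp
      also have "\<dots> = sc (cg n * (\<mu> i0 - of_nat n) + cg (Suc n) * (\<mu> i0 - b - of_nat n) * (of_nat n + of_nat (m - Suc i0)) - of_nat (l - 1) * cg n) (column i0 \<alpha>)"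
        unfolding cnt[symmetric] scale_left_diff_distrib scale_left_distrib sum_distrib_left scale_sum_left[symmetric]
        by (simp add: algebra_simps sum_distrib_left sum.distrib)
      also have "cg n * (\<mu> i0 - of_nat n) + cg (Suc n) * (\<mu> i0 - b - of_nat n) * (of_nat n + of_nat (m - Suc i0)) - of_nat (l - 1) * cg n
        = cg n * (\<mu> i0 + of_nat (m - Suc i0) - of_nat (l - 1))"
        unfolding cgn[symmetric] by (simp add: algebra_simps)
      finally show ?thesis using \<mu>l by simp
    next
      case 3
      have "A s t (column i0 (add_mset t \<alpha>)) = sc (of_nat (Suc (count \<alpha> t)) + (if s = t then b else 0)) (column i0 (add_mset s \<alpha>))"
        if "i0 < t" "t < m" for t
        unfolding column_block[OF 3 s that] by (auto simp: scale_left_distrib algebra_simps)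
      moreover have "A s i0 (column i0 \<alpha>) = column i0 (add_mset s \<alpha>)" using 3 s i0 by (simp add: column_simps)
      ultimately have "e s (sing l) \<alpha> = sc (cg n) (column i0 (add_mset s \<alpha>))
         + (\<Sum>t=Suc i0..<m. sc (cg (Suc n) * (of_nat (Suc (count \<alpha> t)) + (if s = t then b else 0))) (column i0 (add_mset s \<alpha>))) - sc (of_nat (l - 1) * cg (Suc n)) (column i0 (add_mset s \<alpha>))"
        unfolding E wt[OF 3 s] by simp
      also have "\<dots> = sc (cg n + cg (Suc n) * (of_nat n + of_nat (m - Suc i0) + b) - of_nat (l - 1) * cg (Suc n)) (column i0 (add_mset s \<alpha>))"
      proof -
        have "(\<Sum>t=Suc i0..<m. cg (Suc n) * (of_nat (Suc (count \<alpha> t)) + (if s = t then b else 0))) = cg (Suc n) * (of_nat n + of_nat (m - Suc i0) + b)"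
          unfolding sum_distrib_left[symmetric] sum.distrib cnt using 3 s by simp
        then show ?thesis
          unfolding scale_left_diff_distrib scale_left_distrib[of "cg n"] scale_sum_left[symmetric] by simp
      qed
      also have "cg n + cg (Suc n) * (of_nat n + of_nat (m - Suc i0) + b) - of_nat (l - 1) * cg (Suc n)
        = cg (Suc n) * (\<mu> i0 + of_nat (m - Suc i0) - of_nat (l - 1))"
        unfolding cgn by (simp add: algebra_simps)
      finally show ?thesis using \<mu>l by simp
    qed
  qed
qed

lemma sing_nz:
  assumes d: "\<And>r. r < l \<Longrightarrow> \<mu> i0 - b \<noteq> of_nat r"
  shows "sing l \<noteq> 0"
proof
  assume "sing l = 0"
  \<comment> \<open>At the pure power of \<open>i0\<close> no lowering operator occurs, so the
    coefficient is \<open>cg 0 = 1\<close> times \<open>v0\<close>.\<close>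
  then have "sing l (replicate_mset l i0) = 0" by simp
  moreover have "column i0 (replicate_mset k i0) = v0" for k by (induction k) (simp_all add: column_simps i0)
  moreover have "set_mset (replicate_mset l i0) \<subseteq> {i0..<m}" using i0 by auto
  ultimately show False using v0_nz by (simp add: sing_def cg_def)
qed

end

text \<open>\<open>?W\<close> is the largest submodule of vectors without constant term, obtained
  from \<open>word_stable\<close> for the nilradical. It contains the singular vector, which is
  killed by the nilradical and has positive degree, but not the generator
  \<open>\<iota> v0\<close>.\<close>

theorem proper_submod_exists:
  assumes i0: "i0 < m" and b: "\<And>t. i0 < t \<Longrightarrow> t < m \<Longrightarrow> \<mu> t = b"
    and l: "l \<ge> 1" "of_nat l = \<mu> i0 + of_nat (m - i0)" and d: "\<And>r. r < l \<Longrightarrow> \<mu> i0 - b \<noteq> of_nat r"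
  shows "\<exists>W. submod W \<and> W \<noteq> {0} \<and> W \<noteq> Mset"
proof -
  let ?S = "{(s, m) | s. s < m}"
  let ?W = "{z \<in> Mset. \<forall>u\<in>lists ?S. M.wact u z {#} = 0}"
  let ?w = "sing i0 b l"
  have S: "?S \<subseteq> {..<Suc m} \<times> {..<Suc m}" by auto
  have SL: "u \<in> lists ({..<Suc m} \<times> {..<Suc m})" if "u \<in> lists ?S" for u using that S lists_mono by blast
  have smul: "M.wact u (smul c z) = smul c (M.wact u z)" if "u \<in> lists ({..<Suc m} \<times> {..<Suc m})" for u c z
    using that by (induction u) (auto simp: R_smul)
  have R: "R k j z \<in> ?W" if z: "z \<in> ?W" and kj: "k < Suc m" "j < Suc m" for z k j
  proof -
    have "\<forall>u\<in>lists ?S. M.wact u (R k j z) \<in> {z. z {#} = 0}"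
    proof (rule M.word_stable[OF S, where D = Mset])
      fix k j z assume kj: "k < Suc m" "j < Suc m" and z: "z \<in> Mset" "z \<in> {z. z {#} = 0}" "\<forall>(i, j)\<in>?S. R i j z \<in> {z. z {#} = 0}"
      consider "k < m" "j < m" | "k < m" "j = m" | "k = m" "j < m" | "k = m" "j = m" using kj by linarith
      then show "R k j z \<in> {z. z {#} = 0}"
      proof cases
        case 4
        have "(\<Sum>t\<in>T. X t (D t z)) {#} = 0" for T
          by (induction T rule: infinite_finite_induct) (auto simp: X_def)
        then show ?thesis using 4 by (simp add: R_def H_def)
      qed (use z in \<open>auto simp: R_def B_apply R_zero X_def\<close>)
    qed (use z kj Mset_R in auto)
    then show ?thesis using z kj Mset_R by auto
  qed
  have add: "x + y \<in> ?W" if "x \<in> ?W" "y \<in> ?W" for x y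
    using that by (auto simp: Mset_add M.wact_add SL)
  have "submod ?W" unfolding submod_def
  proof (intro conjI ballI allI impI)
    show "0 \<in> ?W" by (auto simp: Mset_zero M.wact_zero SL)
    fix x assume x: "x \<in> ?W"
    show sx: "smul c x \<in> ?W" for c using x by (auto simp: Mset_smul smul SL) (simp add: smul_def)
    show "R i i x - R m m x \<in> ?W" if "i < m" for i
      using R[OF x, of i i] R[OF x, of m m] that by (auto simp: Mset_diff M.wact_diff SL)
  qed (use add R in auto)
  moreover have "?w \<in> ?W"
  proof -
    have "M.wact u ?w {#} = 0" if "u \<in> lists ?S" for u
    proof (cases u rule: rev_cases)
      case Nil
      then show ?thesis using l by (simp add: sing_def[OF i0 b])
    next
      case (snoc v q)
      then obtain s where "q = (s, m)" "s < m" "v \<in> lists ?S" using \<open>u \<in> lists ?S\<close> by auto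
      then have "M.wact u ?w = M.wact v 0"
        using snoc e_sing[OF i0 b l d] by (simp add: R_def)
      then show ?thesis using M.wact_zero[OF SL[OF \<open>v \<in> lists ?S\<close>]] by simp
    qed
    then show ?thesis using sing_Mset[OF i0 b] by blast
  qed
  moreover have "?w \<noteq> 0" using sing_nz[OF i0 b d] by blast
  moreover have "\<iota> v0 \<notin> ?W"
  proof
    assume "\<iota> v0 \<in> ?W"
    then have "M.wact [] (\<iota> v0) {#} = 0" by blast
    then show False using v0_nz by (simp add: \<iota>_def)
  qed
  moreover have "\<iota> v0 \<in> Mset" using \<iota>_Mset v0_U .
  ultimately show ?thesis by (intro exI[of _ ?W]) blast
qed

end

subsection \<open>The model as a module over sl(m+1)\<close>

lemma (in cvec) sm_minus_right: "v \<in> carrier V \<Longrightarrow> w \<in> carrier V \<Longrightarrow> v \<ominus> w = v \<oplus> (- 1 :: complex) \<odot> w"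
  by (simp add: sm_neg_one a_minus_def)

context hw_module
begin

definition Mrec :: "(complex, nat multiset \<Rightarrow> 't) module" where
  "Mrec = \<lparr>carrier = Mset, mult = undefined, one = undefined, zero = 0, add = (+), smult = smul\<rparr>"

lemma Mrec_simps [simp]: "carrier Mrec = Mset" "zero Mrec = 0" "add Mrec = (+)" "smult Mrec = smul"
  by (simp_all add: Mrec_def)

definition sig :: "complex mat \<Rightarrow> (nat multiset \<Rightarrow> 't) \<Rightarrow> nat multiset \<Rightarrow> 't" where
  "sig y w = (\<Sum>i<Suc m. \<Sum>j<Suc m. smul (y $$ (i, j)) (R i j w))"

sublocale F: vector_space smul
  by unfold_locales (auto simp: smul_def fun_eq_iff scale_right_distrib scale_left_distrib)

lemma Mrec_vs: "vectorspace class_ring Mrec"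
proof (rule vectorspace_classI)
  show "abelian_group Mrec"
  proof (rule abelian_groupI)
    fix x assume "x \<in> carrier Mrec"
    then show "\<exists>y\<in>carrier Mrec. y \<oplus>\<^bsub>Mrec\<^esub> x = \<zero>\<^bsub>Mrec\<^esub>" by (intro bexI[of _ "- x"]) (simp_all add: Mset_minus)
  qed (simp_all add: Mset_add Mset_zero add.assoc add.commute)
qed (simp_all add: Mset_smul F.scale_left_distrib F.scale_right_distrib)

lemma Mrec_minus: "x \<in> Mset \<Longrightarrow> y \<in> Mset \<Longrightarrow> x \<ominus>\<^bsub>Mrec\<^esub> y = x - y"
proof -
  have "cvec Mrec" unfolding cvec_def by (rule Mrec_vs)
  moreover assume "x \<in> Mset" "y \<in> Mset"
  ultimately show ?thesis using cvec.sm_minus_right[of Mrec x y] by (simp add: smul_minus_one)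
qed

lemma sig_Mset: "w \<in> Mset \<Longrightarrow> sig y w \<in> Mset"
  unfolding sig_def by (intro Mset_sum Mset_smul Mset_R) auto

lemma R_sum: "i < Suc m \<Longrightarrow> j < Suc m \<Longrightarrow> R i j (\<Sum>k\<in>S. g k) = (\<Sum>k\<in>S. R i j (g k))"
  by (rule additive_sum[of "R i j"]) (rule M.R_add)

lemma sig_comp: "sig x (sig y w) = (\<Sum>i<Suc m. \<Sum>j<Suc m. \<Sum>k<Suc m. \<Sum>l<Suc m. smul (x $$ (i, j) * y $$ (k, l)) (R i j (R k l w)))"
  unfolding sig_def by (intro sum.cong refl) (simp add: R_sum R_smul F.scale_sum_right del: sum.lessThan_Suc)

text \<open>Both compositions are expanded bilinearly and compared by the relations of
  \<open>R\<close>. The two contractions of indices give the entries of \<open>x * y\<close> and of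
  \<open>y * x\<close>.\<close>

lemma sig_bracket:
  assumes x: "x \<in> MM m" and y: "y \<in> MM m"
  shows "sig (x * y - y * x) w = sig x (sig y w) - sig y (sig x w)"
proof -
  have swap: "sig y (sig x w) = (\<Sum>i<Suc m. \<Sum>j<Suc m. \<Sum>k<Suc m. \<Sum>l<Suc m. smul (x $$ (i, j) * y $$ (k, l)) (R k l (R i j w)))"
  proof -
    have "sig y (sig x w) = (\<Sum>k<Suc m. \<Sum>l<Suc m. \<Sum>i<Suc m. \<Sum>j<Suc m. smul (y $$ (k, l) * x $$ (i, j)) (R k l (R i j w)))"
      by (rule sig_comp)
    also have "\<dots> = (\<Sum>k<Suc m. \<Sum>i<Suc m. \<Sum>l<Suc m. \<Sum>j<Suc m. smul (y $$ (k, l) * x $$ (i, j)) (R k l (R i j w)))"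
      by (intro sum.cong refl sum.swap)
    also have "\<dots> = (\<Sum>k<Suc m. \<Sum>i<Suc m. \<Sum>j<Suc m. \<Sum>l<Suc m. smul (y $$ (k, l) * x $$ (i, j)) (R k l (R i j w)))"
      by (intro sum.cong refl sum.swap)
    also have "\<dots> = (\<Sum>i<Suc m. \<Sum>k<Suc m. \<Sum>j<Suc m. \<Sum>l<Suc m. smul (y $$ (k, l) * x $$ (i, j)) (R k l (R i j w)))"
      by (rule sum.swap)
    also have "\<dots> = (\<Sum>i<Suc m. \<Sum>j<Suc m. \<Sum>k<Suc m. \<Sum>l<Suc m. smul (y $$ (k, l) * x $$ (i, j)) (R k l (R i j w)))"
      by (intro sum.cong refl sum.swap)
    finally show ?thesis by (simp only: mult.commute)
  qed
  have t1: "(\<Sum>i<Suc m. \<Sum>j<Suc m. \<Sum>k<Suc m. \<Sum>l<Suc m. smul (x $$ (i, j) * y $$ (k, l)) (if j = k then R i l w else 0))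
    = (\<Sum>i<Suc m. \<Sum>l<Suc m. smul (\<Sum>j<Suc m. x $$ (i, j) * y $$ (j, l)) (R i l w))"
  proof -
    have inner: "(\<Sum>k<Suc m. \<Sum>l<Suc m. smul (x $$ (i, j) * y $$ (k, l)) (if j = k then R i l w else 0))
      = (\<Sum>l<Suc m. smul (x $$ (i, j) * y $$ (j, l)) (R i l w))" if "j < Suc m" for i j
    proof -
      have "(\<Sum>l<Suc m. smul (x $$ (i, j) * y $$ (k, l)) (if j = k then R i l w else 0))
        = (if j = k then \<Sum>l<Suc m. smul (x $$ (i, j) * y $$ (j, l)) (R i l w) else 0)" for k
        by (auto simp del: sum.lessThan_Suc)
      then show ?thesis using that by (simp del: sum.lessThan_Suc)
    qed
    have "(\<Sum>i<Suc m. \<Sum>j<Suc m. \<Sum>k<Suc m. \<Sum>l<Suc m. smul (x $$ (i, j) * y $$ (k, l)) (if j = k then R i l w else 0))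
      = (\<Sum>i<Suc m. \<Sum>j<Suc m. \<Sum>l<Suc m. smul (x $$ (i, j) * y $$ (j, l)) (R i l w))"
      by (rule sum.cong[OF refl], rule sum.cong[OF refl]) (simp add: inner del: sum.lessThan_Suc)
    also have "\<dots> = (\<Sum>i<Suc m. \<Sum>l<Suc m. \<Sum>j<Suc m. smul (x $$ (i, j) * y $$ (j, l)) (R i l w))"
      by (intro sum.cong refl sum.swap)
    finally show ?thesis by (simp only: F.scale_sum_left)
  qed
  have t2: "(\<Sum>i<Suc m. \<Sum>j<Suc m. \<Sum>k<Suc m. \<Sum>l<Suc m. smul (x $$ (i, j) * y $$ (k, l)) (if l = i then R k j w else 0))
    = (\<Sum>k<Suc m. \<Sum>j<Suc m. smul (\<Sum>i<Suc m. y $$ (k, i) * x $$ (i, j)) (R k j w))"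
  proof -
    have "(\<Sum>l<Suc m. smul (x $$ (i, j) * y $$ (k, l)) (if l = i then R k j w else 0)) = smul (x $$ (i, j) * y $$ (k, i)) (R k j w)"
      if "i < Suc m" for i j k
    proof -
      have "(\<Sum>l<Suc m. smul (x $$ (i, j) * y $$ (k, l)) (if l = i then R k j w else 0))
        = (\<Sum>l<Suc m. if l = i then smul (x $$ (i, j) * y $$ (k, i)) (R k j w) else 0)"
        by (rule sum.cong) auto
      then show ?thesis using that by (simp del: sum.lessThan_Suc)
    qed
    then have "(\<Sum>i<Suc m. \<Sum>j<Suc m. \<Sum>k<Suc m. \<Sum>l<Suc m. smul (x $$ (i, j) * y $$ (k, l)) (if l = i then R k j w else 0))
      = (\<Sum>i<Suc m. \<Sum>j<Suc m. \<Sum>k<Suc m. smul (y $$ (k, i) * x $$ (i, j)) (R k j w))"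
      by (intro sum.cong refl) (simp add: mult.commute del: sum.lessThan_Suc)
    also have "\<dots> = (\<Sum>j<Suc m. \<Sum>i<Suc m. \<Sum>k<Suc m. smul (y $$ (k, i) * x $$ (i, j)) (R k j w))"
      by (rule sum.swap)
    also have "\<dots> = (\<Sum>j<Suc m. \<Sum>k<Suc m. \<Sum>i<Suc m. smul (y $$ (k, i) * x $$ (i, j)) (R k j w))"
      by (intro sum.cong refl sum.swap)
    also have "\<dots> = (\<Sum>k<Suc m. \<Sum>j<Suc m. \<Sum>i<Suc m. smul (y $$ (k, i) * x $$ (i, j)) (R k j w))"
      by (rule sum.swap)
    finally show ?thesis by (simp only: F.scale_sum_left)
  qed
  have "sig x (sig y w) - sig y (sig x w) = (\<Sum>i<Suc m. \<Sum>j<Suc m. \<Sum>k<Suc m. \<Sum>l<Suc m.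
      smul (x $$ (i, j) * y $$ (k, l)) (if j = k then R i l w else 0) - smul (x $$ (i, j) * y $$ (k, l)) (if l = i then R k j w else 0))"
    unfolding sig_comp[of x y] swap sum_subtractf[symmetric] F.scale_right_diff_distrib[symmetric]
    by (intro sum.cong refl arg_cong[where f = "smul _"]) (use M.R_comm[of _ _ _ _ w] in \<open>simp add: algebra_simps\<close>)
  also have "\<dots> = (\<Sum>i<Suc m. \<Sum>l<Suc m. smul (\<Sum>j<Suc m. x $$ (i, j) * y $$ (j, l)) (R i l w)) -
      (\<Sum>k<Suc m. \<Sum>j<Suc m. smul (\<Sum>i<Suc m. y $$ (k, i) * x $$ (i, j)) (R k j w))"
    unfolding sum_subtractf t1 t2 ..
  also have "\<dots> = sig (x * y - y * x) w"
    unfolding sig_def sum_subtractf[symmetric] F.scale_left_diff_distrib[symmetric]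
    by (intro sum.cong refl) (simp add: bracket_entry[OF x y] sum_subtractf del: sum.lessThan_Suc index_minus_mat)
  finally show ?thesis ..
qed

lemma sig_lie_module: "lie_module (sl (Suc m)) Mrec sig"
proof (rule lie_module.intro)
  show "vectorspace class_ring Mrec" by (rule Mrec_vs)
  fix x y :: "complex mat" and v w c assume x: "x \<in> carrier (sl (Suc m))" and v: "v \<in> carrier Mrec"
  show "sig x v \<in> carrier Mrec" using v by (simp add: sig_Mset)
  show "sig x (c \<odot>\<^bsub>Mrec\<^esub> v) = c \<odot>\<^bsub>Mrec\<^esub> sig x v"
    by (simp add: sig_def R_smul F.scale_sum_right mult.commute del: sum.lessThan_Suc)
  show "sig x (v \<oplus>\<^bsub>Mrec\<^esub> w) = sig x v \<oplus>\<^bsub>Mrec\<^esub> sig x w"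
    by (simp add: sig_def M.R_add F.scale_right_distrib sum.distrib del: sum.lessThan_Suc)
  have "x \<in> MM m" using x by (simp add: sl_iff)
  then show "sig (c \<odot>\<^bsub>sl (Suc m)\<^esub> x) v = c \<odot>\<^bsub>Mrec\<^esub> sig x v"
    by (simp add: sig_def F.scale_sum_right del: sum.lessThan_Suc)
  assume y: "y \<in> carrier (sl (Suc m))"
  have M: "x \<in> MM m" "y \<in> MM m" using x y by (auto simp: sl_iff)
  show "sig (x \<oplus>\<^bsub>sl (Suc m)\<^esub> y) v = sig x v \<oplus>\<^bsub>Mrec\<^esub> sig y v"
    using M by (simp add: sig_def F.scale_left_distrib sum.distrib del: sum.lessThan_Suc)
  show "sig (lie_bracket (sl (Suc m)) x y) v = sig x (sig y v) \<ominus>\<^bsub>Mrec\<^esub> sig y (sig x v)"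
    using v by (simp add: sig_bracket[OF M] Mrec_minus sig_Mset)
qed

definition el :: "nat \<Rightarrow> nat \<Rightarrow> complex mat" where
  "el i j = mat (Suc m) (Suc m) (\<lambda>(a, b). if a = i \<and> b = j then 1 else 0)"

lemma sig_el: "i < Suc m \<Longrightarrow> j < Suc m \<Longrightarrow> sig (el i j) w = R i j w"
proof -
  assume ij: "i < Suc m" "j < Suc m"
  have "(\<Sum>b<Suc m. smul (el i j $$ (a, b)) (R a b w)) = (if a = i then R i j w else 0)" if "a < Suc m" for a
  proof -
    have "(\<Sum>b<Suc m. smul (el i j $$ (a, b)) (R a b w)) = (\<Sum>b<Suc m. if b = j then (if a = i then R i j w else 0) else 0)"
      by (rule sum.cong) (use that in \<open>auto simp: el_def\<close>)
    then show ?thesis using ij by (simp del: sum.lessThan_Suc)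
  qed
  then have "sig (el i j) w = (\<Sum>a<Suc m. if a = i then R i j w else 0)"
    unfolding sig_def by (intro sum.cong) auto
  then show ?thesis using ij by (simp del: sum.lessThan_Suc)
qed

lemma el_sl: "i < Suc m \<Longrightarrow> j < Suc m \<Longrightarrow> i \<noteq> j \<Longrightarrow> el i j \<in> carrier (sl (Suc m))"
  by (auto simp: sl_iff el_def intro!: sum.neutral)

lemma sig_hm: 
  assumes "i < m" shows "sig (hm m i i) w = R i i w - R m m w"
proof -
  have "sig (hm m i i) w = sig (el i i) w - sig (el m m) w"
    unfolding sig_def sum_subtractf[symmetric] F.scale_left_diff_distrib[symmetric]
    by (intro sum.cong refl) (auto simp: el_def)
  then show ?thesis using assms by (simp add: sig_el)
qed

lemma xm_sl: "t < m \<Longrightarrow> xm m t \<in> carrier (sl (Suc m))"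
  by (auto simp: sl_iff intro!: sum.neutral)

lemma sig_xm: "t < m \<Longrightarrow> sig (xm m t) w = X t w"
proof -
  assume t: "t < m"
  have "xm m t = el m t" by (simp add: xm_def el_def)
  then show ?thesis using t sig_el[of m t w] by (simp add: R_def)
qed

lemma lie_submodule_iff: "lie_submodule (sl (Suc m)) Mrec sig W \<longleftrightarrow> submod W"
proof
  assume W: "lie_submodule (sl (Suc m)) Mrec sig W"
  then have ops: "W \<subseteq> Mset" "0 \<in> W" "\<forall>x\<in>W. \<forall>y\<in>W. x + y \<in> W" "\<forall>c. \<forall>x\<in>W. smul c x \<in> W"
    and cl: "\<And>y w. y \<in> carrier (sl (Suc m)) \<Longrightarrow> w \<in> W \<Longrightarrow> sig y w \<in> W"
    unfolding lie_submodule_def subspace_iff[OF Mrec_vs] by auto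
  have "R i j x \<in> W" if "x \<in> W" "i < Suc m" "j < Suc m" "i \<noteq> j" for x i j
    using cl[OF el_sl[OF that(2-4)] that(1)] that by (simp add: sig_el)
  moreover have "R i i x - R m m x \<in> W" if "x \<in> W" "i < m" for x i
    using cl[of "hm m i i" x] that hm_levi[of i m i] by (simp add: sig_hm levi_iff)
  ultimately show "submod W" using ops by (simp add: submod_def)
next
  assume W: "submod W"
  have sum: "(\<Sum>i\<in>S. g i) \<in> W" if "\<And>i. i \<in> S \<Longrightarrow> g i \<in> W" for S :: "nat set" and g
    using that W by (induction S rule: infinite_finite_induct) (auto simp: submod_def)
  have "sig y w \<in> W" if y: "y \<in> carrier (sl (Suc m))" and w: "w \<in> W" for y w
  proof -
    \<comment> \<open>Subtracting \<open>R m m w\<close> from every diagonal term changes the sum by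
      the trace times \<open>R m m w\<close>, which is zero.\<close>
    let ?g = "\<lambda>i j. smul (y $$ (i, j)) (if i = j then R i i w - R m m w else R i j w)"
    have tr: "(\<Sum>i<Suc m. y $$ (i, i)) = 0" using y by (simp add: sl_iff)
    have "sig y w = (\<Sum>i<Suc m. \<Sum>j<Suc m. ?g i j + (if j = i then smul (y $$ (i, i)) (R m m w) else 0))"
      unfolding sig_def by (intro sum.cong refl) (auto simp: F.scale_right_diff_distrib)
    also have "\<dots> = (\<Sum>i<Suc m. \<Sum>j<Suc m. ?g i j) + (\<Sum>i<Suc m. smul (y $$ (i, i)) (R m m w))"
      by (simp add: sum.distrib del: sum.lessThan_Suc)
    also have "(\<Sum>i<Suc m. smul (y $$ (i, i)) (R m m w)) = 0"
      unfolding F.scale_sum_left[symmetric] tr by simp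
    finally have "sig y w = (\<Sum>i<Suc m. \<Sum>j<Suc m. ?g i j)" by (simp only: add_0_right)
    moreover have "?g i j \<in> W" if "i < Suc m" "j < Suc m" for i j
    proof (cases "i = j")
      case True
      have "R i i w - R m m w \<in> W"
        using W w that by (cases "i = m") (auto simp: submod_def)
      then show ?thesis using W True by (simp add: submod_def)
    next
      case False
      then show ?thesis using W w that by (simp add: submod_def)
    qed
    then have "(\<Sum>i<Suc m. \<Sum>j<Suc m. ?g i j) \<in> W" by (intro sum) simp
    ultimately show ?thesis by (simp only:)
  qed
  then show "lie_submodule (sl (Suc m)) Mrec sig W"
    using W unfolding lie_submodule_def subspace_iff[OF Mrec_vs] by (auto simp: submod_def)
qed

lemma simple_Mrec_iff: "simple_lie_module (sl (Suc m)) Mrec sig \<longleftrightarrow> \<not> (\<exists>W. submod W \<and> W \<noteq> {0} \<and> W \<noteq> Mset)"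
proof -
  have "\<iota> v0 \<noteq> 0" using v0_nz by (auto simp: \<iota>_def fun_eq_iff)
  then have "Mset \<noteq> {0}" using \<iota>_Mset[OF v0_U] by blast
  then show ?thesis unfolding simple_lie_module_def lie_submodule_iff using sig_lie_module by auto
qed

text \<open>The constant is the product of the factorials of the multiplicities. Because it is
  nonzero, words with different multisets have images with different one-point supports, which
  yields independence in \<open>induced_iso\<close>.\<close>

lemma X_word:
  "\<exists>c. c \<noteq> 0 \<and> (\<forall>u. foldr X ts (\<iota> u) = (\<lambda>\<alpha>. if \<alpha> = mset ts then sc c u else 0))"
proof (induction ts)
  case Nil
  then show ?case by (intro exI[of _ 1]) (auto simp: \<iota>_def)
next
  case (Cons t ts)
  then obtain c where c: "c \<noteq> 0" "\<And>u. foldr X ts (\<iota> u) = (\<lambda>\<alpha>. if \<alpha> = mset ts then sc c u else 0)" by blast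
  let ?c = "of_nat (Suc (count (mset ts) t)) * c"
  have "foldr X (t # ts) (\<iota> u) = (\<lambda>\<alpha>. if \<alpha> = mset (t # ts) then sc ?c u else 0)" for u
  proof
    fix \<alpha>
    have e: "foldr X (t # ts) (\<iota> u) \<alpha> = sc (of_nat (count \<alpha> t)) (if \<alpha> - {#t#} = mset ts then sc c u else 0)"
      by (simp add: c(2) X_def)
    show "foldr X (t # ts) (\<iota> u) \<alpha> = (if \<alpha> = mset (t # ts) then sc ?c u else 0)"
    proof (cases "t \<in># \<alpha>")
      case True
      then obtain \<beta> where "\<alpha> = add_mset t \<beta>" by (metis insert_DiffM)
      then show ?thesis unfolding e by (simp del: of_nat_Suc)
    next
      case False
      then show ?thesis unfolding e by (auto simp: not_in_iff)
    qed
  qed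
  moreover have "?c \<noteq> 0" using c(1) by (simp del: of_nat_Suc)
  ultimately show ?case by blast
qed

end

subsection \<open>Relations in the induced module\<close>

context induced
begin

lemma T_zero_r: assumes f: "f \<in> carrier AL" shows "T f \<zero>\<^bsub>V\<^esub> = \<one>\<^bsub>G\<^esub>"
proof -
  have "T f \<zero>\<^bsub>V\<^esub> \<otimes>\<^bsub>G\<^esub> T f \<zero>\<^bsub>V\<^esub> = T f \<zero>\<^bsub>V\<^esub>" using T_add_r[OF f, of "\<zero>\<^bsub>V\<^esub>" "\<zero>\<^bsub>V\<^esub>"] by simp
  then show ?thesis using T_closed[OF f] by simp
qed

lemma T_zero_l: assumes v: "v \<in> carrier V" shows "T 0 v = \<one>\<^bsub>G\<^esub>"
proof -
  have "T 0 v \<otimes>\<^bsub>G\<^esub> T 0 v = T 0 v" using T_add_l[OF free_zero_closed free_zero_closed v] by simp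
  then show ?thesis using T_closed[OF free_zero_closed v] by simp
qed

lemma T_inv: assumes f: "f \<in> carrier AL" and v: "v \<in> carrier V" shows "inv\<^bsub>G\<^esub> (T f v) = T f (\<ominus>\<^bsub>V\<^esub> v)"
proof (rule G.inv_equality)
  show "T f (\<ominus>\<^bsub>V\<^esub> v) \<otimes>\<^bsub>G\<^esub> T f v = \<one>\<^bsub>G\<^esub>"
    using T_add_r[OF f, of "\<ominus>\<^bsub>V\<^esub> v" v] v T_zero_r[OF f] by (simp add: V.V.l_neg)
qed (use f v T_closed in \<open>auto simp del: free_alg_simps(1)\<close>)

lemma T_const: assumes f: "f \<in> carrier AL" and v: "v \<in> carrier V" shows "T (free_const c * f) v = T f (c \<odot>\<^bsub>V\<^esub> v)"
  unfolding free_const_central using T_move[OF f free_const_closed v] V.fact_const[OF v] by simp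

text \<open>A relation of the enveloping algebra times the remaining word still lies in the ideal,
  so the first letter can be manipulated as an element of the Lie algebra.\<close>

lemma T_head_add:
  assumes "a \<in> carrier L" "b \<in> carrier L" "set xs \<subseteq> carrier L" "v \<in> carrier V"
  shows "T (wmon ((a \<oplus>\<^bsub>L\<^esub> b) # xs)) v = T (wmon (a # xs)) v \<otimes>\<^bsub>G\<^esub> T (wmon (b # xs)) v"
proof -
  have "free_gen (a \<oplus>\<^bsub>L\<^esub> b) - free_gen a - free_gen b \<in> L.env_rels" unfolding L.env_rels_def using assms by blast
  from L.I_mult_r[OF L.env_rel_in[OF this] wmon_closed[OF assms(3)]]
  have "wmon ((a \<oplus>\<^bsub>L\<^esub> b) # xs) - (wmon (a # xs) + wmon (b # xs)) \<in> env_ideal L" by (simp add: wmon_Cons algebra_simps)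
  moreover have c: "wmon ((a \<oplus>\<^bsub>L\<^esub> b) # xs) \<in> carrier AL" "wmon (a # xs) \<in> carrier AL" "wmon (b # xs) \<in> carrier AL"
    using assms by (auto intro!: wmon_closed L.L_add simp del: free_alg_simps(1))
  ultimately have "T (wmon ((a \<oplus>\<^bsub>L\<^esub> b) # xs)) v = T (wmon (a # xs) + wmon (b # xs)) v"
    by (intro T_cong free_add_closed)
  then show ?thesis using T_add_l[OF c(2,3) assms(4)] by simp
qed

lemma T_head_smult:
  assumes "a \<in> carrier L" "set xs \<subseteq> carrier L" "v \<in> carrier V"
  shows "T (wmon ((c \<odot>\<^bsub>L\<^esub> a) # xs)) v = T (wmon (a # xs)) (c \<odot>\<^bsub>V\<^esub> v)"
proof -
  have "free_gen (c \<odot>\<^bsub>L\<^esub> a) - free_const c * free_gen a \<in> L.env_rels" unfolding L.env_rels_def using assms by blast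
  from L.I_mult_r[OF L.env_rel_in[OF this] wmon_closed[OF assms(2)]]
  have "wmon ((c \<odot>\<^bsub>L\<^esub> a) # xs) - free_const c * wmon (a # xs) \<in> env_ideal L" by (simp add: wmon_Cons algebra_simps)
  moreover have c: "wmon ((c \<odot>\<^bsub>L\<^esub> a) # xs) \<in> carrier AL" "wmon (a # xs) \<in> carrier AL"
    using assms by (auto intro!: wmon_closed L.L_smult simp del: free_alg_simps(1))
  ultimately have "T (wmon ((c \<odot>\<^bsub>L\<^esub> a) # xs)) v = T (free_const c * wmon (a # xs)) v"
    by (intro T_cong free_mult_closed free_const_closed)
  then show ?thesis using T_const[OF c(2) assms(3)] by simp
qed

lemma T_swap:
  assumes "a \<in> carrier L" "b \<in> carrier L" "set xs \<subseteq> carrier L" "v \<in> carrier V"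
  shows "T (wmon (a # b # xs)) v = T (wmon (b # a # xs)) v \<otimes>\<^bsub>G\<^esub> T (wmon (lie_bracket L a b # xs)) v"
proof -
  have "free_gen a * free_gen b - free_gen b * free_gen a - free_gen (lie_bracket L a b) \<in> L.env_rels"
    unfolding L.env_rels_def using assms by blast
  from L.I_mult_r[OF L.env_rel_in[OF this] wmon_closed[OF assms(3)]]
  have "wmon (a # b # xs) - (wmon (b # a # xs) + wmon (lie_bracket L a b # xs)) \<in> env_ideal L"
    by (simp add: wmon_Cons algebra_simps)
  moreover have c: "wmon (a # b # xs) \<in> carrier AL" "wmon (b # a # xs) \<in> carrier AL" "wmon (lie_bracket L a b # xs) \<in> carrier AL"
    using assms by (auto intro!: wmon_closed L.L_bracket simp del: free_alg_simps(1))
  ultimately have "T (wmon (a # b # xs)) v = T (wmon (b # a # xs) + wmon (lie_bracket L a b # xs)) v"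
    by (intro T_cong free_add_closed)
  then show ?thesis using T_add_l[OF c(2,3) assms(4)] by simp
qed

lemma T_snoc:
  assumes "set xs \<subseteq> carrier L" "y \<in> carrier K" "v \<in> carrier V"
  shows "T (wmon (xs @ [y])) v = T (wmon xs) (\<rho> y v)"
proof -
  have "wmon [y] \<in> carrier AK" using assms by (intro wmon_closed) auto
  then show ?thesis unfolding wmon_append
    using T_move[OF wmon_closed[OF assms(1)] _ assms(3)] V.fact_wmon[of "[y]" v] assms by simp
qed

lemma imul_gen_T:
  assumes "y \<in> carrier L" "set xs \<subseteq> carrier L" "v \<in> carrier V"
  shows "imul (L.cl (free_gen y)) (T (wmon xs) v) = T (wmon (y # xs)) v"
  unfolding wmon_Cons by (rule imul_T[OF free_gen_closed[OF assms(1)] wmon_closed[OF assms(2)] assms(3)])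

lemma T_single: 
  assumes "set xs \<subseteq> carrier L" "v \<in> carrier V"
  shows "T (Poly_Mapping.single (Word xs) c) v = T (wmon xs) (c \<odot>\<^bsub>V\<^esub> v)"
  unfolding single_Word by (rule T_const[OF wmon_closed[OF assms(1)] assms(2)])

end

subsection \<open>Realising the inducing module inside a vector space type\<close>

definition scl :: "complex \<Rightarrow> ('v \<Rightarrow>\<^sub>0 complex) \<Rightarrow> 'v \<Rightarrow>\<^sub>0 complex" where
  "scl c \<tau> = Poly_Mapping.map ((*) c) \<tau>"

lemma lookup_scl [simp]: "Poly_Mapping.lookup (scl c \<tau>) k = c * Poly_Mapping.lookup \<tau> k"
  by (simp add: scl_def Poly_Mapping.map.rep_eq when_def)

lemma vector_space_scl: "vector_space scl"
  by unfold_locales (auto intro!: poly_mapping_eqI simp: lookup_add algebra_simps)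

context cvec
begin

lemma lc_scl:
  assumes g: "g \<in> Poly_Mapping.keys \<tau> \<rightarrow> carrier V" shows "lc V g (scl c \<tau>) = c \<odot> lc V g \<tau>"
proof -
  have "lc V g (scl c \<tau>) = (\<Oplus>k\<in>Poly_Mapping.keys \<tau>. Poly_Mapping.lookup (scl c \<tau>) k \<odot> g k)"
    by (rule lc_superset) (use g in \<open>auto simp: in_keys_iff\<close>)
  also have "\<dots> = (\<Oplus>k\<in>Poly_Mapping.keys \<tau>. c \<odot> (Poly_Mapping.lookup \<tau> k \<odot> g k))"
    by (rule finsum_cong') (use g in \<open>auto simp: Pi_iff sm_assoc\<close>)
  also have "\<dots> = c \<odot> lc V g \<tau>"
    unfolding lc_def by (rule finsum_smult[symmetric]) (use g in \<open>auto simp: Pi_iff\<close>)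
  finally show ?thesis .
qed

text \<open>Labels outside the carrier are sent to zero, so that evaluation is linear on the whole
  free vector space.\<close>

definition ev :: "('v \<Rightarrow>\<^sub>0 complex) \<Rightarrow> 'v" where
  "ev \<tau> = lc V (\<lambda>v. if v \<in> carrier V then v else \<zero>) \<tau>"

lemma ev_closed [simp]: "ev \<tau> \<in> carrier V"
  unfolding ev_def by (rule lc_closed) auto

lemma ev_add: "ev (\<sigma> + \<tau>) = ev \<sigma> \<oplus> ev \<tau>"
  unfolding ev_def by (rule lc_add) auto

lemma ev_scl: "ev (scl c \<tau>) = c \<odot> ev \<tau>"
  unfolding ev_def by (rule lc_scl) auto

lemma ev_zero: "ev 0 = \<zero>"
  by (simp add: ev_def)

lemma ev_single: "v \<in> carrier V \<Longrightarrow> ev (Poly_Mapping.single v c) = c \<odot> v"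
  unfolding ev_def by (subst lc_single) auto

text \<open>Choosing a complement of the kernel of \<open>ev\<close> in the free vector space on \<open>'v\<close> identifies the
  record \<open>V\<close> with a subspace of a type that is a vector space.\<close>

lemma section_exists:
  "\<exists>\<kappa>. (\<forall>v\<in>carrier V. \<forall>w\<in>carrier V. \<kappa> (v \<oplus> w) = \<kappa> v + \<kappa> w) \<and>
     (\<forall>c. \<forall>v\<in>carrier V. \<kappa> (c \<odot> v) = scl c (\<kappa> v)) \<and> (\<forall>v\<in>carrier V. ev (\<kappa> v) = v)"
proof -
  interpret T: Vector_Spaces.vector_space "scl :: complex \<Rightarrow> ('v \<Rightarrow>\<^sub>0 complex) \<Rightarrow> _" by (rule vector_space_scl)
  interpret TT: vector_space_pair "scl :: complex \<Rightarrow> ('v \<Rightarrow>\<^sub>0 complex) \<Rightarrow> _" "scl :: complex \<Rightarrow> ('v \<Rightarrow>\<^sub>0 complex) \<Rightarrow> _" ..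
  let ?R = "{\<tau>. ev \<tau> = \<zero>}"
  have R: "T.subspace ?R" unfolding T.subspace_def by (auto simp: ev_zero ev_add ev_scl)
  obtain B where B: "B \<subseteq> ?R" "T.independent B" "?R \<subseteq> T.span B"
    using T.maximal_independent_subset[of ?R] by blast
  let ?C = "T.extend_basis B"
  have C: "T.independent ?C" "B \<subseteq> ?C" "T.span ?C = UNIV"
    using T.independent_extend_basis[OF B(2)] T.extend_basis_superset[OF B(2)] T.span_extend_basis[OF B(2)] by auto
  \<comment> \<open>The projection along the kernel of \<open>ev\<close> onto the span of the basis
    vectors outside \<open>B\<close>; its values depend only on \<open>ev\<close>.\<close>
  obtain g where g: "Vector_Spaces.linear scl scl g" "\<forall>x\<in>?C. g x = (if x \<in> B then 0 else x)"
    using TT.linear_independent_extend[OF C(1), of "\<lambda>x. if x \<in> B then 0 else x"] by blast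
  interpret g: Vector_Spaces.linear scl scl g by (rule g(1))
  have g0: "g \<tau> = 0" if "ev \<tau> = \<zero>" for \<tau>
  proof -
    have "T.span B \<subseteq> {\<tau>. g \<tau> = 0}"
      by (rule T.span_minimal) (use g(2) C(2) in \<open>auto simp: T.subspace_def g.add g.scale g.zero\<close>)
    then show ?thesis using B(3) that by blast
  qed
  have gev: "ev (g \<tau>) = ev \<tau>" for \<tau>
  proof -
    have "T.span ?C \<subseteq> {\<tau>. ev (g \<tau>) = ev \<tau>}"
    proof (rule T.span_minimal)
      show "?C \<subseteq> {\<tau>. ev (g \<tau>) = ev \<tau>}" using g(2) B(1) by (auto simp: ev_zero)
      show "T.subspace {\<tau>. ev (g \<tau>) = ev \<tau>}" by (auto simp: T.subspace_def g.add g.scale g.zero ev_add ev_scl)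
    qed
    then show ?thesis using C(3) by blast
  qed
  have diff: "g \<sigma> = g \<tau>" if "ev \<sigma> = ev \<tau>" for \<sigma> \<tau>
  proof -
    have "ev (\<sigma> - \<tau>) \<oplus> ev \<tau> = \<zero> \<oplus> ev \<tau>"
      using ev_add[of "\<sigma> - \<tau>" \<tau>] that by simp
    then have "ev (\<sigma> - \<tau>) = \<zero>" by (subst (asm) add.right_cancel) auto
    then have "g (\<sigma> - \<tau>) = 0" by (rule g0)
    then show ?thesis by (simp add: g.diff)
  qed
  \<comment> \<open>Any preimage under \<open>ev\<close> would serve; projecting the formal
    generator labelled \<open>v\<close> makes the choice linear.\<close>
  let ?\<kappa> = "\<lambda>v. g (Poly_Mapping.single v 1)"
  have "?\<kappa> (v \<oplus> w) = ?\<kappa> v + ?\<kappa> w" if "v \<in> carrier V" "w \<in> carrier V" for v w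
    unfolding g.add[symmetric] using that by (intro diff) (simp add: ev_single ev_add)
  moreover have "?\<kappa> (c \<odot> v) = scl c (?\<kappa> v)" if "v \<in> carrier V" for c v
    unfolding g.scale[symmetric] using that by (intro diff) (simp add: ev_single ev_scl)
  moreover have "ev (?\<kappa> v) = v" if "v \<in> carrier V" for v using that by (simp add: gev ev_single)
  ultimately show ?thesis by (intro exI[of _ ?\<kappa>]) blast
qed

definition kap :: "'v \<Rightarrow> 'v \<Rightarrow>\<^sub>0 complex" where
  "kap = (SOME \<kappa>. (\<forall>v\<in>carrier V. \<forall>w\<in>carrier V. \<kappa> (v \<oplus> w) = \<kappa> v + \<kappa> w) \<and>
     (\<forall>c. \<forall>v\<in>carrier V. \<kappa> (c \<odot> v) = scl c (\<kappa> v)) \<and> (\<forall>v\<in>carrier V. ev (\<kappa> v) = v))"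

lemma kap_add: "v \<in> carrier V \<Longrightarrow> w \<in> carrier V \<Longrightarrow> kap (v \<oplus> w) = kap v + kap w"
  and kap_smult: "v \<in> carrier V \<Longrightarrow> kap (c \<odot> v) = scl c (kap v)"
  and ev_kap [simp]: "v \<in> carrier V \<Longrightarrow> ev (kap v) = v"
  using someI_ex[OF section_exists] unfolding kap_def by blast+

lemma kap_zero: "kap \<zero> = 0"
  using kap_add[of \<zero> \<zero>] by simp

lemma kap_minus: "v \<in> carrier V \<Longrightarrow> w \<in> carrier V \<Longrightarrow> kap (v \<ominus> w) = kap v - kap w"
  using kap_add[of "v \<ominus> w" w] by (simp add: a_minus_def a_assoc l_neg)

lemma kap_inj: "v \<in> carrier V \<Longrightarrow> w \<in> carrier V \<Longrightarrow> kap v = kap w \<Longrightarrow> v = w"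
  by (metis ev_kap)

end

locale hw_levi =
  fixes m :: nat and \<mu> :: "nat \<Rightarrow> complex" and V :: "(complex, 'v) module" and \<rho> :: "complex mat \<Rightarrow> 'v \<Rightarrow> 'v"
  assumes shw: "simple_highest_weight_module m \<mu> V \<rho>"
begin

abbreviation "LA \<equiv> lie_subalgebra_on (sl (Suc m)) (levi m)"

lemma simple_V: "simple_lie_module LA V \<rho>"
  using shw by (simp add: simple_highest_weight_module_def)

sublocale V: lie_module LA V \<rho>
  using simple_V by (simp add: simple_lie_module_def)

sublocale VV: cvec V unfolding cvec_def by (rule V.vectorspace)

lemma hw_vector_exists:
  "\<exists>v\<in>carrier V. v \<noteq> \<zero>\<^bsub>V\<^esub> \<and> (\<forall>s t. s < t \<and> t < m \<longrightarrow> \<rho> (hm m s t) v = \<zero>\<^bsub>V\<^esub>) \<and>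
    (\<forall>s<m. \<rho> (hm m s s) v = \<mu> (Suc s) \<odot>\<^bsub>V\<^esub> v)"
proof -
  obtain v where v: "v \<in> carrier V" "\<And>W. lie_submodule LA V \<rho> W \<Longrightarrow> v \<in> W \<Longrightarrow> W = carrier V"
    "\<And>i j. 1 \<le> i \<Longrightarrow> i < j \<Longrightarrow> j \<le> m \<Longrightarrow> \<rho> (E (Suc m) i j) v = \<zero>\<^bsub>V\<^esub>"
    "\<And>i. i \<in> {1..m} \<Longrightarrow> \<rho> (E (Suc m) i i - E (Suc m) (Suc m) (Suc m)) v = \<mu> i \<odot>\<^bsub>V\<^esub> v"
    using shw unfolding simple_highest_weight_module_def by auto
  have "v \<noteq> \<zero>\<^bsub>V\<^esub>"
  proof
    assume "v = \<zero>\<^bsub>V\<^esub>"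
    moreover have "\<rho> x \<zero>\<^bsub>V\<^esub> = \<zero>\<^bsub>V\<^esub>" if "x \<in> levi m" for x
      using V.act_smult[of x "\<zero>\<^bsub>V\<^esub>" 0] V.act_closed[of x "\<zero>\<^bsub>V\<^esub>"] that by simp
    then have "lie_submodule LA V \<rho> {\<zero>\<^bsub>V\<^esub>}"
      unfolding lie_submodule_def subspace_iff[OF V.vectorspace] by simp
    ultimately have "{\<zero>\<^bsub>V\<^esub>} = carrier V" using v(2) by blast
    then show False using simple_V by (simp add: simple_lie_module_def)
  qed
  moreover have "\<rho> (hm m s t) v = \<zero>\<^bsub>V\<^esub>" if "s < t" "t < m" for s t
    using v(3)[of "Suc s" "Suc t"] E_off[of s t m] that by simp
  moreover have "\<rho> (hm m s s) v = \<mu> (Suc s) \<odot>\<^bsub>V\<^esub> v" if "s < m" for s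
    using v(4)[of "Suc s"] E_diag[of m s] that by simp
  ultimately show ?thesis using v(1) by blast
qed

definition hwv :: 'v where
  "hwv = (SOME v. v \<in> carrier V \<and> v \<noteq> \<zero>\<^bsub>V\<^esub> \<and> (\<forall>s t. s < t \<and> t < m \<longrightarrow> \<rho> (hm m s t) v = \<zero>\<^bsub>V\<^esub>) \<and>
    (\<forall>s<m. \<rho> (hm m s s) v = \<mu> (Suc s) \<odot>\<^bsub>V\<^esub> v))"

lemma hwv: "hwv \<in> carrier V" "hwv \<noteq> \<zero>\<^bsub>V\<^esub>" "s < t \<Longrightarrow> t < m \<Longrightarrow> \<rho> (hm m s t) hwv = \<zero>\<^bsub>V\<^esub>"
  "s < m \<Longrightarrow> \<rho> (hm m s s) hwv = \<mu> (Suc s) \<odot>\<^bsub>V\<^esub> hwv"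
proof -
  have "\<exists>v. v \<in> carrier V \<and> v \<noteq> \<zero>\<^bsub>V\<^esub> \<and> (\<forall>s t. s < t \<and> t < m \<longrightarrow> \<rho> (hm m s t) v = \<zero>\<^bsub>V\<^esub>) \<and>
    (\<forall>s<m. \<rho> (hm m s s) v = \<mu> (Suc s) \<odot>\<^bsub>V\<^esub> v)" using hw_vector_exists by blast
  from someI_ex[OF this] show "hwv \<in> carrier V" "hwv \<noteq> \<zero>\<^bsub>V\<^esub>" "s < t \<Longrightarrow> t < m \<Longrightarrow> \<rho> (hm m s t) hwv = \<zero>\<^bsub>V\<^esub>"
  "s < m \<Longrightarrow> \<rho> (hm m s s) hwv = \<mu> (Suc s) \<odot>\<^bsub>V\<^esub> hwv" unfolding hwv_def[symmetric] by blast+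
qed

definition Aop :: "nat \<Rightarrow> nat \<Rightarrow> ('v \<Rightarrow>\<^sub>0 complex) \<Rightarrow> 'v \<Rightarrow>\<^sub>0 complex" where
  "Aop s t \<tau> = VV.kap (\<rho> (hm m s t) (VV.ev \<tau>))"

abbreviation "UV \<equiv> VV.kap ` carrier V"

lemma hm_act_closed: "s < m \<Longrightarrow> t < m \<Longrightarrow> v \<in> carrier V \<Longrightarrow> \<rho> (hm m s t) v \<in> carrier V"
  using V.act_closed[of "hm m s t" v] hm_levi by simp

lemma Aop_kap: "v \<in> carrier V \<Longrightarrow> Aop s t (VV.kap v) = VV.kap (\<rho> (hm m s t) v)"
  by (simp add: Aop_def)

lemma Aop_comm:
  assumes "s < m" "t < m" "u < m" "v < m"
  shows "Aop s t (Aop u v x) = Aop u v (Aop s t x) + (if t = u then Aop s v x else 0) - (if v = s then Aop u t x else 0)"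
proof -
  let ?z = "0\<^sub>m (Suc m) (Suc m)" and ?x = "VV.ev x"
  have x: "?x \<in> carrier V" by simp
  have z: "\<rho> ?z ?x = \<zero>\<^bsub>V\<^esub>"
  proof -
    have "(0::complex) \<cdot>\<^sub>m ?z = ?z" by (rule eq_matI) auto
    then show ?thesis using V.smult_act[of ?z ?x 0] levi_props(2)[of m] x V.act_closed[of ?z ?x] by simp
  qed
  have l: "hm m s t \<in> levi m" "hm m u v \<in> levi m" "hm m s v \<in> levi m" "hm m u t \<in> levi m" using assms hm_levi by auto
  let ?P = "if t = u then hm m s v else ?z" and ?Q = "if v = s then hm m u t else ?z"
  have PQ: "?P \<in> levi m" "?Q \<in> levi m" using l levi_props(2) by auto
  have "\<rho> (hm m s t) (\<rho> (hm m u v) ?x) \<ominus>\<^bsub>V\<^esub> \<rho> (hm m u v) (\<rho> (hm m s t) ?x) = \<rho> (?P + (- 1) \<cdot>\<^sub>m ?Q) ?x"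
    using V.bracket_act[of "hm m s t" "hm m u v" ?x] l x hm_bracket[OF assms] by simp
  also have "\<dots> = \<rho> ?P ?x \<oplus>\<^bsub>V\<^esub> (- 1) \<odot>\<^bsub>V\<^esub> \<rho> ?Q ?x"
    using V.add_act[of ?P "(- 1) \<cdot>\<^sub>m ?Q" ?x] V.smult_act[of ?Q ?x "- 1"] PQ levi_props(4)[OF PQ(2), of "- 1"] x by simp
  finally have "VV.kap (\<rho> (hm m s t) (\<rho> (hm m u v) ?x) \<ominus>\<^bsub>V\<^esub> \<rho> (hm m u v) (\<rho> (hm m s t) ?x)) = VV.kap (\<rho> ?P ?x \<oplus>\<^bsub>V\<^esub> (- 1) \<odot>\<^bsub>V\<^esub> \<rho> ?Q ?x)" by simp
  then have "Aop s t (Aop u v x) - Aop u v (Aop s t x) = VV.kap (\<rho> ?P ?x) + scl (- 1) (VV.kap (\<rho> ?Q ?x))"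
    using assms x V.act_closed[of ?P ?x] V.act_closed[of ?Q ?x] PQ
    by (simp add: VV.kap_minus VV.kap_add VV.kap_smult hm_act_closed Aop_def)
  also have "VV.kap (\<rho> ?P ?x) = (if t = u then Aop s v x else 0)" by (simp add: Aop_def z VV.kap_zero)
  also have "VV.kap (\<rho> ?Q ?x) = (if v = s then Aop u t x else 0)" by (simp add: Aop_def z VV.kap_zero)
  also have "scl (- 1) y = - y" for y :: "'v \<Rightarrow>\<^sub>0 complex" by (rule poly_mapping_eqI) simp
  finally show ?thesis by (simp add: algebra_simps)
qed

sublocale W: hw_module scl m Aop UV "VV.kap hwv" "\<lambda>i. \<mu> (Suc i)"
proof (intro hw_module.intro vector_space_scl gl_rep.intro hw_module_axioms.intro)
  interpret T: Vector_Spaces.vector_space "scl :: complex \<Rightarrow> ('v \<Rightarrow>\<^sub>0 complex) \<Rightarrow> _" by (rule vector_space_scl)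
  fix i j k l :: nat and x y :: "'v \<Rightarrow>\<^sub>0 complex" and c
  show "T.subspace UV" unfolding T.subspace_def
  proof (intro conjI ballI allI)
    show "0 \<in> UV" using VV.kap_zero VV.zero_closed by (metis imageI)
    fix x y c assume "x \<in> UV"
    then obtain v where v: "x = VV.kap v" "v \<in> carrier V" by blast
    show "scl c x \<in> UV" unfolding v using VV.kap_smult[OF v(2), of c] VV.sm_closed[OF v(2), of c] by (metis imageI)
    assume "y \<in> UV"
    then obtain w where w: "y = VV.kap w" "w \<in> carrier V" by blast
    show "x + y \<in> UV" unfolding v w using VV.kap_add[OF v(2) w(2)] VV.a_closed[OF v(2) w(2)] by (metis imageI)
  qed
  show "VV.kap hwv \<in> UV" using hwv(1) by blast
  show "VV.kap hwv \<noteq> 0" using hwv(1,2) VV.kap_inj[of hwv "\<zero>\<^bsub>V\<^esub>"] VV.kap_zero by auto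
  show "i < j \<Longrightarrow> j < m \<Longrightarrow> Aop i j (VV.kap hwv) = 0" using hwv by (simp add: Aop_kap VV.kap_zero)
  show "i < m \<Longrightarrow> Aop i i (VV.kap hwv) = scl (\<mu> (Suc i)) (VV.kap hwv)" using hwv by (simp add: Aop_kap VV.kap_smult)
  show "Aop i j (Aop k l x) = Aop k l (Aop i j x) + (if j = k then Aop i l x else 0) - (if l = i then Aop k j x else 0)"
    if "i < m" "j < m" "k < m" "l < m" using Aop_comm that by blast
  assume ij: "i < m" "j < m"
  show "Aop i j (x + y) = Aop i j x + Aop i j y"
    using ij V.act_add[of "hm m i j" "VV.ev x" "VV.ev y"] hm_levi by (simp add: Aop_def VV.ev_add VV.kap_add hm_act_closed)
  show "Aop i j (scl c x) = scl c (Aop i j x)"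
    using ij V.act_smult[of "hm m i j" "VV.ev x" c] hm_levi by (simp add: Aop_def VV.ev_scl VV.kap_smult hm_act_closed)
  show "Aop i j x \<in> UV" if "x \<in> UV" using ij that hm_act_closed by (auto simp: Aop_kap)
next
  interpret T: Vector_Spaces.vector_space "scl :: complex \<Rightarrow> ('v \<Rightarrow>\<^sub>0 complex) \<Rightarrow> _" by (rule vector_space_scl)
  fix W assume W: "T.subspace W" "W \<subseteq> UV" "\<And>i j y. i < m \<Longrightarrow> j < m \<Longrightarrow> y \<in> W \<Longrightarrow> Aop i j y \<in> W"
  let ?W = "{v \<in> carrier V. VV.kap v \<in> W}"
  have "\<forall>v\<in>?W. \<rho> x v \<in> ?W" if "x \<in> levi m" for x
    using that
  proof (induction x rule: levi_induct)
    case zero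
    have "\<rho> (0\<^sub>m (Suc m) (Suc m)) v = \<zero>\<^bsub>V\<^esub>" if "v \<in> carrier V" for v
    proof -
      have "(0::complex) \<cdot>\<^sub>m (0\<^sub>m (Suc m) (Suc m)) = 0\<^sub>m (Suc m) (Suc m)" by (rule eq_matI) auto
      then show ?thesis using V.smult_act[of "0\<^sub>m (Suc m) (Suc m)" v 0] levi_props(2)[of m] that V.act_closed[of "0\<^sub>m (Suc m) (Suc m)" v] by simp
    qed
    then show ?case using W(1) by (auto simp: VV.kap_zero T.subspace_def)
  next
    case (hm s t)
    then show ?case using W(3)[of s t] hm_act_closed by (auto simp: Aop_kap[symmetric])
  next
    case (add A B)
    then show ?case using W(1) V.add_act[of A B] V.act_closed[of A] V.act_closed[of B] by (auto simp: VV.kap_add T.subspace_def)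
  next
    case (smult c A)
    then show ?case using W(1) V.smult_act[of A _ c] V.act_closed[of A] by (auto simp: VV.kap_smult T.subspace_def)
  qed
  then have "lie_submodule LA V \<rho> ?W"
    using W(1) unfolding lie_submodule_def subspace_iff[OF V.vectorspace]
    by (auto simp: VV.kap_zero VV.kap_add VV.kap_smult T.subspace_def)
  then have "?W = {\<zero>\<^bsub>V\<^esub>} \<or> ?W = carrier V" using simple_V by (simp add: simple_lie_module_def)
  then have "VV.kap ` ?W = VV.kap ` {\<zero>\<^bsub>V\<^esub>} \<or> VV.kap ` ?W = UV" by (elim disjE) simp_all
  moreover have "VV.kap ` ?W = W" using W(2) by blast
  ultimately show "W = {0} \<or> W = UV" by (simp add: VV.kap_zero)
qed

end

lemma lev_lin:
  assumes "x \<in> MM m" "y \<in> MM m"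
  shows "lev m (x + y) = lev m x + lev m y" "lev m (c \<cdot>\<^sub>m x) = c \<cdot>\<^sub>m lev m x"
  by (rule eq_matI; use assms in \<open>auto simp: lev_def\<close>)+

context hw_levi
begin

abbreviation "PA \<equiv> lie_subalgebra_on (sl (Suc m)) (parabolic m)"

lemma parabolic_levi: "x \<in> parabolic m \<Longrightarrow> lev m x \<in> levi m"
  using lev_levi[of x m] by (simp add: parabolic_iff)

lemma parabolic_lie_module: "lie_module PA V (parabolic_act m \<rho>)"
proof -
  interpret PA: lie_ops PA by (rule lie_ops_parabolic)
  show ?thesis
  proof (rule lie_module.intro)
    show "vectorspace class_ring V" by (rule V.vectorspace)
    fix x y v w c assume x: "x \<in> carrier PA" and v: "v \<in> carrier V"
    then have xM: "x \<in> MM m" and xl: "lev m x \<in> levi m" by (auto simp: parabolic_iff sl_iff intro: parabolic_levi)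
    have xe: "parabolic_act m \<rho> x = \<rho> (lev m x)" using x by (simp add: parabolic_act_eq)
    show "parabolic_act m \<rho> x v \<in> carrier V" using V.act_closed[of "lev m x" v] xl v by (simp add: xe)
    show "parabolic_act m \<rho> x (c \<odot>\<^bsub>V\<^esub> v) = c \<odot>\<^bsub>V\<^esub> parabolic_act m \<rho> x v"
      using V.act_smult[of "lev m x" v c] xl v by (simp add: xe)
    show "parabolic_act m \<rho> x (v \<oplus>\<^bsub>V\<^esub> w) = parabolic_act m \<rho> x v \<oplus>\<^bsub>V\<^esub> parabolic_act m \<rho> x w" if "w \<in> carrier V"
      using V.act_add[of "lev m x" v w] xl v that by (simp add: xe)
    have "c \<cdot>\<^sub>m x \<in> parabolic m" using PA.L_smult[of x c] x by simp
    then show "parabolic_act m \<rho> (c \<odot>\<^bsub>PA\<^esub> x) v = c \<odot>\<^bsub>V\<^esub> parabolic_act m \<rho> x v"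
      using V.smult_act[of "lev m x" v c] xl v by (simp add: xe parabolic_act_eq lev_lin(2)[OF xM xM])
    assume y: "y \<in> carrier PA"
    then have yM: "y \<in> MM m" and yl: "lev m y \<in> levi m" by (auto simp: parabolic_iff sl_iff intro: parabolic_levi)
    have ye: "parabolic_act m \<rho> y = \<rho> (lev m y)" using y by (simp add: parabolic_act_eq)
    have "x + y \<in> parabolic m" using PA.L_add[of x y] x y by simp
    then show "parabolic_act m \<rho> (x \<oplus>\<^bsub>PA\<^esub> y) v = parabolic_act m \<rho> x v \<oplus>\<^bsub>V\<^esub> parabolic_act m \<rho> y v"
      using V.add_act[of "lev m x" "lev m y" v] xl yl v by (simp add: xe ye parabolic_act_eq lev_lin(1)[OF xM yM])
    have "x * y - y * x \<in> parabolic m" using PA.L_bracket[of x y] x y by simp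
    then show "parabolic_act m \<rho> (lie_bracket PA x y) v =
        parabolic_act m \<rho> x (parabolic_act m \<rho> y v) \<ominus>\<^bsub>V\<^esub> parabolic_act m \<rho> y (parabolic_act m \<rho> x v)"
      using V.bracket_act[of "lev m x" "lev m y" v] xl yl v x y by (simp add: xe ye parabolic_act_eq lev_bracket)
  qed
qed

sublocale I: induced "sl (Suc m)" PA V "parabolic_act m \<rho>"
proof (intro induced.intro rep.intro induced_axioms.intro)
  show "carrier PA \<subseteq> carrier (sl (Suc m))" by (auto simp: parabolic_iff)
qed (simp_all add: lie_ops_sl lie_ops_parabolic parabolic_lie_module)

sublocale N: rep "sl (Suc m)" W.Mrec W.sig
  by (intro rep.intro lie_ops_sl W.sig_lie_module)

text \<open>The entries of the upper left block are the coordinates of \<open>y\<close> with respect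
  to the matrices \<open>hm m s t\<close>; the corner entry is determined by the trace.\<close>

lemma levi_sum:
  assumes "y \<in> levi m" "v \<in> carrier V"
  shows "VV.kap (\<rho> y v) = (\<Sum>s<m. \<Sum>t<m. scl (y $$ (s, t)) (Aop s t (VV.kap v)))"
  using assms(1)
proof (induction y rule: levi_induct)
  case zero
  have "(0::complex) \<cdot>\<^sub>m (0\<^sub>m (Suc m) (Suc m)) = 0\<^sub>m (Suc m) (Suc m)" by (rule eq_matI) auto
  then have "\<rho> (0\<^sub>m (Suc m) (Suc m)) v = \<zero>\<^bsub>V\<^esub>"
    using V.smult_act[of "0\<^sub>m (Suc m) (Suc m)" v 0] levi_props(2)[of m] assms(2) V.act_closed[of "0\<^sub>m (Suc m) (Suc m)" v] by simp
  then show ?case by (simp add: VV.kap_zero)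
next
  case (hm a b)
  have "(\<Sum>t<m. scl (hm m a b $$ (s, t)) (Aop s t (VV.kap v))) = (if s = a then Aop a b (VV.kap v) else 0)" if "s < m" for s
  proof -
    have "(\<Sum>t<m. scl (hm m a b $$ (s, t)) (Aop s t (VV.kap v))) = (\<Sum>t<m. if t = b then (if s = a then Aop a b (VV.kap v) else 0) else 0)"
      by (rule sum.cong) (use that in auto)
    then show ?thesis using hm by simp
  qed
  then show ?case using hm assms(2) by (simp add: Aop_kap)
next
  case (add A B)
  have M: "A \<in> MM m" "B \<in> MM m" using add levi_props(5) by blast+
  have "VV.kap (\<rho> (A + B) v) = VV.kap (\<rho> A v) + VV.kap (\<rho> B v)"
    using add V.add_act[of A B v] V.act_closed[of A v] V.act_closed[of B v] assms(2) by (simp add: VV.kap_add)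
  also have "\<dots> = (\<Sum>s<m. \<Sum>t<m. scl (A $$ (s, t)) (Aop s t (VV.kap v)) + scl (B $$ (s, t)) (Aop s t (VV.kap v)))"
    unfolding add.IH by (simp add: sum.distrib)
  also have "\<dots> = (\<Sum>s<m. \<Sum>t<m. scl ((A + B) $$ (s, t)) (Aop s t (VV.kap v)))"
    by (intro sum.cong refl) (use M in \<open>simp add: W.scale_left_distrib\<close>)
  finally show ?case .
next
  case (smult c A)
  have M: "A \<in> MM m" using smult levi_props(5) by blast
  have "VV.kap (\<rho> (c \<cdot>\<^sub>m A) v) = scl c (VV.kap (\<rho> A v))"
    using smult V.smult_act[of A v c] V.act_closed[of A v] assms(2) by (simp add: VV.kap_smult)
  also have "\<dots> = (\<Sum>s<m. \<Sum>t<m. scl (c * A $$ (s, t)) (Aop s t (VV.kap v)))"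
    unfolding smult.IH by (simp add: W.scale_sum_right)
  also have "\<dots> = (\<Sum>s<m. \<Sum>t<m. scl ((c \<cdot>\<^sub>m A) $$ (s, t)) (Aop s t (VV.kap v)))"
    by (intro sum.cong refl) (use M in simp)
  finally show ?case .
qed

definition inc :: "'v \<Rightarrow> nat multiset \<Rightarrow> 'v \<Rightarrow>\<^sub>0 complex" where
  "inc v = W.\<iota> (VV.kap v)"

lemma inc_Mset: "v \<in> carrier V \<Longrightarrow> inc v \<in> W.Mset"
  unfolding inc_def by (rule W.\<iota>_Mset) blast

text \<open>On constants \<open>e s\<close> and \<open>H\<close> vanish, and the last row of
  \<open>y\<close> is zero off the corner. Only the upper left block survives, which is also the
  part of \<open>y\<close> that acts through \<open>lev\<close>.\<close>

lemma inc_equivariant: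
  assumes y: "y \<in> parabolic m" and v: "v \<in> carrier V"
  shows "W.sig y (inc v) = inc (parabolic_act m \<rho> y v)"
proof -
  have y0: "y $$ (m, j) = 0" if "j < m" for j using y that by (simp add: parabolic_iff)
  have z: "W.smul c 0 = 0" for c by (rule W.F.scale_zero_right)
  have "W.sig y (inc v) = (\<Sum>i<m. \<Sum>j<m. W.smul (y $$ (i, j)) (W.\<iota> (Aop i j (VV.kap v))))"
    unfolding W.sig_def inc_def by (simp add: W.R_def W.B_\<iota> W.e_\<iota> W.H_\<iota> y0 z)
  also have "\<dots> = (\<Sum>i<m. \<Sum>j<m. W.\<iota> (scl (lev m y $$ (i, j)) (Aop i j (VV.kap v))))"
    by (intro sum.cong refl) (simp add: W.\<iota>_scale lev_def)
  also have "\<dots> = W.\<iota> (\<Sum>i<m. \<Sum>j<m. scl (lev m y $$ (i, j)) (Aop i j (VV.kap v)))"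
    by (simp only: additive_sum[of W.\<iota>, OF W.\<iota>_add])
  also have "\<dots> = inc (parabolic_act m \<rho> y v)"
    unfolding inc_def levi_sum[OF parabolic_levi[OF y] v, symmetric] using y by (simp add: parabolic_act_eq)
  finally show ?thesis .
qed

subsection \<open>Normal form of the elements of the induced module\<close>

definition TX :: "nat list \<Rightarrow> 'v \<Rightarrow> ((complex mat word \<Rightarrow>\<^sub>0 complex) set \<times> 'v \<Rightarrow>\<^sub>0 int) set" where
  "TX ts v = I.T (wmon (map (xm m) ts)) v"

lemma xs_sl: "ts \<in> lists {..<m} \<Longrightarrow> set (map (xm m) ts) \<subseteq> carrier (sl (Suc m))"
  by (induction ts) (auto simp: W.xm_sl)

lemma TX_closed: "ts \<in> lists {..<m} \<Longrightarrow> v \<in> carrier V \<Longrightarrow> TX ts v \<in> carrier I.G"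
  unfolding TX_def by (rule I.T_closed[OF wmon_closed[OF xs_sl]])

text \<open>The finite sums of tensors of words in the opposite nilradical with vectors, built
  inductively; they turn out to exhaust the induced module.\<close>

inductive_set Q :: "((complex mat word \<Rightarrow>\<^sub>0 complex) set \<times> 'v \<Rightarrow>\<^sub>0 int) set set" where
  one: "\<one>\<^bsub>I.G\<^esub> \<in> Q"
| step: "\<lbrakk>ts \<in> lists {..<m}; v \<in> carrier V; X \<in> Q\<rbrakk> \<Longrightarrow> TX ts v \<otimes>\<^bsub>I.G\<^esub> X \<in> Q"

lemma Q_closed: "X \<in> Q \<Longrightarrow> X \<in> carrier I.G"
  by (induction X rule: Q.induct) (auto intro: TX_closed)

lemma TX_Q: "ts \<in> lists {..<m} \<Longrightarrow> v \<in> carrier V \<Longrightarrow> TX ts v \<in> Q"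
  using Q.step[OF _ _ Q.one, of ts v] TX_closed[of ts v] by simp

lemma Q_mult: "X \<in> Q \<Longrightarrow> Y \<in> Q \<Longrightarrow> X \<otimes>\<^bsub>I.G\<^esub> Y \<in> Q"
proof (induction X rule: Q.induct)
  case one
  then show ?case using Q_closed by simp
next
  case (step ts v X)
  then show ?case using Q.step[of ts v "X \<otimes>\<^bsub>I.G\<^esub> Y"] Q_closed TX_closed by (simp add: I.G.m_assoc)
qed

lemma Q_inv: "X \<in> Q \<Longrightarrow> inv\<^bsub>I.G\<^esub> X \<in> Q"
proof (induction X rule: Q.induct)
  case one
  then show ?case by (simp add: Q.one)
next
  case (step ts v X)
  have "inv\<^bsub>I.G\<^esub> (TX ts v) = TX ts (\<ominus>\<^bsub>V\<^esub> v)"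
    unfolding TX_def by (rule I.T_inv[OF wmon_closed[OF xs_sl[OF step(1)]] step(2)])
  then show ?case using step Q_closed TX_closed by (simp add: I.G.inv_mult Q.step)
qed

abbreviation "gm y \<equiv> I.imul (I.L.cl (free_gen y))"

lemma gm_one: "y \<in> carrier (sl (Suc m)) \<Longrightarrow> gm y \<one>\<^bsub>I.G\<^esub> = \<one>\<^bsub>I.G\<^esub>"
  using I.imul_T[OF free_gen_closed free_one_closed VV.zero_closed, of y] I.T_zero_r[OF free_one_closed]
    I.T_zero_r[OF free_gen_closed, of y] by simp

lemma gm_Q:
  assumes y: "y \<in> carrier (sl (Suc m))"
    and T: "\<And>ts v. ts \<in> lists {..<m} \<Longrightarrow> v \<in> carrier V \<Longrightarrow> I.T (wmon (y # map (xm m) ts)) v \<in> Q"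
  shows "X \<in> Q \<Longrightarrow> gm y X \<in> Q"
proof (induction X rule: Q.induct)
  case one
  then show ?case using gm_one[OF y] Q.one by simp
next
  case (step ts v X)
  have "gm y (TX ts v \<otimes>\<^bsub>I.G\<^esub> X) = I.T (wmon (y # map (xm m) ts)) v \<otimes>\<^bsub>I.G\<^esub> gm y X"
    using I.imul_mult[OF free_gen_closed[OF y] TX_closed[OF step(1,2)] Q_closed[OF step(3)]]
      I.imul_gen_T[OF y xs_sl[OF step(1)] step(2)] by (simp add: TX_def)
  then show ?case using T[OF step(1,2)] step(4) Q_mult by simp
qed

lemma gm_xm_Q: "t < m \<Longrightarrow> X \<in> Q \<Longrightarrow> gm (xm m t) X \<in> Q"
proof (rule gm_Q)
  show "I.T (wmon (xm m t # map (xm m) ts)) v \<in> Q" if "t < m" "ts \<in> lists {..<m}" "v \<in> carrier V" for ts v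
    using TX_Q[of "t # ts" v] that by (simp add: TX_def)
qed (auto intro: W.xm_sl)

text \<open>The Lie algebra is the parabolic subalgebra plus the span of the \<open>xm m t\<close>:
  the entries of the last row are cleared one at a time, starting with the last column before the
  corner.\<close>

lemma parabolic_peel:
  assumes par: "\<And>y. y \<in> parabolic m \<Longrightarrow> P y" and x: "\<And>t. t < m \<Longrightarrow> P (xm m t)"
    and add: "\<And>y z. \<lbrakk>y \<in> carrier (sl (Suc m)); z \<in> carrier (sl (Suc m)); P y; P z\<rbrakk> \<Longrightarrow> P (y + z)"
    and sm: "\<And>c y. \<lbrakk>y \<in> carrier (sl (Suc m)); P y\<rbrakk> \<Longrightarrow> P (c \<cdot>\<^sub>m y)"
    and y: "y \<in> carrier (sl (Suc m))"
  shows "P y"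
proof -
  have "\<forall>y\<in>carrier (sl (Suc m)). (\<forall>t<m. k \<le> t \<longrightarrow> y $$ (m, t) = 0) \<longrightarrow> P y" if "k \<le> m" for k
    using that
  proof (induction k)
    case 0
    then show ?case using par by (simp add: parabolic_iff)
  next
    case (Suc k)
    show ?case
    proof (intro ballI impI)
      fix y assume y: "y \<in> carrier (sl (Suc m))" "\<forall>t<m. Suc k \<le> t \<longrightarrow> y $$ (m, t) = 0"
      have k: "k < m" using Suc.prems by simp
      let ?c = "y $$ (m, k)"
      let ?y = "y + (- ?c) \<cdot>\<^sub>m xm m k"
      have yM: "y \<in> MM m" using y by (simp add: sl_iff)
      have xk: "c \<cdot>\<^sub>m xm m k \<in> carrier (sl (Suc m))" for c using I.L.L_smult[OF W.xm_sl[OF k]] by simp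
      have y': "?y \<in> carrier (sl (Suc m))" using I.L.L_add[OF y(1) xk] by simp
      have ent: "?y $$ (m, t) = y $$ (m, t) - ?c * (if t = k then 1 else 0)" if "t < m" for t
        using that yM by simp
      have "\<forall>t<m. k \<le> t \<longrightarrow> ?y $$ (m, t) = 0"
      proof (intro allI impI)
        fix t assume t: "t < m" "k \<le> t"
        show "?y $$ (m, t) = 0" unfolding ent[OF t(1)] using y(2) t by (cases "t = k") auto
      qed
      moreover have "\<forall>y\<in>carrier (sl (Suc m)). (\<forall>t<m. k \<le> t \<longrightarrow> y $$ (m, t) = 0) \<longrightarrow> P y"
        by (rule Suc.IH) (use k in simp)
      ultimately have "P ?y" using y' by blast
      then have "P (?y + ?c \<cdot>\<^sub>m xm m k)" using add[OF y' xk _ sm[OF W.xm_sl[OF k] x[OF k]]] by blast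
      moreover have "?y + ?c \<cdot>\<^sub>m xm m k = y" by (rule eq_matI) (use yM in auto)
      ultimately show "P y" by simp
    qed
  qed
  from this[of m] show ?thesis using y by simp
qed

text \<open>A parabolic letter is moved past the first \<open>xm m s\<close>. The bracket left
  behind precedes a shorter word, but need not be parabolic; this is why the induction on the word
  is carried out for arbitrary \<open>y\<close>.\<close>

lemma gen_word_Q:
  "ts \<in> lists {..<m} \<Longrightarrow> y \<in> carrier (sl (Suc m)) \<Longrightarrow> v \<in> carrier V \<Longrightarrow> I.T (wmon (y # map (xm m) ts)) v \<in> Q"
proof (induction ts arbitrary: y v)
  case Nil
  have "\<forall>v\<in>carrier V. I.T (wmon (y # map (xm m) [])) v \<in> Q"
  proof (rule parabolic_peel[OF _ _ _ _ Nil.prems(2)])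
    fix y assume y: "y \<in> parabolic m"
    show "\<forall>v\<in>carrier V. I.T (wmon (y # map (xm m) [])) v \<in> Q"
    proof
      fix v assume v: "v \<in> carrier V"
      have "parabolic_act m \<rho> y v \<in> carrier V" using I.V.act_closed[of y v] y v by simp
      then show "I.T (wmon (y # map (xm m) [])) v \<in> Q"
        using I.T_snoc[of "[]" y v] y v TX_Q[of "[]"] by (simp add: TX_def)
    qed
  next
    show "\<forall>v\<in>carrier V. I.T (wmon (xm m t # map (xm m) [])) v \<in> Q" if "t < m" for t
      using TX_Q[of "[t]"] that by (simp add: TX_def)
  next
    fix y z assume "y \<in> carrier (sl (Suc m))" "z \<in> carrier (sl (Suc m))"
      "\<forall>v\<in>carrier V. I.T (wmon (y # map (xm m) [])) v \<in> Q" "\<forall>v\<in>carrier V. I.T (wmon (z # map (xm m) [])) v \<in> Q"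
    then show "\<forall>v\<in>carrier V. I.T (wmon ((y + z) # map (xm m) [])) v \<in> Q"
      using I.T_head_add[of y z "[]"] Q_mult by simp
  next
    fix c y assume "y \<in> carrier (sl (Suc m))" "\<forall>v\<in>carrier V. I.T (wmon (y # map (xm m) [])) v \<in> Q"
    then show "\<forall>v\<in>carrier V. I.T (wmon ((c \<cdot>\<^sub>m y) # map (xm m) [])) v \<in> Q"
      using I.T_head_smult[of y "[]" _ c] by simp
  qed
  then show ?case using Nil.prems by blast
next
  case (Cons s ts)
  have s: "s < m" and ts: "ts \<in> lists {..<m}" using Cons.prems by auto
  let ?w = "map (xm m) (s # ts)"
  have w: "set ?w \<subseteq> carrier (sl (Suc m))" using xs_sl Cons.prems(1) by blast
  have "\<forall>v\<in>carrier V. I.T (wmon (y # ?w)) v \<in> Q"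
  proof (rule parabolic_peel[OF _ _ _ _ Cons.prems(2)])
    fix y assume y: "y \<in> parabolic m"
    then have ys: "y \<in> carrier (sl (Suc m))" by (simp add: parabolic_iff)
    show "\<forall>v\<in>carrier V. I.T (wmon (y # ?w)) v \<in> Q"
    proof
      fix v assume v: "v \<in> carrier V"
      have b: "lie_bracket (sl (Suc m)) y (xm m s) \<in> carrier (sl (Suc m))" by (rule I.L.L_bracket[OF ys W.xm_sl[OF s]])
      have yw: "set (y # map (xm m) ts) \<subseteq> carrier (sl (Suc m))" using ys xs_sl[OF ts] by simp
      have "I.T (wmon (xm m s # y # map (xm m) ts)) v = gm (xm m s) (I.T (wmon (y # map (xm m) ts)) v)"
        using I.imul_gen_T[OF W.xm_sl[OF s] yw v] by simp
      then have "I.T (wmon (xm m s # y # map (xm m) ts)) v \<in> Q" using gm_xm_Q[OF s Cons.IH[OF ts ys v]] by simp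
      moreover have "I.T (wmon (lie_bracket (sl (Suc m)) y (xm m s) # map (xm m) ts)) v \<in> Q" by (rule Cons.IH[OF ts b v])
      ultimately show "I.T (wmon (y # ?w)) v \<in> Q"
        using I.T_swap[OF ys W.xm_sl[OF s] xs_sl[OF ts] v] Q_mult by simp
    qed
  next
    show "\<forall>v\<in>carrier V. I.T (wmon (xm m t # ?w)) v \<in> Q" if "t < m" for t
      using TX_Q[of "t # s # ts"] that Cons.prems(1) by (simp add: TX_def)
  next
    fix y z assume "y \<in> carrier (sl (Suc m))" "z \<in> carrier (sl (Suc m))"
      "\<forall>v\<in>carrier V. I.T (wmon (y # ?w)) v \<in> Q" "\<forall>v\<in>carrier V. I.T (wmon (z # ?w)) v \<in> Q"
    then show "\<forall>v\<in>carrier V. I.T (wmon ((y + z) # ?w)) v \<in> Q"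
      using I.T_head_add[OF _ _ w, of y z] Q_mult by simp
  next
    fix c y assume "y \<in> carrier (sl (Suc m))" "\<forall>v\<in>carrier V. I.T (wmon (y # ?w)) v \<in> Q"
    then show "\<forall>v\<in>carrier V. I.T (wmon ((c \<cdot>\<^sub>m y) # ?w)) v \<in> Q"
      using I.T_head_smult[OF _ w, of y _ c] by simp
  qed
  then show ?case using Cons.prems by blast
qed

lemma word_Q: "set xs \<subseteq> carrier (sl (Suc m)) \<Longrightarrow> v \<in> carrier V \<Longrightarrow> I.T (wmon xs) v \<in> Q"
proof (induction xs)
  case Nil
  then show ?case using TX_Q[of "[]" v] by (simp add: TX_def)
next
  case (Cons y xs)
  then have "gm y (I.T (wmon xs) v) \<in> Q" by (intro gm_Q) (auto intro: gen_word_Q)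
  then show ?case using I.imul_gen_T[of y xs v] Cons.prems by simp
qed

lemma all_Q: assumes "X \<in> carrier I.G" shows "X \<in> Q"
  using assms
proof (induction X rule: I.G_induct)
  case (T f v)
  show ?case using T(1)
  proof (induction f rule: free_induct)
    case zero
    then show ?case using I.T_zero_l[OF T(2)] Q.one by simp
  next
    case (single xs c)
    then show ?case using I.T_single[OF single T(2)] word_Q[OF single, of "c \<odot>\<^bsub>V\<^esub> v"] T(2) by simp
  next
    case (add f g)
    then show ?case using I.T_add_l[OF add(1,2) T(2)] Q_mult by simp
  qed
qed (auto intro: Q_mult Q_inv)

text \<open>The zero matrix is written as a multiple of a letter so that \<open>T_head_smult\<close>
  moves the scalar 0 to the vector.\<close>

lemma xm_comm: assumes "s < m" "t < m" shows "xm m s * xm m t - xm m t * xm m s = (0::complex) \<cdot>\<^sub>m xm m s"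
proof (rule eq_matI)
  fix i j assume "i < dim_row ((0::complex) \<cdot>\<^sub>m xm m s)" "j < dim_col ((0::complex) \<cdot>\<^sub>m xm m s)"
  then have ij: "i < Suc m" "j < Suc m" by auto
  have z: "xm m a $$ (i, k) * xm m b $$ (k, j) = 0" if "a < m" "k < Suc m" for a b k
    using that ij by auto
  have "(\<Sum>k<Suc m. xm m a $$ (i, k) * xm m b $$ (k, j)) = 0" if "a < m" for a b
    by (rule sum.neutral) (use z that in blast)
  then show "(xm m s * xm m t - xm m t * xm m s) $$ (i, j) = ((0::complex) \<cdot>\<^sub>m xm m s) $$ (i, j)"
    unfolding bracket_entry[OF xm_closed xm_closed ij] using ij assms by (simp del: sum.lessThan_Suc)
qed simp_all

lemma TX_swap: assumes "s < m" "t < m" "ts \<in> lists {..<m}" "v \<in> carrier V" shows "TX (s # t # ts) v = TX (t # s # ts) v"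
proof -
  note x = W.xm_sl[OF assms(1)] W.xm_sl[OF assms(2)] xs_sl[OF assms(3)]
  have "I.T (wmon (((0::complex) \<cdot>\<^sub>m xm m s) # map (xm m) ts)) v = \<one>\<^bsub>I.G\<^esub>"
    using I.T_head_smult[OF x(1,3) assms(4), of 0] I.T_zero_r[OF wmon_closed, of "xm m s # map (xm m) ts"] x assms(4) by simp
  then show ?thesis
    using I.T_swap[OF x assms(4)] xm_comm[OF assms(1,2)] TX_closed[of "t # s # ts" v] assms by (simp add: TX_def)
qed

lemma TX_Cons: "t < m \<Longrightarrow> ts \<in> lists {..<m} \<Longrightarrow> v \<in> carrier V \<Longrightarrow> TX (t # ts) v = gm (xm m t) (TX ts v)"
  using I.imul_gen_T[OF W.xm_sl xs_sl, of t ts v] by (simp add: TX_def)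

lemma TX_move: "as \<in> lists {..<m} \<Longrightarrow> t < m \<Longrightarrow> bs \<in> lists {..<m} \<Longrightarrow> v \<in> carrier V \<Longrightarrow> TX (as @ t # bs) v = TX (t # as @ bs) v"
proof (induction as)
  case (Cons s as)
  then have "TX ((s # as) @ t # bs) v = gm (xm m s) (TX (t # as @ bs) v)" by (simp add: TX_Cons)
  also have "\<dots> = TX (s # t # as @ bs) v" using Cons.prems by (subst (2) TX_Cons) auto
  also have "\<dots> = TX (t # s # as @ bs) v" using Cons.prems by (intro TX_swap) auto
  finally show ?case by simp
qed simp

lemma TX_perm: "mset ts = mset us \<Longrightarrow> ts \<in> lists {..<m} \<Longrightarrow> v \<in> carrier V \<Longrightarrow> TX ts v = TX us v"
proof (induction ts arbitrary: us)
  case Nil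
  then show ?case by simp
next
  case (Cons t ts)
  then have "t \<in> set us" by (metis list.set_intros(1) mset_eq_setD)
  then obtain as bs where us: "us = as @ t # bs" by (meson split_list)
  have m: "mset ts = mset (as @ bs)" using Cons.prems(1) us by simp
  have t: "t < m" "ts \<in> lists {..<m}" using Cons.prems by auto
  have "set (as @ bs) = set ts" using m by (metis mset_eq_setD)
  then have ab: "as \<in> lists {..<m}" "bs \<in> lists {..<m}" using t(2) unfolding in_lists_conv_set by auto
  have "TX (t # ts) v = TX (t # as @ bs) v" using Cons.IH[OF m t(2) Cons.prems(3)] t ab Cons.prems(3) by (simp add: TX_Cons)
  then show ?case using TX_move[OF ab(1) t(1) ab(2) Cons.prems(3)] us by simp
qed

definition TM :: "nat multiset \<Rightarrow> 'v \<Rightarrow> ((complex mat word \<Rightarrow>\<^sub>0 complex) set \<times> 'v \<Rightarrow>\<^sub>0 int) set" where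
  "TM \<alpha> v = TX (sorted_list_of_multiset \<alpha>) v"

lemma slm: "set_mset \<alpha> \<subseteq> {..<m} \<Longrightarrow> sorted_list_of_multiset \<alpha> \<in> lists {..<m}"
  unfolding in_lists_conv_set by auto

lemma TM_closed: "set_mset \<alpha> \<subseteq> {..<m} \<Longrightarrow> v \<in> carrier V \<Longrightarrow> TM \<alpha> v \<in> carrier I.G"
  unfolding TM_def by (rule TX_closed[OF slm])

lemma TX_TM: "ts \<in> lists {..<m} \<Longrightarrow> v \<in> carrier V \<Longrightarrow> TX ts v = TM (mset ts) v"
  unfolding TM_def by (rule TX_perm) auto

lemma TM_add: "set_mset \<alpha> \<subseteq> {..<m} \<Longrightarrow> v \<in> carrier V \<Longrightarrow> w \<in> carrier V \<Longrightarrow> TM \<alpha> (v \<oplus>\<^bsub>V\<^esub> w) = TM \<alpha> v \<otimes>\<^bsub>I.G\<^esub> TM \<alpha> w"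
  unfolding TM_def TX_def by (rule I.T_add_r[OF wmon_closed[OF xs_sl[OF slm]]])

lemma TM_zero: "set_mset \<alpha> \<subseteq> {..<m} \<Longrightarrow> TM \<alpha> \<zero>\<^bsub>V\<^esub> = \<one>\<^bsub>I.G\<^esub>"
  unfolding TM_def TX_def by (rule I.T_zero_r[OF wmon_closed[OF xs_sl[OF slm]]])

text \<open>A normal form: one summand for each exponent in \<open>S\<close>, the exponents being
  distinct. Distinctness allows the coefficients of the image to be read off separately.\<close>

inductive canon :: "nat multiset set \<Rightarrow> ((complex mat word \<Rightarrow>\<^sub>0 complex) set \<times> 'v \<Rightarrow>\<^sub>0 int) set \<Rightarrow> bool" where
  one: "canon {} \<one>\<^bsub>I.G\<^esub>"
| step: "\<lbrakk>canon S X; \<alpha> \<notin> S; set_mset \<alpha> \<subseteq> {..<m}; v \<in> carrier V\<rbrakk> \<Longrightarrow> canon (insert \<alpha> S) (TM \<alpha> v \<otimes>\<^bsub>I.G\<^esub> X)"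

lemma canon_closed: "canon S X \<Longrightarrow> X \<in> carrier I.G"
  by (induction rule: canon.induct) (auto intro: TM_closed)

lemma canon_merge:
  assumes "canon S X" "\<alpha> \<in> S" "set_mset \<alpha> \<subseteq> {..<m}" "v \<in> carrier V" shows "canon S (TM \<alpha> v \<otimes>\<^bsub>I.G\<^esub> X)"
  using assms(1,2)
proof (induction rule: canon.induct)
  case (step S X \<beta> w)
  have c: "TM \<alpha> v \<in> carrier I.G" "TM \<beta> w \<in> carrier I.G" "X \<in> carrier I.G"
    using step assms TM_closed canon_closed by auto
  show ?case
  proof (cases "\<beta> = \<alpha>")
    case True
    have "TM \<alpha> v \<otimes>\<^bsub>I.G\<^esub> (TM \<alpha> w \<otimes>\<^bsub>I.G\<^esub> X) = TM \<alpha> (v \<oplus>\<^bsub>V\<^esub> w) \<otimes>\<^bsub>I.G\<^esub> X"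
      using c True step assms by (simp add: TM_add I.G.m_assoc)
    then show ?thesis using canon.step[OF step(1,2,3), of "v \<oplus>\<^bsub>V\<^esub> w"] True step assms by simp
  next
    case False
    have "TM \<alpha> v \<otimes>\<^bsub>I.G\<^esub> (TM \<beta> w \<otimes>\<^bsub>I.G\<^esub> X) = TM \<beta> w \<otimes>\<^bsub>I.G\<^esub> (TM \<alpha> v \<otimes>\<^bsub>I.G\<^esub> X)"
      using c by (simp add: I.G.m_lcomm)
    then show ?thesis using canon.step[OF _ step(2,3,4), of "TM \<alpha> v \<otimes>\<^bsub>I.G\<^esub> X"] step False by simp
  qed
qed simp

lemma all_canon: assumes "X \<in> carrier I.G" shows "\<exists>S. canon S X"
  using all_Q[OF assms]
proof (induction X rule: Q.induct)
  case one
  then show ?case using canon.one by blast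
next
  case (step ts v X)
  then obtain S where S: "canon S X" by blast
  have m: "set_mset (mset ts) \<subseteq> {..<m}" using step(1) unfolding in_lists_conv_set by auto
  show ?case unfolding TX_TM[OF step(1,2)]
    using canon_merge[OF S _ m step(2)] canon.step[OF S _ m step(2)] by blast
qed

text \<open>On a sum in normal form the image has at each exponent a nonzero multiple of the vector
  attached there, so image zero forces every vector, hence every summand, to vanish. Surjectivity
  follows from \<open>Mset_generated\<close>.\<close>

lemma induced_iso:
  obtains \<Psi> where "\<Psi> \<in> hom I.G (add_monoid W.Mrec)" "bij_betw \<Psi> (carrier I.G) (carrier W.Mrec)"
    "\<And>f v. f \<in> carrier I.AL \<Longrightarrow> v \<in> carrier V \<Longrightarrow> \<Psi> (I.T f v) = free_act W.Mrec W.sig f (inc v)"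
proof -
  have inc: "inc v \<in> carrier W.Mrec" if "v \<in> carrier V" for v using inc_Mset that by simp
  obtain \<Psi> where \<Psi>: "\<Psi> \<in> hom I.G (add_monoid W.Mrec)"
    "\<And>f v. f \<in> carrier I.AL \<Longrightarrow> v \<in> carrier V \<Longrightarrow> \<Psi> (I.T f v) = free_act W.Mrec W.sig f (inc v)"
  proof (rule I.universal[OF W.sig_lie_module, of inc])
    fix v w c y
    show "v \<in> carrier V \<Longrightarrow> inc v \<in> carrier W.Mrec" by (rule inc)
    show "v \<in> carrier V \<Longrightarrow> w \<in> carrier V \<Longrightarrow> inc (v \<oplus>\<^bsub>V\<^esub> w) = inc v \<oplus>\<^bsub>W.Mrec\<^esub> inc w"
      by (simp add: inc_def VV.kap_add W.\<iota>_add)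
    show "v \<in> carrier V \<Longrightarrow> inc (c \<odot>\<^bsub>V\<^esub> v) = c \<odot>\<^bsub>W.Mrec\<^esub> inc v"
      by (simp add: inc_def VV.kap_smult W.\<iota>_scale)
    show "y \<in> carrier PA \<Longrightarrow> v \<in> carrier V \<Longrightarrow> W.sig y (inc v) = inc (parabolic_act m \<rho> y v)"
      using inc_equivariant by simp
  qed blast
  interpret NG: comm_group "add_monoid W.Mrec" by (rule N.V.a_comm_group)
  interpret \<Psi>: group_hom I.G "add_monoid W.Mrec" \<Psi> using \<Psi>(1) by unfold_locales
  have add: "\<Psi> (X \<otimes>\<^bsub>I.G\<^esub> Y) = \<Psi> X + \<Psi> Y" if "X \<in> carrier I.G" "Y \<in> carrier I.G" for X Y
    using \<Psi>.hom_mult[OF that] by simp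
  have one: "\<Psi> \<one>\<^bsub>I.G\<^esub> = 0" using \<Psi>.hom_one by simp
  have cl: "\<Psi> X \<in> W.Mset" if "X \<in> carrier I.G" for X using \<Psi>.hom_closed[OF that] by simp
  have word: "\<Psi> (TX ts v) = foldr W.X ts (inc v)" if "ts \<in> lists {..<m}" "v \<in> carrier V" for ts v
  proof -
    have "\<Psi> (TX ts v) = foldr W.sig (map (xm m) ts) (inc v)"
      unfolding TX_def using \<Psi>(2)[OF wmon_closed[OF xs_sl[OF that(1)]] that(2)] N.fact_wmon[OF xs_sl[OF that(1)] inc[OF that(2)]] by simp
    also have "\<dots> = foldr W.X ts (inc v)" using that(1) by (induction ts) (auto simp: W.sig_xm)
    finally show ?thesis .
  qed
  have TM: "\<exists>c. c \<noteq> 0 \<and> (\<forall>v\<in>carrier V. \<Psi> (TM \<alpha> v) = (\<lambda>\<beta>. if \<beta> = \<alpha> then scl c (VV.kap v) else 0))"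
    if "set_mset \<alpha> \<subseteq> {..<m}" for \<alpha>
    using W.X_word[of "sorted_list_of_multiset \<alpha>"] word[OF slm[OF that]] by (auto simp: TM_def inc_def)
  \<comment> \<open>The support statement is carried along because it isolates the coefficient at a
    new exponent from the remaining summands.\<close>
  have canon: "(\<forall>\<beta>. \<beta> \<notin> S \<longrightarrow> \<Psi> X \<beta> = 0) \<and> (\<Psi> X = 0 \<longrightarrow> X = \<one>\<^bsub>I.G\<^esub>)" if "canon S X" for S X
    using that
  proof (induction rule: canon.induct)
    case one
    then show ?case using \<open>\<Psi> \<one>\<^bsub>I.G\<^esub> = 0\<close> by simp
  next
    case (step S X \<alpha> v)
    obtain c where c: "c \<noteq> 0" "\<Psi> (TM \<alpha> v) = (\<lambda>\<beta>. if \<beta> = \<alpha> then scl c (VV.kap v) else 0)"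
      using TM[OF step(3)] step(4) by blast
    have e: "\<Psi> (TM \<alpha> v \<otimes>\<^bsub>I.G\<^esub> X) = (\<lambda>\<beta>. if \<beta> = \<alpha> then scl c (VV.kap v) else 0) + \<Psi> X"
      using add[OF TM_closed[OF step(3,4)] canon_closed[OF step(1)]] c(2) by simp
    have "TM \<alpha> v \<otimes>\<^bsub>I.G\<^esub> X = \<one>\<^bsub>I.G\<^esub>" if z: "\<Psi> (TM \<alpha> v \<otimes>\<^bsub>I.G\<^esub> X) = 0"
    proof -
      have "scl c (VV.kap v) + \<Psi> X \<alpha> = 0" using fun_cong[OF z, of \<alpha>] unfolding e by simp
      then have "scl c (VV.kap v) = 0" using step.IH step(2) by simp
      then have "VV.kap v = 0" using c(1) by simp
      then have "v = \<zero>\<^bsub>V\<^esub>" using VV.kap_inj[OF step(4), of "\<zero>\<^bsub>V\<^esub>"] VV.kap_zero by simp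
      then have T1: "TM \<alpha> v = \<one>\<^bsub>I.G\<^esub>" using TM_zero[OF step(3)] by simp
      then have "TM \<alpha> v \<otimes>\<^bsub>I.G\<^esub> X = X" using canon_closed[OF step(1)] by simp
      then show ?thesis using z step.IH by simp
    qed
    moreover have "\<Psi> (TM \<alpha> v \<otimes>\<^bsub>I.G\<^esub> X) \<beta> = 0" if "\<beta> \<notin> insert \<alpha> S" for \<beta>
      unfolding e using that step.IH by simp
    ultimately show ?case by blast
  qed
  have "inj_on \<Psi> (carrier I.G)"
  proof (rule inj_onI)
    fix X Y assume XY: "X \<in> carrier I.G" "Y \<in> carrier I.G" "\<Psi> X = \<Psi> Y"
    let ?Z = "X \<otimes>\<^bsub>I.G\<^esub> inv\<^bsub>I.G\<^esub> Y"
    have "?Z \<otimes>\<^bsub>I.G\<^esub> Y = X" using XY by (simp add: I.G.m_assoc)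
    then have "\<Psi> ?Z + \<Psi> Y = \<Psi> X" using add[of ?Z Y] XY by simp
    then have "\<Psi> ?Z = 0" using XY(3) by simp
    moreover obtain S where "canon S ?Z" using all_canon[of ?Z] XY by auto
    ultimately have "?Z = \<one>\<^bsub>I.G\<^esub>" using canon by blast
    then show "X = Y" using \<open>?Z \<otimes>\<^bsub>I.G\<^esub> Y = X\<close> XY by simp
  qed
  moreover have "W.Mset \<subseteq> \<Psi> ` carrier I.G"
  proof (rule W.Mset_generated)
    fix x y assume "x \<in> \<Psi> ` carrier I.G" "y \<in> \<Psi> ` carrier I.G"
    then obtain X Y where "x = \<Psi> X" "y = \<Psi> Y" "X \<in> carrier I.G" "Y \<in> carrier I.G" by blast
    then show "x + y \<in> \<Psi> ` carrier I.G" using add[of X Y] by (metis I.G.m_closed imageI)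
  next
    fix u assume "u \<in> UV"
    then obtain v where v: "u = VV.kap v" "v \<in> carrier V" by blast
    have "W.\<iota> u = \<Psi> (TX [] v)" using word[of "[]" v] v by (simp add: inc_def)
    then show "W.\<iota> u \<in> \<Psi> ` carrier I.G" using TX_closed[of "[]" v] v by auto
  next
    fix t x assume t: "t < m" and "x \<in> \<Psi> ` carrier I.G"
    then obtain X where X: "x = \<Psi> X" "X \<in> carrier I.G" by blast
    have "\<Psi> (gm (xm m t) X) = free_act W.Mrec W.sig (free_gen (xm m t)) (\<Psi> X)"
      using I.universal_mul[OF W.sig_lie_module inc \<Psi> free_gen_closed[OF W.xm_sl[OF t]] X(2)] by blast
    also have "\<dots> = W.X t x" using N.fact_gen[OF W.xm_sl[OF t], of "\<Psi> X"] cl[OF X(2)] W.sig_xm[OF t] X(1) by simp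
    finally show "W.X t x \<in> \<Psi> ` carrier I.G"
      using I.imul_closed[OF free_gen_closed[OF W.xm_sl[OF t]] X(2)] by (metis imageI)
  qed
  ultimately have "bij_betw \<Psi> (carrier I.G) (carrier W.Mrec)" using cl by (auto simp: bij_betw_def)
  then show thesis using \<Psi> that by blast
qed

theorem simple_gen_verma_iff:
  "simple_lie_module (sl (m + 1)) (gen_verma m V \<rho>) (gen_verma_act m V \<rho>) \<longleftrightarrow>
    \<not> (\<exists>W. W.submod W \<and> W \<noteq> {0} \<and> W \<noteq> W.Mset)"
proof -
  obtain \<Psi> where \<Psi>: "\<Psi> \<in> hom I.G (add_monoid W.Mrec)" "bij_betw \<Psi> (carrier I.G) (carrier W.Mrec)"
    "\<And>f v. f \<in> carrier I.AL \<Longrightarrow> v \<in> carrier V \<Longrightarrow> \<Psi> (I.T f v) = free_act W.Mrec W.sig f (inc v)"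
    using induced_iso by blast
  have inc: "inc v \<in> carrier W.Mrec" if "v \<in> carrier V" for v using inc_Mset that by simp
  show ?thesis
    unfolding gen_verma_def gen_verma_act_def Suc_eq_plus1[symmetric]
    using I.induced_simple_iff[OF W.sig_lie_module inc \<Psi>(1,3,2)] W.simple_Mrec_iff by blast
qed

end

theorem theorem4p11:
  fixes m ibar :: nat and \<mu> :: "nat \<Rightarrow> complex"
    and V :: "(complex, 'v) module" and \<rho> :: "complex mat \<Rightarrow> 'v \<Rightarrow> 'v"
  assumes "m \<ge> 1" and "ibar \<in> {1..m}"
    and "\<forall>i\<in>{1..ibar}. \<mu> i = \<mu> 1"
    and "\<forall>i\<in>{ibar+1..m}. \<mu> i = \<mu> m"
    and "(\<forall>i\<in>{1..m}. \<mu> i = \<mu> 1) \<longrightarrow> ibar = m"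
    and "simple_highest_weight_module m \<mu> V \<rho>"
  shows "\<not> simple_lie_module (sl (m+1)) (gen_verma m V \<rho>) (gen_verma_act m V \<rho>) \<longleftrightarrow>
    (ibar \<noteq> m \<and>
      (\<exists>l::nat. l \<ge> 1 \<and> of_nat l = \<mu> ibar + of_nat m + 1 - of_nat ibar \<and>
         \<mu> ibar - \<mu> (ibar+1) \<notin> of_nat ` {0..l-1})) \<or>
    (\<exists>k::nat. k \<ge> 1 \<and> of_nat k = \<mu> m + 1)"
proof -
  interpret hw_levi m \<mu> V \<rho> by unfold_locales (rule assms(6))
  obtain i0 where i0: "ibar = Suc i0" "i0 < m" using assms(2) by (cases ibar) auto
  obtain m' where m': "m = Suc m'" using assms(1) by (cases m) auto
  \<comment> \<open>Translates the zero-based count of indices from \<open>i0\<close> on into the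
    expression \<open>m + 1 - ibar\<close> of the statement.\<close>
  have mi: "of_nat (m - i0) = (of_nat m + 1 - of_nat ibar :: complex)" using i0 by (simp add: of_nat_diff)
  \<comment> \<open>The bound \<open>l \<ge> 1\<close> matters: truncated subtraction would turn
    \<open>{0..l-1}\<close> into \<open>{0}\<close> for \<open>l = 0\<close>.\<close>
  have rng: "x \<notin> of_nat ` {0..l-1} \<longleftrightarrow> (\<forall>r<l. x \<noteq> of_nat r)" if "l \<ge> 1" for x :: complex and l :: nat
  proof -
    have "{0..l-1} = {..<l}" using that by auto
    then show ?thesis by auto
  qed
  show ?thesis unfolding simple_gen_verma_iff not_not
  proof
    assume "\<exists>W. W.submod W \<and> W \<noteq> {0} \<and> W \<noteq> W.Mset"
    then obtain W where W: "W.submod W" "W \<noteq> {0}" "W \<noteq> W.Mset" by blast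
    have "(\<exists>k\<ge>1. of_nat k = \<mu> (Suc (m - 1)) + 1) \<or>
      (i0 \<noteq> m - 1 \<and> (\<exists>k\<ge>1. of_nat k = \<mu> (Suc i0) + of_nat (m - i0) \<and> (\<forall>r<k. \<mu> (Suc i0) - \<mu> (Suc (Suc i0)) \<noteq> of_nat r)))"
    proof (rule W.proper_submod_imp[OF W i0(2)])
      show "\<mu> (Suc i) = \<mu> (Suc (Suc i))" if "i < i0" for i
        using assms(3) i0 that by (metis Suc_le_eq atLeastAtMost_iff le_add1 less_Suc_eq_le nat_less_le plus_1_eq_Suc)
      show "\<mu> (Suc i) = \<mu> (Suc (Suc i))" if "i0 < i" "Suc i < m" for i
      proof -
        have "Suc i \<in> {ibar + 1..m}" "Suc (Suc i) \<in> {ibar + 1..m}" using that i0 by auto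
        then show ?thesis using assms(4) by metis
      qed
    qed
    then show "(ibar \<noteq> m \<and> (\<exists>l::nat. l \<ge> 1 \<and> of_nat l = \<mu> ibar + of_nat m + 1 - of_nat ibar \<and>
         \<mu> ibar - \<mu> (ibar+1) \<notin> of_nat ` {0..l-1})) \<or> (\<exists>k::nat. k \<ge> 1 \<and> of_nat k = \<mu> m + 1)"
    proof
      assume "\<exists>k\<ge>1. of_nat k = \<mu> (Suc (m - 1)) + 1"
      then show ?thesis using m' by auto
    next
      assume a: "i0 \<noteq> m - 1 \<and> (\<exists>k\<ge>1. of_nat k = \<mu> (Suc i0) + of_nat (m - i0) \<and> (\<forall>r<k. \<mu> (Suc i0) - \<mu> (Suc (Suc i0)) \<noteq> of_nat r))"
      then obtain k where k: "k \<ge> 1" "of_nat k = \<mu> (Suc i0) + of_nat (m - i0)" "\<forall>r<k. \<mu> (Suc i0) - \<mu> (Suc (Suc i0)) \<noteq> of_nat r" by blast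
      have "of_nat k = \<mu> ibar + of_nat m + 1 - of_nat ibar" using k(2) mi i0(1) by (simp only: add_diff_eq add.assoc)
      moreover have "\<mu> ibar - \<mu> (ibar+1) \<notin> of_nat ` {0..k-1}" using k(1,3) i0(1) rng[OF k(1)] by simp
      moreover have "ibar \<noteq> m" using a i0 by auto
      ultimately show ?thesis using k(1) by blast
    qed
  next
    assume "(ibar \<noteq> m \<and> (\<exists>l::nat. l \<ge> 1 \<and> of_nat l = \<mu> ibar + of_nat m + 1 - of_nat ibar \<and>
         \<mu> ibar - \<mu> (ibar+1) \<notin> of_nat ` {0..l-1})) \<or> (\<exists>k::nat. k \<ge> 1 \<and> of_nat k = \<mu> m + 1)"
    then show "\<exists>W. W.submod W \<and> W \<noteq> {0} \<and> W \<noteq> W.Mset"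
    proof
      assume a: "ibar \<noteq> m \<and> (\<exists>l::nat. l \<ge> 1 \<and> of_nat l = \<mu> ibar + of_nat m + 1 - of_nat ibar \<and>
         \<mu> ibar - \<mu> (ibar+1) \<notin> of_nat ` {0..l-1})"
      then obtain l :: nat where l: "l \<ge> 1" "of_nat l = \<mu> ibar + of_nat m + 1 - of_nat ibar" "\<mu> ibar - \<mu> (ibar+1) \<notin> of_nat ` {0..l-1}" by blast
      show ?thesis
      proof (rule W.proper_submod_exists[OF i0(2)])
        show "\<mu> (Suc t) = \<mu> (ibar + 1)" if "i0 < t" "t < m" for t
        proof -
          have "Suc t \<in> {ibar + 1..m}" "ibar + 1 \<in> {ibar + 1..m}" using that i0 a assms(2) by auto
          then show ?thesis using assms(4) by metis
        qed
        show "l \<ge> 1" by (rule l(1))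
        show "of_nat l = \<mu> (Suc i0) + of_nat (m - i0)" using l(2) mi i0(1) by (simp only: add_diff_eq add.assoc)
        show "\<mu> (Suc i0) - \<mu> (ibar + 1) \<noteq> of_nat r" if "r < l" for r
          using l(3) rng[OF l(1)] that i0(1) by simp
      qed
    next
      assume "\<exists>k::nat. k \<ge> 1 \<and> of_nat k = \<mu> m + 1"
      then obtain k :: nat where k: "k \<ge> 1" "of_nat k = \<mu> m + 1" by blast
      show ?thesis
      \<comment> \<open>The second condition is the case in which no index follows
        \<open>i0\<close>. The choice \<open>b = \<mu> m + 1\<close> makes the difference -1, which
        is never a natural number, so nothing is excluded.\<close>
      proof (rule W.proper_submod_exists[of "m - 1" "\<mu> m + 1" k])
        show "\<mu> (Suc (m - 1)) - (\<mu> m + 1) \<noteq> of_nat r" for r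
        proof
          assume "\<mu> (Suc (m - 1)) - (\<mu> m + 1) = of_nat r"
          then have "- 1 = (of_nat r :: complex)" using m' by simp
          then have "of_nat (Suc r) = (1::complex) + - 1" by (simp only: of_nat_Suc)
          then show False by (simp del: of_nat_Suc)
        qed
      qed (use k m' in auto)
    qed
  qed
qed

end
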